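(* Let $f:\mathbb{R}^N\to\mathbb{R}$ be twice continuously differentiable with $\|\nabla^2 f(x)\|_2\le L$ for all $x\in\mathbb{R}^N$ (where $L>0$), and $\inf_{x\in\mathbb{R}^N} f(x)>-\infty$. Let $0<\beta<\frac12$ and $\gamma>0$, and let $(x^k)_{k\ge 0}\subset\mathbb{R}^N$ be a sequence generated from starting points $x^0,x^1\in\mathbb{R}^N$ by the heavy-ball proximal point algorithm $$x^{k+1}\in\mathbf{Prox}_{\gamma f}\bigl(x^k+\beta(x^k-x^{k-1})\bigr),\qquad k\ge 1.$$ Then $\lim_{k}\|\nabla f(x^k)\|=0$. Furthermore, if $f$ is semi-algebraic and coercive, then $(x^k)_{k\ge 0}$ converges to some critical point $x^*$ of $f$.
   Context: $\|\cdot\|_2$ is the spectral norm. For a function $J$ (not necessarily convex), $\mathbf{Prox}_{J}(z):=\arg\min_{x}\{J(x)+\frac{\|x-z\|^2}{2}\}$ (the set of global minimizers; $x^{k+1}$ may be any of its elements). A point $x^*$ is a critical point of $f$ if $\nabla f(x^* )=0$. $f$ is coercive if $f(x)\to+\infty$ as $\|x\|\to+\infty$. $f$ is semi-algebraic if its graph is a semi-algebraic set. *)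

theory Defs
  imports "HOL-Analysis.Analysis"
begin

definition grad :: "('a::euclidean_space \<Rightarrow> real) \<Rightarrow> 'a \<Rightarrow> 'a" where
  "grad f x = (THE D. GDERIV f x :> D)"

definition hessian :: "(real ^ 'n \<Rightarrow> real) \<Rightarrow> real ^ 'n \<Rightarrow> real ^ 'n ^ 'n" where
  "hessian f x = jacobian (grad f) (at x)"

definition twice_continuously_differentiable :: "(real ^ 'n \<Rightarrow> real) \<Rightarrow> bool" where
  "twice_continuously_differentiable f \<longleftrightarrow>
     (\<forall>x. f differentiable (at x)) \<and> (\<forall>x. grad f differentiable (at x)) \<and>
     continuous_on UNIV (hessian f)"

(* operator norm induced by the Euclidean norms *)
definition spectral_norm :: "real ^ 'n ^ 'm \<Rightarrow> real" where
  "spectral_norm A = onorm (\<lambda>v. A *v v)"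

definition Prox :: "('a::euclidean_space \<Rightarrow> real) \<Rightarrow> 'a \<Rightarrow> 'a set" where
  "Prox J z = {x. is_arg_min (\<lambda>u. J u + (norm (u - z))\<^sup>2 / 2) (\<lambda>_. True) x}"

definition critical_point :: "('a::euclidean_space \<Rightarrow> real) \<Rightarrow> 'a \<Rightarrow> bool" where
  "critical_point f x \<longleftrightarrow> f differentiable (at x) \<and> grad f x = 0"

definition coercive :: "('a::euclidean_space \<Rightarrow> real) \<Rightarrow> bool" where
  "coercive f \<longleftrightarrow> filterlim f at_top at_infinity"

(* On a Euclidean space, real_polynomial_function describes exactly the polynomials
   in the coordinates with real coefficients. *)
definition semialgebraic_set :: "'a::euclidean_space set \<Rightarrow> bool" where
  "semialgebraic_set S \<longleftrightarrow>
     (\<exists>(p::nat) (q::nat) g h.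
        (\<forall>i<p. \<forall>j<q. real_polynomial_function (g i j) \<and> real_polynomial_function (h i j)) \<and>
        S = (\<Union>i<p. \<Inter>j<q. {x. g i j x = 0 \<and> h i j x < 0}))"

definition semialgebraic :: "('a::euclidean_space \<Rightarrow> real) \<Rightarrow> bool" where
  "semialgebraic f \<longleftrightarrow> semialgebraic_set {(x, y). y = f x}"

lemma grad_eq:
  assumes "GDERIV f x :> D"
  shows "grad f x = D"
proof -
  have "D' = D" if "GDERIV f x :> D'" for D'
  proof -
    have "(\<lambda>h. inner h D') = (\<lambda>h. inner h D)"
      using that assms unfolding gderiv_def by (rule has_derivative_unique)
    then show ?thesis
      by (metis vector_eq_ldot)
  qed
  with assms show ?thesis
    unfolding grad_def by blast
qed

lemma GDERIV_grad:
  assumes "f differentiable (at x)"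
  shows "GDERIV f x :> grad f x"
proof -
  obtain f' where f': "(f has_derivative f') (at x)"
    using assms by (auto simp: differentiable_def)
  then have "linear f'"
    by (rule has_derivative_linear)
  then have "f' = (\<lambda>h. inner h (adjoint f' 1))"
    by (simp add: adjoint_works)
  with f' have "GDERIV f x :> adjoint f' 1"
    by (simp add: gderiv_def)
  then show ?thesis
    using grad_eq by metis
qed

end

theory Submission
  imports Defs "HOL-Computational_Algebra.Fundamental_Theorem_Algebra"
begin

text \<open>
  The energy \<open>\<gamma> f(x\<^sub>k) + \<beta>/2 |x\<^sub>k - x\<^sub>k\<^sub>-\<^sub>1|\<^sup>2\<close> drops by at least \<open>(1 - 2\<beta>)/2 |x\<^sub>k\<^sub>+\<^sub>1 - x\<^sub>k|\<^sup>2\<close> in each step,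
  because the proximal point is no worse than the candidate \<open>x\<^sub>k\<close>. So the steps tend to 0, and the
  optimality condition of the proximal problem writes \<open>\<gamma> \<nabla>f(x\<^sub>k\<^sub>+\<^sub>1)\<close> as a combination of the last
  two steps, which gives the first claim.

  For the second claim the steps must be summable. This follows from a Lojasiewicz inequality
  \<open>(f x - c)\<^sup>\<theta> \<le> C |\<nabla>f x|\<close> with \<open>\<theta> < 1\<close> on a ball that contains the iterates, where \<open>c\<close> is the limit
  of the values: composing the energy gap with the concave function \<open>r \<mapsto> r\<^sup>1\<^sup>-\<^sup>\<theta>\<close> turns the quadratic
  descent into a telescoping bound for the lengths of the steps (\<open>finite_length_if_lojasiewicz_step\<close>).
  The exponent is taken to be at least \<open>1/2\<close>, so that the quadratic term of the energy is harmless.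

  The inequality itself is semi-algebraic geometry, built here from quantifier elimination.
  \<^item> A predicate is called definable if it only depends on the signs of finitely many polynomials.
    Definable predicates are closed under quantifiers (\<open>definable_ex\<close>). The proof is the one of Cohen
    and Hoermander in a semantic form: if finitely many polynomial functions of the parameters have
    equal signs at two parameters, then an increasing bijection of the line matches the signs of all
    polynomials under consideration (\<open>sign_determined\<close>). Its induction step rests on the fact that a
    polynomial is monotone between the zeros of its derivative.
  \<^item> Hence a definable predicate of one real variable is constant to the right of every point. From
    this alone, definable functions near \<open>0+\<close> are strictly monotone or constant
    (\<open>definable_fun_monotone_germ\<close>), and an infinitesimal definable function is bounded by a
    fractional power (\<open>definable_graph_power_bound\<close>).
  \<^item> If \<open>|\<nabla>f| \<le> C s\<close> happened on the levels \<open>f = c + s\<close> for all small \<open>s\<close>, one could select a bounded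
    definable curve of such points. Its coordinates are monotone, so it has finite length, yet climbing
    from level \<open>s\<close> to level \<open>t\<close> costs a length of at least about \<open>(t - s)/(2 C s)\<close>, and these
    costs add up to a divergent logarithm (\<open>no_slow_definable_curve\<close>). So
    \<open>s / min |\<nabla>f|\<close> tends to 0 with \<open>s\<close>; being definable, it is bounded by a power of \<open>s\<close>, and
    this is the inequality with an exponent below 1.
\<close>

section \<open>Sign patterns of functions monotone on the gaps of a finite set\<close>

text \<open>Neither point lies in \<open>Z\<close> and no point of \<open>Z\<close> separates them. The pointwise form keeps every
  use within linear arithmetic.\<close>

definition same_gap :: "real set \<Rightarrow> real \<Rightarrow> real \<Rightarrow> bool" where
  "same_gap Z t u \<longleftrightarrow> (\<forall>z\<in>Z. (z < t \<and> z < u) \<or> (t < z \<and> u < z))"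

text \<open>What matters about a nonconstant polynomial \<open>h\<close> if \<open>Z\<close> contains the zeros of its derivative:
  \<open>D\<close> stands for any function with the sign of the derivative, the ends \<open>x\<close> and \<open>y\<close> may
  themselves belong to \<open>Z\<close>, and growth at infinity decides the signs on the two unbounded gaps. The
  class is closed under increasing changes of the variable, unlike the class of polynomials.\<close>

definition gapwise_monotone :: "real set \<Rightarrow> (real \<Rightarrow> real) \<Rightarrow> (real \<Rightarrow> real) \<Rightarrow> bool" where
  "gapwise_monotone Z D h \<longleftrightarrow> continuous_on UNIV h \<and>
     (\<forall>x y. x < y \<longrightarrow> {x<..<y} \<inter> Z = {} \<longrightarrow>
        (\<forall>t. x < t \<longrightarrow> t < y \<longrightarrow> (0 < D t \<and> h x < h y) \<or> (D t < 0 \<and> h y < h x))) \<and>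
     (\<forall>M. \<exists>K. \<forall>x. K \<le> \<bar>x\<bar> \<longrightarrow> M \<le> \<bar>h x\<bar>)"

lemma finite_isolated:
  fixes Z :: "real set"
  assumes "finite Z"
  obtains x y where "x < t" "t < y" "\<And>z. z \<in> Z \<Longrightarrow> z < x \<or> z = t \<or> y < z"
proof -
  obtain d where d: "d > 0" "\<And>z. z \<in> Z \<Longrightarrow> z \<noteq> t \<Longrightarrow> d \<le> dist t z"
    using finite_set_avoid[OF assms, of t] by blast
  show ?thesis
    by (rule that[of "t - d / 2" "t + d / 2"]) (use d in \<open>force simp: dist_real_def\<close>)+
qed

lemma gapwise_monotoneD:
  assumes "gapwise_monotone Z D h"
  shows "continuous_on UNIV h"
    and "\<And>x y t. x < t \<Longrightarrow> t < y \<Longrightarrow> {x<..<y} \<inter> Z = {} \<Longrightarrow>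
           (0 < D t \<and> h x < h y) \<or> (D t < 0 \<and> h y < h x)"
    and "\<And>M. \<exists>K. \<forall>x. K \<le> \<bar>x\<bar> \<longrightarrow> M \<le> \<bar>h x\<bar>"
proof -
  show "continuous_on UNIV h" and "\<And>M. \<exists>K. \<forall>x. K \<le> \<bar>x\<bar> \<longrightarrow> M \<le> \<bar>h x\<bar>"
    using assms unfolding gapwise_monotone_def by auto
  fix x y t :: real assume a: "x < t" "t < y" and b: "{x<..<y} \<inter> Z = {}"
  then have "x < y" by simp
  with a b assms show "(0 < D t \<and> h x < h y) \<or> (D t < 0 \<and> h y < h x)"
    unfolding gapwise_monotone_def by blast
qed

lemma gapwise_monotone_reflect:
  assumes "gapwise_monotone Z D h"
  shows "gapwise_monotone (uminus ` Z) (\<lambda>t. - D (- t)) (\<lambda>t. h (- t))"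
  unfolding gapwise_monotone_def
proof (intro conjI allI impI)
  show "continuous_on UNIV (\<lambda>t. h (- t))"
    using gapwise_monotoneD(1)[OF assms]
    by (intro continuous_on_compose2[of UNIV h UNIV uminus] continuous_intros) auto
next
  fix x y t :: real
  assume a: "x < t" "t < y" and b: "{x<..<y} \<inter> uminus ` Z = {}"
  have "{-y<..<-x} \<inter> Z = {}"
    using b by (force simp: disjoint_iff image_iff)
  from gapwise_monotoneD(2)[OF assms _ _ this, of "-t"] a
  show "0 < - D (- t) \<and> h (- x) < h (- y) \<or> - D (- t) < 0 \<and> h (- y) < h (- x)"
    by auto
next
  fix M show "\<exists>K. \<forall>x. K \<le> \<bar>x\<bar> \<longrightarrow> M \<le> \<bar>h (- x)\<bar>"
    using gapwise_monotoneD(3)[OF assms, of M] by (metis abs_minus_cancel)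
qed

lemma gapwise_monotone_negate:
  assumes "gapwise_monotone Z D h"
  shows "gapwise_monotone Z (\<lambda>t. - D t) (\<lambda>t. - h t)"
  unfolding gapwise_monotone_def
proof (intro conjI allI impI)
  show "continuous_on UNIV (\<lambda>t. - h t)"
    using gapwise_monotoneD(1)[OF assms] by (rule continuous_on_minus)
  show "\<exists>K. \<forall>x. K \<le> \<bar>x\<bar> \<longrightarrow> M \<le> \<bar>- h x\<bar>" for M
    using gapwise_monotoneD(3)[OF assms, of M] by simp
  fix x y t :: real
  assume "x < t" "t < y" "{x<..<y} \<inter> Z = {}"
  from gapwise_monotoneD(2)[OF assms this]
  show "0 < - D t \<and> - h x < - h y \<or> - D t < 0 \<and> - h y < - h x" by auto
qed

text \<open>An increasing function is negative somewhere on a gap exactly if the gap has no left end or the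
  value at the left end is negative. Both conditions are the same for \<open>h\<close> and for \<open>k\<close>.\<close>

lemma negative_in_increasing_gap:
  assumes fin: "finite Z" and h: "gapwise_monotone Z D h" and k: "gapwise_monotone Z D k"
    and sg: "\<And>z. z \<in> Z \<Longrightarrow> sgn (h z) = sgn (k z)"
    and t: "t \<notin> Z" "0 < D t" "h t < 0"
  shows "\<exists>u. same_gap Z t u \<and> k u < 0"
proof -
  obtain y where y: "t < y" "\<And>z. z \<in> Z \<Longrightarrow> z < t \<or> y < z"
    using finite_isolated[OF fin, of t] t(1) by (metis order.strict_trans)
  show ?thesis
  proof (cases "\<exists>z\<in>Z. z < t")
    case False
    obtain K where K: "\<And>x. K \<le> \<bar>x\<bar> \<Longrightarrow> \<bar>k y\<bar> + 1 \<le> \<bar>k x\<bar>"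
      using gapwise_monotoneD(3)[OF k] by blast
    \<comment> \<open>Far to the left \<open>|k|\<close> exceeds \<open>|k y|\<close>, and an increasing \<open>k\<close> must be negative there.\<close>
    define u where "u = min (t - 1) (- \<bar>K\<bar>)"
    have u: "u < t" "K \<le> \<bar>u\<bar>" by (auto simp: u_def)
    have "{u<..<y} \<inter> Z = {}"
    proof -
      have "z \<notin> Z" if "z < y" for z
        using y(2)[of z] False that by (meson less_asym)
      then show ?thesis by auto
    qed
    from gapwise_monotoneD(2)[OF k u(1) y(1) this] t(2) have "k u < k y" by auto
    with K[OF u(2)] have "k u < 0" by auto
    moreover have "same_gap Z t u"
      using False y u(1) unfolding same_gap_def by (meson less_trans)
    ultimately show ?thesis by blast
  next
    case True
    define a where "a = Max {z\<in>Z. z < t}"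
    have f: "finite {z\<in>Z. z < t}" and ne: "{z\<in>Z. z < t} \<noteq> {}"
      using True fin by auto
    have a: "a \<in> Z" "a < t" using Max_in[OF f ne] by (simp_all add: a_def)
    have le: "z \<le> a" if "z \<in> Z" "z < t" for z
      using Max_ge[OF f, of z] that by (simp add: a_def)
    have gap: "{a<..<y} \<inter> Z = {}"
    proof -
      have "z \<notin> Z" if "a < z" "z < y" for z
        using y(2)[of z] le[of z] that by linarith
      then show ?thesis by auto
    qed
    define s where "s = (a + t) / 2"
    have s: "a < s" "s < t" using a by (auto simp: s_def)
    have "0 < D s"
      using gapwise_monotoneD(2)[OF h a(2) y(1) gap] gapwise_monotoneD(2)[OF h s(1) _ gap] s(2) y(1) t(2)
      by fastforce
    moreover have "{a<..<t} \<inter> Z = {}" using gap y(1) by (simp add: disjoint_iff)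
    ultimately have "h a < h t"
      using gapwise_monotoneD(2)[OF h s(1) s(2)] by fastforce
    with t(3) have "h a < 0" by simp
    with sg[OF a(1)] have "k a < 0" by (simp add: sgn_if split: if_splits)
    moreover have "isCont k a"
      using gapwise_monotoneD(1)[OF k] by (simp add: continuous_on_eq_continuous_at)
    ultimately have "eventually (\<lambda>u. k u < 0) (at_right a)"
      by (metis filterlim_at_split isCont_def order_tendstoD(2))
    moreover have "eventually (\<lambda>u. u \<in> {a<..<t}) (at_right a)"
      by (rule eventually_at_right_real[OF a(2)])
    ultimately have "eventually (\<lambda>u. k u < 0 \<and> u \<in> {a<..<t}) (at_right a)"
      by (rule eventually_conj)
    from eventually_happens'[OF trivial_limit_at_right_real this]
    obtain u where u: "k u < 0" "a < u" "u < t" by auto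
    have "same_gap Z t u"
      unfolding same_gap_def
    proof
      fix z assume z: "z \<in> Z"
      show "z < t \<and> z < u \<or> t < z \<and> u < z"
        using y(2)[OF z] le[OF z] u y(1) by linarith
    qed
    with u(1) show ?thesis by blast
  qed
qed

lemma same_gap_reflect: "same_gap (uminus ` Z) (- t) (- u) \<longleftrightarrow> same_gap Z t u"
  unfolding same_gap_def by auto

lemma same_gap_trans:
  assumes "same_gap Z t u" "same_gap Z u v"
  shows "same_gap Z t v"
  unfolding same_gap_def
proof
  fix z assume "z \<in> Z"
  with assms have "z < t \<and> z < u \<or> t < z \<and> u < z" "z < u \<and> z < v \<or> u < z \<and> v < z"
    unfolding same_gap_def by blast+
  then show "z < t \<and> z < v \<or> t < z \<and> v < z" by linarith
qed

lemma same_gap_between: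
  assumes "same_gap Z t u" "same_gap Z t v" "u \<le> w" "w \<le> v"
  shows "same_gap Z t w"
  unfolding same_gap_def
proof
  fix z assume "z \<in> Z"
  with assms(1,2) have "z < t \<and> z < u \<or> t < z \<and> u < z" "z < t \<and> z < v \<or> t < z \<and> v < z"
    unfolding same_gap_def by blast+
  with assms(3,4) show "z < t \<and> z < w \<or> t < z \<and> w < z" by linarith
qed

text \<open>Decreasing gaps are reduced to increasing ones by reflecting the line.\<close>

lemma negative_in_gap:
  assumes fin: "finite Z" and h: "gapwise_monotone Z D h" and k: "gapwise_monotone Z D k"
    and sg: "\<And>z. z \<in> Z \<Longrightarrow> sgn (h z) = sgn (k z)"
    and t: "t \<notin> Z" "h t < 0"
  shows "\<exists>u. same_gap Z t u \<and> k u < 0"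
proof (cases "0 < D t")
  case True
  then show ?thesis using negative_in_increasing_gap[OF fin h k sg t(1) _ t(2)] by blast
next
  case False
  obtain x y where xy: "x < t" "t < y" "\<And>z. z \<in> Z \<Longrightarrow> z < x \<or> z = t \<or> y < z"
    using finite_isolated[OF fin] by blast
  have "{x<..<y} \<inter> Z = {}"
  proof -
    have "z \<notin> Z" if "x < z" "z < y" for z
      using xy(3)[of z] that t(1) by auto
    then show ?thesis by auto
  qed
  from gapwise_monotoneD(2)[OF h xy(1,2) this] False have D: "D t < 0" by auto
  have "\<exists>u. same_gap (uminus ` Z) (- t) u \<and> k (- u) < 0"
    by (rule negative_in_increasing_gap[OF _ gapwise_monotone_reflect[OF h] gapwise_monotone_reflect[OF k]])
       (use fin sg t D in auto)
  then show ?thesis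
    by (metis add.inverse_inverse same_gap_reflect)
qed

text \<open>A zero of \<open>h\<close> inside a gap forces both signs of \<open>h\<close> there, hence both signs of \<open>k\<close>, and
  then the intermediate value theorem yields a zero of \<open>k\<close>.\<close>

lemma sign_in_gap:
  assumes fin: "finite Z" and h: "gapwise_monotone Z D h" and k: "gapwise_monotone Z D k"
    and sg: "\<And>z. z \<in> Z \<Longrightarrow> sgn (h z) = sgn (k z)"
    and t: "t \<notin> Z"
  shows "\<exists>u. same_gap Z t u \<and> sgn (k u) = sgn (h t)"
proof -
  have neg: "\<exists>u. same_gap Z t u \<and> k u < 0" if "h v < 0" "same_gap Z t v" for v
  proof -
    have "v \<notin> Z" using that(2) by (auto simp: same_gap_def)
    from negative_in_gap[OF fin h k sg this that(1)] that(2) show ?thesis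
      using same_gap_trans by blast
  qed
  have pos: "\<exists>u. same_gap Z t u \<and> 0 < k u" if "0 < h v" "same_gap Z t v" for v
  proof -
    have "v \<notin> Z" using that(2) by (auto simp: same_gap_def)
    from negative_in_gap[OF fin gapwise_monotone_negate[OF h] gapwise_monotone_negate[OF k] _ this]
      that sg
    have "\<exists>u. same_gap Z v u \<and> 0 < k u" by (auto simp: sgn_minus)
    then show ?thesis
      using that(2) same_gap_trans by blast
  qed
  have refl: "same_gap Z t t" using t unfolding same_gap_def by (metis linorder_neqE)
  show ?thesis
  proof (cases "h t" "0::real" rule: linorder_cases)
    case less
    with neg[OF less refl] show ?thesis by (metis sgn_neg)
  next
    case greater
    with pos[OF greater refl] show ?thesis by (metis sgn_pos)
  next
    case equal
    obtain x y where xy: "x < t" "t < y" "\<And>z. z \<in> Z \<Longrightarrow> z < x \<or> z = t \<or> y < z"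
      using finite_isolated[OF fin] by blast
    then have xy3: "\<And>z. z \<in> Z \<Longrightarrow> z < x \<or> y < z" using t by blast
    have gy: "same_gap Z t y"
      unfolding same_gap_def
    proof
      fix z assume "z \<in> Z"
      from xy3[OF this] xy(1,2) show "z < t \<and> z < y \<or> t < z \<and> y < z" by linarith
    qed
    have gx: "same_gap Z t x"
      unfolding same_gap_def
    proof
      fix z assume "z \<in> Z"
      from xy3[OF this] xy(1,2) show "z < t \<and> z < x \<or> t < z \<and> x < z" by linarith
    qed
    have e3: "{x<..<y} \<inter> Z = {}"
    proof -
      have False if "z \<in> Z" "x < z" "z < y" for z
        using xy3[OF that(1)] that(2,3) by linarith
      then show ?thesis by auto
    qed
    then have e: "{t<..<y} \<inter> Z = {}" "{x<..<t} \<inter> Z = {}" "{x<..<y} \<inter> Z = {}"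
      using xy(1,2) by (simp_all add: disjoint_iff)
    define v w where "v = (x + t) / 2" and "w = (t + y) / 2"
    have vw: "x < v" "v < t" "t < w" "w < y" using xy by (auto simp: v_def w_def)
    have "(0 < D w \<and> h t < h y) \<or> (D w < 0 \<and> h y < h t)"
         "(0 < D v \<and> h x < h t) \<or> (D v < 0 \<and> h t < h x)"
         "(0 < D w \<and> h x < h y) \<or> (D w < 0 \<and> h y < h x)"
         "(0 < D v \<and> h x < h y) \<or> (D v < 0 \<and> h y < h x)"
      using gapwise_monotoneD(2)[OF h _ _ e(1), of w] gapwise_monotoneD(2)[OF h _ _ e(2), of v]
        gapwise_monotoneD(2)[OF h _ _ e(3), of w] gapwise_monotoneD(2)[OF h _ _ e(3), of v] vw
      by auto
    then have "(h y < 0 \<and> 0 < h x) \<or> (0 < h y \<and> h x < 0)"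
      using equal by auto
    then obtain v w where "h v < 0" "same_gap Z t v" "0 < h w" "same_gap Z t w"
      using gx gy by blast
    then obtain v' w' where v': "same_gap Z t v'" "k v' < 0" and w': "same_gap Z t w'" "0 < k w'"
      using neg pos by blast
    have ck: "continuous_on A k" for A
      by (rule continuous_on_subset[OF gapwise_monotoneD(1)[OF k]]) simp
    have "\<exists>u. (v' \<le> u \<and> u \<le> w' \<or> w' \<le> u \<and> u \<le> v') \<and> k u = 0"
    proof (cases "v' \<le> w'")
      case True
      then show ?thesis using IVT'[of k v' 0 w', OF _ _ _ ck] v'(2) w'(2) by auto
    next
      case False
      then show ?thesis using IVT2'[of k v' 0 w', OF _ _ _ ck] v'(2) w'(2) by auto
    qed
    then obtain u where u: "v' \<le> u \<and> u \<le> w' \<or> w' \<le> u \<and> u \<le> v'" "k u = 0" by blast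
    have "same_gap Z t u"
      using u(1) same_gap_between[OF v'(1) w'(1)] same_gap_between[OF w'(1) v'(1)] by blast
    with u(2) equal show ?thesis by auto
  qed
qed

text \<open>The map is the identity except on an interval around \<open>r\<close> and \<open>r'\<close> that avoids \<open>Z\<close>; there it is a
  concave bump: the minimum of a steep line through \<open>(a, a)\<close> and a flat line through \<open>(b, b)\<close>, which cross
  at \<open>(r, r')\<close>. As a maximum and minimum of increasing affine maps it is evidently increasing.\<close>

lemma order_iso_push_right:
  fixes Z :: "real set"
  assumes fin: "finite Z" and gap: "same_gap Z r r'" and "r < r'"
  shows "\<exists>\<alpha>. strict_mono \<alpha> \<and> surj \<alpha> \<and> (\<forall>z\<in>Z. \<alpha> z = z) \<and> \<alpha> r = r'"
proof -
  have nZ: "r \<notin> Z" "r' \<notin> Z" using gap by (auto simp: same_gap_def)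
  obtain a where a: "a < r" "\<And>z. z \<in> Z \<Longrightarrow> z < a \<or> r < z"
    using finite_isolated[OF fin, of r] nZ(1) by (metis order.strict_trans)
  obtain b where b: "r' < b" "\<And>z. z \<in> Z \<Longrightarrow> z < r' \<or> b < z"
    using finite_isolated[OF fin, of r'] nZ(2) by (metis order.strict_trans)
  define s1 where "s1 = (r' - a) / (r - a)"
  define s2 where "s2 = (b - r') / (b - r)"
  have s1: "1 \<le> s1" and s2: "0 < s2" "s2 \<le> 1"
    using a(1) b(1) \<open>r < r'\<close> by (auto simp: s1_def s2_def field_simps)
  define \<alpha> where "\<alpha> = (\<lambda>t. max t (min (a + s1 * (t - a)) (b + s2 * (t - b))))"
  have low: "\<alpha> t = t" if "t \<le> a" for t
  proof -
    have "s1 * (t - a) \<le> 1 * (t - a)"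
      by (rule mult_right_mono_neg) (use that s1 in auto)
    then show ?thesis by (simp add: \<alpha>_def)
  qed
  have high: "\<alpha> t = t" if "b \<le> t" for t
  proof -
    have "s2 * (t - b) \<le> 1 * (t - b)"
      by (rule mult_right_mono) (use that s2 in auto)
    then show ?thesis by (simp add: \<alpha>_def)
  qed
  have mono: "strict_mono \<alpha>"
  proof (rule strict_monoI)
    fix t u :: real assume "t < u"
    then have "s1 * (t - a) < s1 * (u - a)" "s2 * (t - b) < s2 * (u - b)"
      using s1 s2 by auto
    with \<open>t < u\<close> show "\<alpha> t < \<alpha> u" unfolding \<alpha>_def by linarith
  qed
  have cont: "continuous_on A \<alpha>" for A
    unfolding \<alpha>_def by (intro continuous_intros)
  have "\<exists>t. \<alpha> t = y" for y
  proof -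
    have "min y a \<le> max y b" "\<alpha> (min y a) \<le> y" "y \<le> \<alpha> (max y b)"
      by (auto simp: low high)
    from IVT'[OF this(2,3,1) cont] show ?thesis by blast
  qed
  then have "surj \<alpha>" by (metis surjI)
  moreover have "\<alpha> z = z" if "z \<in> Z" for z
  proof -
    have "z < r \<and> z < r' \<or> r < z \<and> r' < z"
      using gap that by (auto simp: same_gap_def)
    with a(2)[OF that] b(2)[OF that] low[of z] high[of z] show ?thesis by fastforce
  qed
  moreover have "\<alpha> r = r'"
  proof -
    have "s1 * (r - a) = r' - a" "s2 * (r - b) = r' - b"
      using a(1) b(1) \<open>r < r'\<close> by (simp_all add: s1_def s2_def field_simps)
    then show ?thesis using \<open>r < r'\<close> by (simp add: \<alpha>_def)
  qed
  ultimately show ?thesis using mono by blast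
qed

lemma strict_mono_inv_real:
  fixes \<alpha> :: "real \<Rightarrow> real"
  assumes "strict_mono \<alpha>" "surj \<alpha>"
  shows "strict_mono (inv \<alpha>)" "surj (inv \<alpha>)" "inv \<alpha> (\<alpha> t) = t" "\<alpha> (inv \<alpha> t) = t"
proof -
  have inj: "inj \<alpha>" using assms(1) strict_mono_imp_inj_on by blast
  show 1: "inv \<alpha> (\<alpha> t) = t" for t using inj by simp
  show 2: "\<alpha> (inv \<alpha> t) = t" for t using assms(2) by (simp add: surj_f_inv_f)
  show "surj (inv \<alpha>)" using 1 by (metis surjI)
  show "strict_mono (inv \<alpha>)"
    using 2 assms(1) by (intro strict_monoI) (metis strict_mono_less)
qed

lemma order_iso_comp:
  fixes \<alpha> \<phi> :: "real \<Rightarrow> real"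
  assumes "strict_mono \<alpha>" "surj \<alpha>" "strict_mono \<phi>" "surj \<phi>"
  shows "strict_mono (\<lambda>t. \<phi> (\<alpha> t))" "surj (\<lambda>t. \<phi> (\<alpha> t))"
  using assms comp_surj[of \<alpha> \<phi>] by (auto simp: strict_mono_def comp_def)

lemma same_gap_sym: "same_gap Z t u \<Longrightarrow> same_gap Z u t"
  unfolding same_gap_def by auto

lemma order_iso_push:
  fixes Z :: "real set"
  assumes fin: "finite Z" and gap: "same_gap Z r r'"
  shows "\<exists>\<alpha>. strict_mono \<alpha> \<and> surj \<alpha> \<and> (\<forall>z\<in>Z. \<alpha> z = z) \<and> \<alpha> r = r'"
proof (cases r r' rule: linorder_cases)
  case less
  with order_iso_push_right[OF assms] show ?thesis by blast
next
  case equal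
  then show ?thesis by (intro exI[of _ id]) (auto simp: strict_mono_def)
next
  case greater
  from order_iso_push_right[OF fin same_gap_sym[OF gap] this]
  obtain \<alpha> where \<alpha>: "strict_mono \<alpha>" "surj \<alpha>" "\<forall>z\<in>Z. \<alpha> z = z" "\<alpha> r' = r" by blast
  then show ?thesis
    using strict_mono_inv_real[OF \<alpha>(1,2)] by (intro exI[of _ "inv \<alpha>"]) metis
qed

lemma same_gap_order_iso:
  assumes "strict_mono (\<alpha> :: real \<Rightarrow> real)" "\<And>z. z \<in> Z \<Longrightarrow> \<alpha> z = z" "t \<notin> Z"
  shows "same_gap Z t (\<alpha> t)"
  unfolding same_gap_def
proof
  fix z assume z: "z \<in> Z"
  show "z < t \<and> z < \<alpha> t \<or> t < z \<and> \<alpha> t < z"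
    using strict_monoD[OF assms(1), of z t] strict_monoD[OF assms(1), of t z] assms(2)[OF z] assms(3) z
    by (cases z t rule: linorder_cases) auto
qed

text \<open>The points of \<open>S\<close> are moved one after the other. Points that are already in place lie in other
  gaps, so they can be added to the set that the next move keeps fixed.\<close>

lemma order_iso_aligning_points:
  fixes Z :: "real set"
  assumes "finite S" and fin: "finite Z" and "S \<inter> Z = {}"
    and "\<And>r s. r \<in> S \<Longrightarrow> s \<in> S \<Longrightarrow> same_gap Z r s \<Longrightarrow> r = s"
    and "\<And>r. r \<in> S \<Longrightarrow> \<exists>r'. same_gap Z r r' \<and> Q r'"
  shows "\<exists>\<alpha>. strict_mono \<alpha> \<and> surj \<alpha> \<and> (\<forall>z\<in>Z. \<alpha> z = z) \<and> (\<forall>r\<in>S. Q (\<alpha> r))"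
  using assms(1,3-5)
proof (induction S rule: finite_induct)
  case empty
  then show ?case by (intro exI[of _ id]) (auto simp: strict_mono_def)
next
  case (insert r S)
  have "\<exists>\<alpha>. strict_mono \<alpha> \<and> surj \<alpha> \<and> (\<forall>z\<in>Z. \<alpha> z = z) \<and> (\<forall>r\<in>S. Q (\<alpha> r))"
    by (rule insert.IH) (use insert.prems in auto)
  then obtain \<alpha> where \<alpha>: "strict_mono \<alpha>" "surj \<alpha>" "\<And>z. z \<in> Z \<Longrightarrow> \<alpha> z = z" "\<And>r. r \<in> S \<Longrightarrow> Q (\<alpha> r)"
    by blast
  obtain r' where r': "same_gap Z r r'" "Q r'" using insert.prems(3)[of r] by auto
  have nZ: "r \<notin> Z" using insert.prems(1) by auto
  have g: "same_gap Z (\<alpha> r) r'"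
    using same_gap_trans[OF same_gap_sym[OF same_gap_order_iso[OF \<alpha>(1,3) nZ]] r'(1)] .
  have "same_gap (Z \<union> \<alpha> ` S) (\<alpha> r) r'"
    unfolding same_gap_def
  proof
    fix z assume "z \<in> Z \<union> \<alpha> ` S"
    then show "z < \<alpha> r \<and> z < r' \<or> \<alpha> r < z \<and> r' < z"
    proof
      assume "z \<in> Z" with g show ?thesis by (auto simp: same_gap_def)
    next
      assume "z \<in> \<alpha> ` S"
      then obtain s where s: "s \<in> S" "z = \<alpha> s" by blast
      have "r \<noteq> s" using insert.hyps s by blast
      then have "\<not> same_gap Z r s" using insert.prems(2)[of r s] s by auto
      then obtain y where y: "y \<in> Z" "\<not> (y < r \<and> y < s \<or> r < y \<and> s < y)"
        unfolding same_gap_def by blast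
      have "s \<notin> Z" using s insert.prems(1) by auto
      with y nZ have "y < r \<and> s < y \<or> r < y \<and> y < s" by (metis linorder_neqE)
      moreover have "y < \<alpha> r \<and> y < r' \<or> \<alpha> r < y \<and> r' < y"
        using g y(1) by (auto simp: same_gap_def)
      ultimately show ?thesis
        using strict_monoD[OF \<alpha>(1)] \<alpha>(3)[OF y(1)] s(2) by (metis less_asym order.strict_trans)
    qed
  qed
  from order_iso_push[OF _ this] fin insert.hyps(1)
  obtain \<delta> where \<delta>: "strict_mono \<delta>" "surj \<delta>" "\<And>z. z \<in> Z \<union> \<alpha> ` S \<Longrightarrow> \<delta> z = z" "\<delta> (\<alpha> r) = r'"
    by blast
  have "strict_mono (\<lambda>t. \<delta> (\<alpha> t))" "surj (\<lambda>t. \<delta> (\<alpha> t))"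
    using order_iso_comp \<alpha>(1,2) \<delta>(1,2) by blast+
  then show ?case
    using \<alpha>(3,4) \<delta>(3,4) r'(2) by (intro exI[of _ "\<lambda>t. \<delta> (\<alpha> t)"]) auto
qed

text \<open>The direction \<open>D\<close> is constant on a gap, because both points see the same pair \<open>h x < h y\<close> or
  \<open>h y < h x\<close> for \<open>x\<close> and \<open>y\<close> slightly outside.\<close>

lemma gapwise_monotone_same_gap:
  assumes fin: "finite Z" and h: "gapwise_monotone Z D h" and gap: "same_gap Z t u" and "t < u"
  shows "(0 < D t \<and> 0 < D u \<and> h t < h u) \<or> (D t < 0 \<and> D u < 0 \<and> h u < h t)"
proof -
  have nZ: "t \<notin> Z" "u \<notin> Z" using gap by (auto simp: same_gap_def)
  obtain x where x: "x < t" "\<And>z. z \<in> Z \<Longrightarrow> z < x \<or> t < z"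
    using finite_isolated[OF fin, of t] nZ(1) by (metis order.strict_trans)
  obtain y where y: "u < y" "\<And>z. z \<in> Z \<Longrightarrow> z < u \<or> y < z"
    using finite_isolated[OF fin, of u] nZ(2) by (metis order.strict_trans)
  have e: "{x<..<y} \<inter> Z = {}"
  proof -
    have False if "z \<in> Z" "x < z" "z < y" for z
    proof -
      have "z < t \<and> z < u \<or> t < z \<and> u < z" using gap that(1) by (auto simp: same_gap_def)
      with x(2)[OF that(1)] y(2)[OF that(1)] that(2,3) show False by linarith
    qed
    then show ?thesis by auto
  qed
  then have e': "{t<..<u} \<inter> Z = {}"
    using x(1) y(1) by (simp add: disjoint_iff)
  define v where "v = (t + u) / 2"
  have v: "t < v" "v < u" using \<open>t < u\<close> by (auto simp: v_def)
  show ?thesis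
    using gapwise_monotoneD(2)[OF h _ _ e, of t] gapwise_monotoneD(2)[OF h _ _ e, of u]
      gapwise_monotoneD(2)[OF h _ _ e, of v] gapwise_monotoneD(2)[OF h _ _ e', of v] v x(1) y(1)
    by auto
qed

text \<open>It suffices to move each zero of \<open>h\<close> outside \<open>Z\<close> to the zero of \<open>k\<close> in the same gap. On a
  gap with a zero, both functions are monotone in the same direction and pass through corresponding
  zeros. On a gap without zero of \<open>h\<close>, a different sign of \<open>k\<close> would also be a sign of \<open>h\<close>
  on that gap, by \<open>sign_in_gap\<close> with exchanged roles, and so \<open>h\<close> would have a zero there.\<close>

lemma order_iso_matching_signs:
  assumes fin: "finite Z" and h: "gapwise_monotone Z D h" and k: "gapwise_monotone Z D k"
    and sg: "\<And>z. z \<in> Z \<Longrightarrow> sgn (h z) = sgn (k z)"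
    and roots: "finite {r. h r = 0}"
  shows "\<exists>\<alpha>. strict_mono \<alpha> \<and> surj \<alpha> \<and> (\<forall>z\<in>Z. \<alpha> z = z) \<and> (\<forall>t. sgn (h t) = sgn (k (\<alpha> t)))"
proof -
  define S where "S = {r. h r = 0} - Z"
  have uniq: "r = s" if "h r = 0" "h s = 0" "same_gap Z r s" for r s
    using gapwise_monotone_same_gap[OF fin h, of r s] gapwise_monotone_same_gap[OF fin h, of s r]
      that same_gap_sym by (cases r s rule: linorder_cases) auto
  have "\<exists>\<alpha>. strict_mono \<alpha> \<and> surj \<alpha> \<and> (\<forall>z\<in>Z. \<alpha> z = z) \<and> (\<forall>r\<in>S. k (\<alpha> r) = 0)"
  proof (rule order_iso_aligning_points[OF _ fin])
    fix r assume "r \<in> S"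
    then show "\<exists>r'. same_gap Z r r' \<and> k r' = 0"
      using sign_in_gap[OF fin h k sg, of r] by (auto simp: S_def sgn_zero_iff)
  qed (use uniq roots in \<open>auto simp: S_def\<close>)
  then obtain \<alpha> where \<alpha>: "strict_mono \<alpha>" "surj \<alpha>" "\<And>z. z \<in> Z \<Longrightarrow> \<alpha> z = z"
      "\<And>r. r \<in> S \<Longrightarrow> k (\<alpha> r) = 0" by blast
  have "sgn (h t) = sgn (k (\<alpha> t))" for t
  proof (cases "t \<in> Z")
    case True
    then show ?thesis using sg \<alpha>(3) by simp
  next
    case t: False
    have ga: "same_gap Z u (\<alpha> u)" if "u \<notin> Z" for u
      by (rule same_gap_order_iso[OF \<alpha>(1,3) that])
    show ?thesis
    proof (cases "\<exists>r. h r = 0 \<and> same_gap Z t r")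
      case True
      then obtain r where r: "h r = 0" "same_gap Z t r" by blast
      then have rZ: "r \<notin> Z" by (auto simp: same_gap_def)
      with r have k0: "k (\<alpha> r) = 0" using \<alpha>(4) by (simp add: S_def)
      have dir: "sgn (D u) = sgn (D v)" if "same_gap Z u v" for u v
        using gapwise_monotone_same_gap[OF fin h that] gapwise_monotone_same_gap[OF fin h same_gap_sym[OF that]]
        by (cases u v rule: linorder_cases) auto
      have D1: "sgn (D r) = sgn (D (\<alpha> r))" and D2: "sgn (D t) = sgn (D (\<alpha> t))"
        using dir ga rZ t by blast+
      have g: "same_gap Z (\<alpha> t) (\<alpha> r)"
        using same_gap_trans[OF same_gap_trans[OF same_gap_sym[OF ga[OF t]] r(2)] ga[OF rZ]] .
      show ?thesis
      proof (cases t r rule: linorder_cases)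
        case less
        with \<alpha>(1) have "\<alpha> t < \<alpha> r" by (simp add: strict_mono_less)
        from gapwise_monotone_same_gap[OF fin h r(2) less] gapwise_monotone_same_gap[OF fin k g this] D1 k0 r(1)
        show ?thesis by (auto simp: sgn_if)
      next
        case equal with r k0 show ?thesis by simp
      next
        case greater
        with \<alpha>(1) have "\<alpha> r < \<alpha> t" by (simp add: strict_mono_less)
        from gapwise_monotone_same_gap[OF fin h same_gap_sym[OF r(2)] greater]
          gapwise_monotone_same_gap[OF fin k same_gap_sym[OF g] this] D1 k0 r(1)
        show ?thesis by (auto simp: sgn_if)
      qed
    next
      case False
      have "\<alpha> t \<notin> Z" using ga[OF t] by (auto simp: same_gap_def)
      from sign_in_gap[OF fin k h _ this] sg
      obtain w where w: "same_gap Z (\<alpha> t) w" "sgn (h w) = sgn (k (\<alpha> t))" by metis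
      have tw: "same_gap Z t w" using same_gap_trans[OF ga[OF t] w(1)] .
      have tt: "same_gap Z t t" using same_gap_trans[OF tw same_gap_sym[OF tw]] .
      have hc: "continuous_on A h" for A
        by (rule continuous_on_subset[OF gapwise_monotoneD(1)[OF h]]) simp
      have nz: "h x \<noteq> 0" if "min t w \<le> x" "x \<le> max t w" for x
      proof -
        have "same_gap Z t x"
          using same_gap_between[OF tt tw] same_gap_between[OF tw tt] that
          by (cases "t \<le> w") auto
        with False show ?thesis by blast
      qed
      have "sgn (h t) = sgn (h w)"
      proof (rule ccontr)
        assume "sgn (h t) \<noteq> sgn (h w)"
        moreover have "h t \<noteq> 0" "h w \<noteq> 0" using nz by auto
        ultimately have "(h t < 0 \<and> 0 < h w) \<or> (h w < 0 \<and> 0 < h t)"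
          by (auto simp: sgn_if split: if_splits)
        then have "\<exists>x. min t w \<le> x \<and> x \<le> max t w \<and> h x = 0"
        proof (cases "t \<le> w")
          case True
          with \<open>_ \<or> _\<close> show ?thesis
            using IVT'[of h t 0 w, OF _ _ _ hc] IVT2'[of h w 0 t, OF _ _ _ hc] by auto
        next
          case False
          with \<open>_ \<or> _\<close> show ?thesis
            using IVT'[of h w 0 t, OF _ _ _ hc] IVT2'[of h t 0 w, OF _ _ _ hc] by auto
        qed
        with nz show False by blast
      qed
      with w(2) show ?thesis by simp
    qed
  qed
  with \<alpha> show ?thesis by blast
qed

lemma poly_sgn_const:
  fixes p :: "real poly"
  assumes "\<And>x. min t u \<le> x \<Longrightarrow> x \<le> max t u \<Longrightarrow> poly p x \<noteq> 0"
  shows "sgn (poly p t) = sgn (poly p u)"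
proof (rule ccontr)
  assume ne: "sgn (poly p t) \<noteq> sgn (poly p u)"
  moreover have "poly p t \<noteq> 0" "poly p u \<noteq> 0" using assms by auto
  ultimately have "poly p t * poly p u < 0"
    by (auto simp: sgn_if mult_less_0_iff split: if_splits)
  moreover have "t \<noteq> u" using ne by auto
  ultimately obtain x where "t < x \<and> x < u \<or> u < x \<and> x < t" "poly p x = 0"
    by (metis poly_IVT mult.commute linorder_neqE)
  with assms[of x] show False by auto
qed

text \<open>The change of variable \<open>\<phi>\<close> carries the gaps of \<open>Z\<close> to gaps between the zeros of the
  derivative; the mean value theorem then gives the direction.\<close>

lemma gapwise_monotone_poly:
  fixes q :: "real poly" and \<phi> :: "real \<Rightarrow> real"
  assumes \<phi>: "strict_mono \<phi>" "surj \<phi>" and deg: "1 \<le> degree q"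
    and nz: "\<And>t. t \<notin> Z \<Longrightarrow> poly (pderiv q) (\<phi> t) \<noteq> 0"
    and D: "\<And>t. sgn (D t) = sgn (poly (pderiv q) (\<phi> t))"
  shows "gapwise_monotone Z D (\<lambda>t. poly q (\<phi> t))"
  unfolding gapwise_monotone_def
proof (intro conjI allI impI)
  have "continuous_on UNIV \<phi>"
    by (rule continuous_onI_mono) (use \<phi> in \<open>auto simp: strict_mono_less_eq\<close>)
  then show "continuous_on UNIV (\<lambda>t. poly q (\<phi> t))"
    by (intro continuous_intros)
next
  fix x y t assume xy: "x < y" and gap: "{x<..<y} \<inter> Z = {}" and t: "x < t" "t < y"
  have mono: "a < b \<longleftrightarrow> \<phi> a < \<phi> b" for a b using \<phi>(1) by (simp add: strict_mono_less)
  obtain c where c: "\<phi> x < c" "c < \<phi> y"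
    "poly q (\<phi> y) - poly q (\<phi> x) = (\<phi> y - \<phi> x) * poly (pderiv q) c"
    using poly_MVT[of "\<phi> x" "\<phi> y" q] xy mono by blast
  have "sgn (poly (pderiv q) c) = sgn (poly (pderiv q) (\<phi> t))"
  proof (rule poly_sgn_const)
    fix v assume v: "min c (\<phi> t) \<le> v" "v \<le> max c (\<phi> t)"
    obtain u where u: "v = \<phi> u" using \<phi>(2) by (metis surjD)
    have "\<phi> x < \<phi> t" "\<phi> t < \<phi> y" using mono t by auto
    then have "\<phi> x < \<phi> u" "\<phi> u < \<phi> y"
      using v c u by linarith+
    then have "u \<notin> Z" using gap mono by force
    then show "poly (pderiv q) v \<noteq> 0" using nz u by simp
  qed
  moreover have "\<phi> x < \<phi> y" using mono xy by simp
  moreover have "poly (pderiv q) (\<phi> t) \<noteq> 0" using nz gap t by force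
  moreover have "sgn (poly q (\<phi> y) - poly q (\<phi> x)) = sgn (poly (pderiv q) c)"
    using c(3) \<open>\<phi> x < \<phi> y\<close> by (simp add: sgn_mult)
  ultimately show "0 < D t \<and> poly q (\<phi> x) < poly q (\<phi> y) \<or> D t < 0 \<and> poly q (\<phi> y) < poly q (\<phi> x)"
    using D[of t] by (auto simp: sgn_if split: if_splits)
next
  fix M :: real
  obtain a p where q: "q = pCons a p" by (cases q)
  with deg have "p \<noteq> 0" by auto
  from poly_infinity[OF this, of M a] q
  obtain K where K: "\<And>x. K \<le> \<bar>x\<bar> \<Longrightarrow> M \<le> \<bar>poly q x\<bar>" by auto
  obtain u v where uv: "\<phi> u = - \<bar>K\<bar>" "\<phi> v = \<bar>K\<bar>" using \<phi>(2) by (metis surjD)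
  show "\<exists>K. \<forall>x. K \<le> \<bar>x\<bar> \<longrightarrow> M \<le> \<bar>poly q (\<phi> x)\<bar>"
  proof (intro exI allI impI)
    fix x assume x: "max \<bar>u\<bar> \<bar>v\<bar> \<le> \<bar>x\<bar>"
    have "x \<le> u \<or> v \<le> x" using x by linarith
    then have "\<phi> x \<le> \<phi> u \<or> \<phi> v \<le> \<phi> x" using \<phi>(1) by (simp add: strict_mono_less_eq)
    with uv have "K \<le> \<bar>\<phi> x\<bar>" by auto
    with K show "M \<le> \<bar>poly q (\<phi> x)\<bar>" by blast
  qed
qed

text \<open>The core of the induction step of quantifier elimination. The order isomorphism \<open>\<phi>\<close> matches the
  signs of a family that contains the derivative of \<open>p\<close>, and at the zeros of the family it also
  matches the signs of \<open>p\<close>. Modifying \<open>\<phi>\<close> inside the gaps between these zeros preserves the signs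
  of the family and makes the signs of \<open>p\<close> agree everywhere.\<close>

lemma order_iso_extend:
  fixes p p' :: "real poly" and \<phi> :: "real \<Rightarrow> real"
  assumes \<phi>: "strict_mono \<phi>" "surj \<phi>" and deg: "1 \<le> degree p" "1 \<le> degree p'"
    and fin: "finite I" and i0: "i0 \<in> I" "g i0 = pderiv p" "g' i0 = pderiv p'"
    and gs: "\<And>i t. i \<in> I \<Longrightarrow> sgn (poly (g i) t) = sgn (poly (g' i) (\<phi> t))"
    and ps: "\<And>i t. i \<in> I \<Longrightarrow> g i \<noteq> 0 \<Longrightarrow> poly (g i) t = 0 \<Longrightarrow> sgn (poly p t) = sgn (poly p' (\<phi> t))"
  shows "\<exists>\<psi>. strict_mono \<psi> \<and> surj \<psi> \<and> (\<forall>t. sgn (poly p t) = sgn (poly p' (\<psi> t))) \<and>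
           (\<forall>i\<in>I. \<forall>t. sgn (poly (g i) t) = sgn (poly (g' i) (\<psi> t)))"
proof -
  define Z where "Z = (\<Union>i\<in>{i\<in>I. g i \<noteq> 0}. {t. poly (g i) t = 0})"
  have finZ: "finite Z" using fin by (auto simp: Z_def intro: poly_roots_finite)
  have pd: "pderiv p \<noteq> 0" using deg by (simp add: pderiv_eq_0_iff)
  have nz: "poly (pderiv p) t \<noteq> 0" if "t \<notin> Z" for t
    using that i0 pd unfolding Z_def by auto
  have h: "gapwise_monotone Z (poly (pderiv p)) (\<lambda>t. poly p t)"
    by (rule gapwise_monotone_poly[of "\<lambda>t. t"]) (use deg nz in \<open>auto simp: strict_mono_def\<close>)
  have k: "gapwise_monotone Z (poly (pderiv p)) (\<lambda>t. poly p' (\<phi> t))"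
  proof (rule gapwise_monotone_poly[OF \<phi> deg(2)])
    show sg: "sgn (poly (pderiv p) t) = sgn (poly (pderiv p') (\<phi> t))" for t
      using gs[OF i0(1), of t] i0 by simp
    show "poly (pderiv p') (\<phi> t) \<noteq> 0" if "t \<notin> Z" for t
      using sg[of t] nz[OF that] by (metis sgn_zero_iff)
  qed
  have "finite {r. poly p r = 0}" using deg by (intro poly_roots_finite) auto
  from order_iso_matching_signs[OF finZ h k _ this] ps
  obtain \<alpha> where \<alpha>: "strict_mono \<alpha>" "surj \<alpha>" "\<And>z. z \<in> Z \<Longrightarrow> \<alpha> z = z"
      "\<And>t. sgn (poly p t) = sgn (poly p' (\<phi> (\<alpha> t)))"
    unfolding Z_def by (smt (verit) UN_iff mem_Collect_eq)
  have "sgn (poly (g i) t) = sgn (poly (g' i) (\<phi> (\<alpha> t)))" if i: "i \<in> I" for i t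
  proof (cases "t \<in> Z \<or> g i = 0")
    case True
    then show ?thesis
    proof
      assume "t \<in> Z" then show ?thesis using \<alpha>(3) gs[OF i] by simp
    next
      assume "g i = 0" then show ?thesis using gs[OF i, of "\<alpha> t"] by simp
    qed
  next
    case False
    then have gap: "same_gap Z t (\<alpha> t)" using same_gap_order_iso[OF \<alpha>(1,3)] by blast
    have tt: "same_gap Z t t" using same_gap_trans[OF gap same_gap_sym[OF gap]] .
    have "sgn (poly (g i) t) = sgn (poly (g i) (\<alpha> t))"
    proof (rule poly_sgn_const)
      fix x assume "min t (\<alpha> t) \<le> x" "x \<le> max t (\<alpha> t)"
      then have "same_gap Z t x"
        using same_gap_between[OF tt gap] same_gap_between[OF gap tt] by (cases "t \<le> \<alpha> t") auto
      then have "x \<notin> Z" by (auto simp: same_gap_def)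
      then show "poly (g i) x \<noteq> 0" using False i by (auto simp: Z_def)
    qed
    with gs[OF i, of "\<alpha> t"] show ?thesis by simp
  qed
  moreover have "strict_mono (\<lambda>t. \<phi> (\<alpha> t))" "surj (\<lambda>t. \<phi> (\<alpha> t))"
    using order_iso_comp \<phi> \<alpha>(1,2) by blast+
  ultimately show ?thesis using \<alpha>(4) by (intro exI[of _ "\<lambda>t. \<phi> (\<alpha> t)"]) auto
qed

section \<open>Sign diagrams of polynomials with parameters\<close>

text \<open>Univariate polynomials whose coefficients are polynomial functions of a parameter \<open>z\<close>. The
  number \<open>n\<close> is a formal degree: the degree may drop at some parameters.\<close>

definition param_poly :: "nat \<Rightarrow> ('z::real_normed_vector \<Rightarrow> real poly) \<Rightarrow> bool" where
  "param_poly n q \<longleftrightarrow> (\<forall>z. degree (q z) \<le> n) \<and> (\<forall>i. real_polynomial_function (\<lambda>z. coeff (q z) i))"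

lemma param_polyI:
  assumes "\<And>i z. n < i \<Longrightarrow> coeff (q z) i = 0"
    and "\<And>i. real_polynomial_function (\<lambda>z. coeff (q z) i)"
  shows "param_poly n q"
  using assms by (auto simp: param_poly_def intro!: degree_le)

lemma param_polyD:
  assumes "param_poly n q"
  shows "degree (q z) \<le> n" "n < i \<Longrightarrow> coeff (q z) i = 0"
    "real_polynomial_function (\<lambda>z. coeff (q z) i)"
  using assms by (auto simp: param_poly_def intro: coeff_eq_0 le_less_trans)

lemma param_poly_mono: "param_poly n q \<Longrightarrow> n \<le> m \<Longrightarrow> param_poly m q"
  by (auto simp: param_poly_def intro: order_trans)

lemma param_poly_pderiv: "param_poly (Suc n) q \<Longrightarrow> param_poly n (\<lambda>z. pderiv (q z))"
  by (intro param_polyI, simp_all only: coeff_pderiv)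
     (auto simp: param_polyD(2) intro!: real_polynomial_function.intros(4) param_polyD(3))

lemma param_poly_cutoff: "param_poly m q \<Longrightarrow> param_poly n (\<lambda>z. poly_cutoff (Suc n) (q z))"
  by (rule param_polyI; (case_tac "i < Suc n")?) (simp_all add: coeff_poly_cutoff real_polynomial_function.intros(2) param_polyD(3))

lemma poly_cutoff_degree: "degree p < n \<Longrightarrow> poly_cutoff n p = p"
  by (rule poly_eqI) (auto simp: coeff_poly_cutoff coeff_eq_0)

text \<open>Pseudo-division with the even power \<open>(b z)\<^sup>2\<close> of the leading coefficient, so that no sign is
  lost; at a zero of \<open>g\<close> the subtracted multiple of \<open>g\<close> vanishes. The divisor is cut off at
  degree \<open>j\<close> because the remainder must be a polynomial family over all parameters, including those
  where \<open>g\<close> has larger degree.\<close>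

lemma param_pseudo_remainder:
  fixes g p :: "'z::real_normed_vector \<Rightarrow> real poly"
  assumes g: "param_poly m g" and p: "param_poly n p" and j: "1 \<le> j"
  shows "\<exists>r. param_poly (j - 1) r \<and> (\<forall>z t. degree (g z) = j \<longrightarrow> poly (g z) t = 0 \<longrightarrow>
            sgn (poly (p z) t) = sgn (poly (r z) t))"
  using p
proof (induction n arbitrary: p)
  case 0
  then have "param_poly (j - 1) p" by (rule param_poly_mono) simp
  then show ?case by blast
next
  case (Suc n)
  show ?case
  proof (cases "Suc n < j")
    case True
    have "param_poly (j - 1) p" by (rule param_poly_mono[OF Suc.prems]) (use True in simp)
    then show ?thesis by blast
  next
    case False
    define c where "c = (\<lambda>z. poly_cutoff (Suc j) (g z))"
    define b where "b = (\<lambda>z. coeff (g z) j)"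
    define a where "a = (\<lambda>z. coeff (p z) (Suc n))"
    define p1 where "p1 = (\<lambda>z. smult ((b z)\<^sup>2) (p z) - smult (b z * a z) (monom 1 (Suc n - j) * c z))"
    have c: "param_poly j c" using g unfolding c_def by (rule param_poly_cutoff)
    have co: "coeff (p1 z) i = (b z)\<^sup>2 * coeff (p z) i -
        b z * a z * (if i < Suc n - j then 0 else coeff (c z) (i - (Suc n - j)))" for z i
      by (simp add: p1_def coeff_monom_mult)
    have "param_poly n p1"
    proof (rule param_polyI)
      fix i z assume "n < i"
      show "coeff (p1 z) i = 0"
      proof (cases "i = Suc n")
        case True
        then have "i - (Suc n - j) = j" "\<not> i < Suc n - j" using False by auto
        then show ?thesis
          using True by (simp add: co a_def c_def coeff_poly_cutoff b_def power2_eq_square)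
      next
        case ne: False
        with \<open>n < i\<close> have "j < i - (Suc n - j)" "\<not> i < Suc n - j" "Suc n < i" using False by auto
        then show ?thesis
          by (simp add: co param_polyD(2)[OF c] param_polyD(2)[OF Suc.prems])
      qed
    next
      fix i
      have 1: "real_polynomial_function b" "real_polynomial_function a"
        unfolding b_def a_def using param_polyD(3) g Suc.prems by blast+
      have 2: "real_polynomial_function (\<lambda>z. if i < Suc n - j then 0 else coeff (c z) (i - (Suc n - j)))"
        using param_polyD(3)[OF c, of "i - (Suc n - j)"] real_polynomial_function.intros(2)[of 0]
        by (cases "i < Suc n - j") simp_all
      have 3: "real_polynomial_function (\<lambda>z. (b z)\<^sup>2 * coeff (p z) i)"
        using real_polynomial_function.intros(4)[OF real_polynomial_function_power[OF 1(1)]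
          param_polyD(3)[OF Suc.prems]] .
      have 4: "real_polynomial_function (\<lambda>z. b z * a z *
                 (if i < Suc n - j then 0 else coeff (c z) (i - (Suc n - j))))"
        by (rule real_polynomial_function.intros(4)[OF real_polynomial_function.intros(4)[OF 1] 2])
      show "real_polynomial_function (\<lambda>z. coeff (p1 z) i)"
        unfolding co by (rule real_polynomial_function_diff[OF 3 4])
    qed
    from Suc.IH[OF this] obtain r where r: "param_poly (j - 1) r"
      "\<And>z t. degree (g z) = j \<Longrightarrow> poly (g z) t = 0 \<Longrightarrow> sgn (poly (p1 z) t) = sgn (poly (r z) t)"
      by blast
    have "sgn (poly (p z) t) = sgn (poly (r z) t)" if "degree (g z) = j" "poly (g z) t = 0" for z t
    proof -
      have "c z = g z" unfolding c_def using that(1) by (intro poly_cutoff_degree) simp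
      moreover have "b z \<noteq> 0" using that(1) j by (auto simp: b_def)
      then have "0 < (b z)\<^sup>2" by simp
      ultimately have "sgn (poly (p1 z) t) = sgn (poly (p z) t)"
        using that(2) by (simp add: p1_def sgn_if zero_less_mult_iff)
      with r(2)[OF that] show ?thesis by simp
    qed
    with r(1) show ?thesis by blast
  qed
qed

text \<open>The sign diagram of a finite family of polynomials is not encoded by a data structure. That two
  parameters have the same diagram is expressed by an order isomorphism of the line instead.\<close>

definition sign_determined :: "('z::real_normed_vector \<Rightarrow> real poly) set \<Rightarrow> bool" where
  "sign_determined Q \<longleftrightarrow> (\<exists>B. finite B \<and> (\<forall>b\<in>B. real_polynomial_function b) \<and>
     (\<forall>z z'. (\<forall>b\<in>B. sgn (b z) = sgn (b z')) \<longrightarrow>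
        (\<exists>\<phi>. strict_mono \<phi> \<and> surj \<phi> \<and> (\<forall>q\<in>Q. \<forall>t. sgn (poly (q z) t) = sgn (poly (q z') (\<phi> t))))))"

text \<open>One polynomial \<open>p\<close> of formal degree \<open>n + 1\<close> is traded for finitely many of formal degree at
  most \<open>n\<close>: its derivative, its truncation (which replaces \<open>p\<close> where the leading coefficient
  vanishes), and its pseudo-remainders modulo the derivative and the other polynomials at each possible degree
  (which give the signs of \<open>p\<close> at the zeros of these). The coefficients are added to the
  determining functions, so that equal signs also mean equal degrees.\<close>

lemma sign_determined_insert:
  fixes p :: "'z::real_normed_vector \<Rightarrow> real poly"
  assumes IH: "\<And>Q'. finite Q' \<Longrightarrow> \<forall>q\<in>Q'. param_poly n q \<Longrightarrow> sign_determined (F \<union> Q')"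
    and F: "finite F" "\<forall>q\<in>F. param_poly (Suc n) q" and p: "param_poly (Suc n) p"
    and Q: "finite Q" "\<forall>q\<in>Q. param_poly n q"
  shows "sign_determined (insert p F \<union> Q)"
proof -
  define dp where "dp = (\<lambda>z. pderiv (p z))"
  define cp where "cp = (\<lambda>z. poly_cutoff (Suc n) (p z))"
  define G where "G = F \<union> Q \<union> {dp}"
  have finG: "finite G" using F Q by (simp add: G_def)
  have dp: "param_poly n dp" unfolding dp_def by (rule param_poly_pderiv[OF p])
  have cp: "param_poly n cp" unfolding cp_def by (rule param_poly_cutoff[OF p])
  have G: "param_poly (Suc n) g" if "g \<in> G" for g
    using that F(2) Q(2) dp by (auto simp: G_def intro: param_poly_mono[OF _ le_SucI[OF order_refl]])
  have "\<exists>r. param_poly n r \<and> (\<forall>z t. degree (g z) = j \<longrightarrow> poly (g z) t = 0 \<longrightarrow>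
            sgn (poly (p z) t) = sgn (poly (r z) t))" if "g \<in> G" "j \<in> {1..Suc n}" for g j
  proof -
    from param_pseudo_remainder[OF G[OF that(1)] p, of j] that(2)
    obtain r where "param_poly (j - 1) r" "\<forall>z t. degree (g z) = j \<longrightarrow> poly (g z) t = 0 \<longrightarrow>
            sgn (poly (p z) t) = sgn (poly (r z) t)" by auto
    moreover have "j - 1 \<le> n" using that(2) by auto
    ultimately show ?thesis using param_poly_mono by blast
  qed
  then obtain R where R: "\<And>g j. g \<in> G \<Longrightarrow> j \<in> {1..Suc n} \<Longrightarrow> param_poly n (R g j) \<and>
      (\<forall>z t. degree (g z) = j \<longrightarrow> poly (g z) t = 0 \<longrightarrow> sgn (poly (p z) t) = sgn (poly (R g j z) t))"
    by metis
  define Q' where "Q' = Q \<union> {dp, cp} \<union> (\<lambda>(g, j). R g j) ` (G \<times> {1..Suc n})"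
  have "sign_determined (F \<union> Q')"
    by (rule IH) (use Q finG dp cp R in \<open>auto simp: Q'_def\<close>)
  then obtain B' where B': "finite B'" "\<forall>b\<in>B'. real_polynomial_function b"
    "\<And>z z'. (\<forall>b\<in>B'. sgn (b z) = sgn (b z')) \<Longrightarrow>
        (\<exists>\<phi>. strict_mono \<phi> \<and> surj \<phi> \<and> (\<forall>q\<in>F \<union> Q'. \<forall>t. sgn (poly (q z) t) = sgn (poly (q z') (\<phi> t))))"
    unfolding sign_determined_def by blast
  define C where "C = (\<lambda>(g, i) z. coeff (g z) i) ` (insert p G \<times> {..Suc n})"
  show ?thesis
    unfolding sign_determined_def
  proof (intro exI[of _ "B' \<union> C"] conjI allI impI)
    show "finite (B' \<union> C)" using B' finG by (simp add: C_def)
    show "\<forall>b\<in>B' \<union> C. real_polynomial_function b"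
    proof
      fix b assume "b \<in> B' \<union> C"
      then show "real_polynomial_function b"
      proof
        assume "b \<in> C"
        then obtain g i where g: "g \<in> insert p G" "b = (\<lambda>z. coeff (g z) i)"
          unfolding C_def by auto
        then have "param_poly (Suc n) g" using G p by blast
        from param_polyD(3)[OF this] g(2) show ?thesis by simp
      qed (use B' in blast)
    qed
    fix z z' assume agree: "\<forall>b\<in>B' \<union> C. sgn (b z) = sgn (b z')"
    then obtain \<phi> where \<phi>: "strict_mono \<phi>" "surj \<phi>"
      "\<And>q t. q \<in> F \<union> Q' \<Longrightarrow> sgn (poly (q z) t) = sgn (poly (q z') (\<phi> t))"
      using B'(3)[of z z'] by auto
    have co: "coeff (g z) i = 0 \<longleftrightarrow> coeff (g z') i = 0" if "g \<in> insert p G" for g i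
    proof (cases "i \<le> Suc n")
      case True
      then have "(\<lambda>z. coeff (g z) i) \<in> C" using that by (force simp: C_def)
      then have "sgn (coeff (g z) i) = sgn (coeff (g z') i)"
        using bspec[OF agree, of "\<lambda>z. coeff (g z) i"] by simp
      then show ?thesis by (metis sgn_zero_iff)
    next
      case False
      have "param_poly (Suc n) g" using that G p by blast
      with False show ?thesis by (simp add: param_polyD(2))
    qed
    have deg: "degree (g z) = degree (g z')" if "g \<in> insert p G" for g
      using co[OF that] by (intro antisym degree_le) (metis coeff_eq_0)+
    show "\<exists>\<phi>. strict_mono \<phi> \<and> surj \<phi> \<and>
             (\<forall>q\<in>insert p F \<union> Q. \<forall>t. sgn (poly (q z) t) = sgn (poly (q z') (\<phi> t)))"
    proof (cases "coeff (p z) (Suc n) = 0")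
      case True
      have red: "cp w = p w" if "coeff (p w) (Suc n) = 0" for w
        unfolding cp_def
      proof (rule poly_eqI)
        fix i show "coeff (poly_cutoff (Suc n) (p w)) i = coeff (p w) i"
          using that param_polyD(2)[OF p, of i w] by (cases "i = Suc n") (auto simp: coeff_poly_cutoff)
      qed
      have "cp z = p z" "cp z' = p z'" using True co[of p "Suc n"] red by auto
      then have "sgn (poly (p z) t) = sgn (poly (p z') (\<phi> t))" for t
        using \<phi>(3)[of cp t] by (simp add: Q'_def)
      then show ?thesis using \<phi> by (intro exI[of _ \<phi>]) (auto simp: Q'_def)
    next
      case False
      then have d: "degree (p z) = Suc n"
        using param_polyD(1)[OF p, of z] by (meson le_antisym le_degree)
      have "\<exists>\<psi>. strict_mono \<psi> \<and> surj \<psi> \<and> (\<forall>t. sgn (poly (p z) t) = sgn (poly (p z') (\<psi> t))) \<and>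
           (\<forall>g\<in>G. \<forall>t. sgn (poly (g z) t) = sgn (poly (g z') (\<psi> t)))"
      proof (rule order_iso_extend[OF \<phi>(1,2) _ _ finG])
        show "1 \<le> degree (p z)" "1 \<le> degree (p z')" using d deg[of p] by auto
        show "dp \<in> G" "dp z = pderiv (p z)" "dp z' = pderiv (p z')" by (auto simp: G_def dp_def)
        show gs: "sgn (poly (g z) t) = sgn (poly (g z') (\<phi> t))" if "g \<in> G" for g t
          using that \<phi>(3) by (auto simp: G_def Q'_def)
        fix g t assume g: "g \<in> G" "g z \<noteq> 0" "poly (g z) t = 0"
        define j where "j = degree (g z)"
        have "j \<noteq> 0"
        proof
          assume "j = 0"
          then obtain c where "g z = [:c:]" unfolding j_def by (metis degree_eq_zeroE)
          with g show False by simp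
        qed
        moreover have "j \<le> Suc n" unfolding j_def by (rule param_polyD(1)[OF G[OF g(1)]])
        ultimately have j: "j \<in> {1..Suc n}" by auto
        have g': "poly (g z') (\<phi> t) = 0" using gs[OF g(1), of t] g(3) by (metis sgn_zero_iff sgn_0)
        have "R g j \<in> Q'" using g(1) j by (force simp: Q'_def)
        then have "sgn (poly (R g j z) t) = sgn (poly (R g j z') (\<phi> t))" using \<phi>(3) by blast
        then show "sgn (poly (p z) t) = sgn (poly (p z') (\<phi> t))"
          using R[OF g(1) j] g(3) g' deg[of g] g(1) by (simp add: j_def)
      qed
      then show ?thesis by (auto simp: G_def)
    qed
  qed
qed

text \<open>Induction on the formal degree bound, and within it on the number of polynomials that attain it.\<close>

theorem sign_determined:
  fixes Q :: "('z::real_normed_vector \<Rightarrow> real poly) set"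
  assumes "finite Q" "\<forall>q\<in>Q. param_poly n q"
  shows "sign_determined Q"
  using assms
proof (induction n arbitrary: Q)
  case 0
  show ?case
    unfolding sign_determined_def
  proof (intro exI[of _ "(\<lambda>q z. coeff (q z) 0) ` Q"] conjI allI impI)
    show "finite ((\<lambda>q z. coeff (q z) 0) ` Q)" using 0 by simp
    show "\<forall>b\<in>(\<lambda>q z. coeff (q z) 0) ` Q. real_polynomial_function b"
      using 0 param_polyD(3) by auto
    fix z z' assume a: "\<forall>b\<in>(\<lambda>q z. coeff (q z) 0) ` Q. sgn (b z) = sgn (b z')"
    have "poly (q w) t = coeff (q w) 0" if "q \<in> Q" for q w t
    proof -
      have "degree (q w) = 0" using 0 that param_polyD(1) by fastforce
      then show ?thesis by (metis degree_eq_zeroE poly_const_conv coeff_pCons_0)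
    qed
    with a show "\<exists>\<phi>. strict_mono \<phi> \<and> surj \<phi> \<and> (\<forall>q\<in>Q. \<forall>t. sgn (poly (q z) t) = sgn (poly (q z') (\<phi> t)))"
      by (intro exI[of _ "\<lambda>t. t"]) (auto simp: strict_mono_def)
  qed
next
  case (Suc n)
  have "\<forall>Q'. finite Q' \<longrightarrow> (\<forall>q\<in>Q'. param_poly n q) \<longrightarrow> sign_determined (F \<union> Q')"
    if "finite F" "\<forall>q\<in>F. param_poly (Suc n) q" for F :: "('z \<Rightarrow> real poly) set"
    using that
  proof (induction F rule: finite_induct)
    case empty
    then show ?case using Suc.IH by simp
  next
    case (insert p F)
    then show ?case
      by (intro allI impI sign_determined_insert) auto
  qed
  from this[OF Suc.prems, rule_format, of "{}"] show ?case by simp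
qed

section \<open>Definable predicates and quantifier elimination\<close>

lemma polynomial_function_linear_compose:
  fixes L :: "'b::real_normed_vector \<Rightarrow> 'c::real_normed_vector" and f :: "'a::real_normed_vector \<Rightarrow> 'b"
  assumes "bounded_linear L" "polynomial_function f"
  shows "polynomial_function (\<lambda>x. L (f x))"
  unfolding polynomial_function_def o_def
proof (intro allI impI)
  fix F :: "'c \<Rightarrow> real" assume "bounded_linear F"
  from bounded_linear_compose[OF this assms(1)] assms(2)
  show "real_polynomial_function (\<lambda>x. F (L (f x)))"
    unfolding polynomial_function_def o_def by blast
qed

lemmas polynomial_function_fst = polynomial_function_linear_compose[OF bounded_linear_fst]
lemmas polynomial_function_snd = polynomial_function_linear_compose[OF bounded_linear_snd]

lemma polynomial_function_Pair:
  assumes "polynomial_function f" "polynomial_function g"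
  shows "polynomial_function (\<lambda>x. (f x, g x))"
proof -
  have "polynomial_function (\<lambda>x. (f x, 0) + (0, g x))"
    by (intro polynomial_function_add polynomial_function_linear_compose[of "\<lambda>y. (y, 0)"]
        polynomial_function_linear_compose[of "\<lambda>y. (0, y)"] assms bounded_linear_Pair
        bounded_linear_ident bounded_linear_zero)
  then show ?thesis by simp
qed

lemma real_polynomial_function_inner:
  fixes f g :: "'z::real_normed_vector \<Rightarrow> 'a::euclidean_space"
  assumes "polynomial_function f" "polynomial_function g"
  shows "real_polynomial_function (\<lambda>x. f x \<bullet> g x)"
proof -
  have "real_polynomial_function (\<lambda>x. h x \<bullet> b)" if "polynomial_function h" for h :: "'z \<Rightarrow> 'a" and b
    using polynomial_function_linear_compose[OF bounded_linear_inner_left that]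
    by (simp add: real_polynomial_function_eq)
  then have "real_polynomial_function (\<lambda>x. \<Sum>b\<in>Basis. (f x \<bullet> b) * (g x \<bullet> b))"
    using assms by (intro real_polynomial_function_sum real_polynomial_function.intros(4)) auto
  then show ?thesis by (simp add: euclidean_inner[symmetric])
qed

text \<open>These are the semi-algebraic sets. Saturation under the sign vector of \<open>B\<close> makes Boolean
  combinations immediate.\<close>

definition definable :: "('z::real_normed_vector \<Rightarrow> bool) \<Rightarrow> bool" where
  "definable P \<longleftrightarrow> (\<exists>B. finite B \<and> (\<forall>b\<in>B. real_polynomial_function b) \<and>
     (\<forall>x y. (\<forall>b\<in>B. sgn (b x) = sgn (b y)) \<longrightarrow> (P x \<longleftrightarrow> P y)))"

lemma definable_not: "definable P \<Longrightarrow> definable (\<lambda>x. \<not> P x)"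
  unfolding definable_def by simp

lemma definable_conj:
  assumes "definable P" "definable Q"
  shows "definable (\<lambda>x. P x \<and> Q x)"
proof -
  obtain B where B: "finite B" "\<forall>b\<in>B. real_polynomial_function b"
      "\<And>x y. (\<forall>b\<in>B. sgn (b x) = sgn (b y)) \<Longrightarrow> (P x \<longleftrightarrow> P y)"
    using assms(1) unfolding definable_def by blast
  obtain C where C: "finite C" "\<forall>b\<in>C. real_polynomial_function b"
      "\<And>x y. (\<forall>b\<in>C. sgn (b x) = sgn (b y)) \<Longrightarrow> (Q x \<longleftrightarrow> Q y)"
    using assms(2) unfolding definable_def by blast
  show ?thesis
    unfolding definable_def
  proof (intro exI[of _ "B \<union> C"] conjI allI impI)
    show "finite (B \<union> C)" "\<forall>b\<in>B \<union> C. real_polynomial_function b" using B C by auto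
    fix x y assume "\<forall>b\<in>B \<union> C. sgn (b x) = sgn (b y)"
    then show "(P x \<and> Q x) \<longleftrightarrow> (P y \<and> Q y)" using B(3)[of x y] C(3)[of x y] by simp
  qed
qed

lemma definable_disj: "definable P \<Longrightarrow> definable Q \<Longrightarrow> definable (\<lambda>x. P x \<or> Q x)"
  using definable_not[OF definable_conj[OF definable_not[of P] definable_not[of Q]]] by simp

lemma definable_imp: "definable P \<Longrightarrow> definable Q \<Longrightarrow> definable (\<lambda>x. P x \<longrightarrow> Q x)"
  using definable_disj[OF definable_not[of P], of Q] by simp

lemma definable_sgn:
  assumes "real_polynomial_function p"
  shows "definable (\<lambda>x. R (sgn (p x)))"
  unfolding definable_def by (rule exI[of _ "{p}"]) (use assms in auto)

lemma definable_poly_less: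
  assumes "real_polynomial_function p" "real_polynomial_function q"
  shows "definable (\<lambda>x. p x < q x)"
  using definable_sgn[OF real_polynomial_function_diff[OF assms], of "\<lambda>s. s < 0"] by simp

lemma definable_poly_le:
  assumes "real_polynomial_function p" "real_polynomial_function q"
  shows "definable (\<lambda>x. p x \<le> q x)"
  using definable_not[OF definable_poly_less[OF assms(2,1)]] by (simp add: not_less)

lemma definable_poly_eq:
  assumes "real_polynomial_function p" "real_polynomial_function q"
  shows "definable (\<lambda>x. p x = q x)"
  using definable_sgn[OF real_polynomial_function_diff[OF assms], of "\<lambda>s. s = 0"] by (simp add: sgn_zero_iff)

lemma definable_compose:
  assumes "definable P" "polynomial_function h"
  shows "definable (\<lambda>x. P (h x))"
proof -
  obtain B where B: "finite B" "\<forall>b\<in>B. real_polynomial_function b"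
      "\<And>x y. (\<forall>b\<in>B. sgn (b x) = sgn (b y)) \<Longrightarrow> (P x \<longleftrightarrow> P y)"
    using assms(1) unfolding definable_def by blast
  show ?thesis
    unfolding definable_def
  proof (intro exI[of _ "(\<lambda>b. b \<circ> h) ` B"] conjI allI impI)
    show "finite ((\<lambda>b. b \<circ> h) ` B)" using B by simp
    show "\<forall>b\<in>(\<lambda>b. b \<circ> h) ` B. real_polynomial_function b"
      using B(2) assms(2) by (auto intro: real_polynomial_function_compose)
    fix x y assume "\<forall>b\<in>(\<lambda>b. b \<circ> h) ` B. sgn (b x) = sgn (b y)"
    then show "P (h x) \<longleftrightarrow> P (h y)" by (intro B(3)) simp
  qed
qed

lemma param_poly_add:
  assumes "param_poly m p" "param_poly n q"
  shows "param_poly (max m n) (\<lambda>z. p z + q z)"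
  by (rule param_polyI)
     (use assms in \<open>simp_all add: param_polyD(2) real_polynomial_function.intros(3) param_polyD(3)\<close>)

lemma param_poly_mult:
  assumes "param_poly m p" "param_poly n q"
  shows "param_poly (m + n) (\<lambda>z. p z * q z)"
  unfolding param_poly_def
proof (intro conjI allI)
  fix z show "degree (p z * q z) \<le> m + n"
    by (rule order_trans[OF degree_mult_le]) (intro add_mono param_polyD(1)[OF assms(1)] param_polyD(1)[OF assms(2)])
  fix i show "real_polynomial_function (\<lambda>z. coeff (p z * q z) i)"
    unfolding coeff_mult
    by (intro real_polynomial_function_sum real_polynomial_function.intros(4)
        param_polyD(3)[OF assms(1)] param_polyD(3)[OF assms(2)]) auto
qed

text \<open>Restricted to the lines in direction \<open>d\<close>, a polynomial function is a polynomial with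
  parameters. This is the form in which \<open>sign_determined\<close> eliminates one quantifier.\<close>

lemma real_polynomial_function_along_line:
  fixes b :: "'z::real_normed_vector \<Rightarrow> real"
  assumes "real_polynomial_function b"
  shows "\<exists>n c. param_poly n c \<and> (\<forall>z t. poly (c z) t = b (z + t *\<^sub>R d))"
  using assms
proof (induction b rule: real_polynomial_function.induct)
  case (linear f)
  then have lin: "linear f" by (simp add: bounded_linear.linear)
  have "real_polynomial_function (\<lambda>z. coeff [:f z, f d:] i)" for i
  proof (cases i)
    case 0
    then show ?thesis by (simp add: real_polynomial_function.intros(1)[OF linear])
  next
    case (Suc k)
    then show ?thesis by (cases k) (simp_all add: real_polynomial_function.intros(2))
  qed
  then have "param_poly 1 (\<lambda>z. [:f z, f d:])" by (simp add: param_poly_def)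
  moreover have "poly [:f z, f d:] t = f (z + t *\<^sub>R d)" for z t
    by (simp add: linear_add[OF lin] linear_scale[OF lin])
  ultimately show ?case by blast
next
  case (const k)
  show ?case
    by (intro exI[of _ 0] exI[of _ "\<lambda>z. [:k:]"])
       (simp add: param_poly_def real_polynomial_function.intros(2))
next
  case (add f g)
  then obtain m c n e where "param_poly m c" "\<And>z t. poly (c z) t = f (z + t *\<^sub>R d)"
    "param_poly n e" "\<And>z t. poly (e z) t = g (z + t *\<^sub>R d)" by blast
  then show ?case
    by (intro exI[of _ "max m n"] exI[of _ "\<lambda>z. c z + e z"]) (simp add: param_poly_add)
next
  case (mult f g)
  then obtain m c n e where "param_poly m c" "\<And>z t. poly (c z) t = f (z + t *\<^sub>R d)"
    "param_poly n e" "\<And>z t. poly (e z) t = g (z + t *\<^sub>R d)" by blast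
  then show ?case
    by (intro exI[of _ "m + n"] exI[of _ "\<lambda>z. c z * e z"]) (simp add: param_poly_mult)
qed

lemma definable_ex_direction:
  fixes P :: "'z::real_normed_vector \<Rightarrow> bool"
  assumes "definable P"
  shows "definable (\<lambda>z. \<exists>t. P (z + t *\<^sub>R d))"
proof -
  obtain B where B: "finite B" "\<forall>b\<in>B. real_polynomial_function b"
      "\<And>x y. (\<forall>b\<in>B. sgn (b x) = sgn (b y)) \<Longrightarrow> (P x \<longleftrightarrow> P y)"
    using assms unfolding definable_def by blast
  have "\<forall>b\<in>B. \<exists>n c. param_poly n c \<and> (\<forall>z t. poly (c z) t = b (z + t *\<^sub>R d))"
    using B(2) real_polynomial_function_along_line by blast
  then obtain n c where nc: "\<And>b. b \<in> B \<Longrightarrow> param_poly (n b) (c b)"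
    "\<And>b z t. b \<in> B \<Longrightarrow> poly (c b z) t = b (z + t *\<^sub>R d)"
    by metis
  have "sign_determined (c ` B)"
  proof (rule sign_determined)
    show "finite (c ` B)" using B by simp
    show "\<forall>q\<in>c ` B. param_poly (Max (n ` B)) q"
      using nc(1) B(1) by (auto intro!: param_poly_mono[OF nc(1)])
  qed
  then obtain C where C: "finite C" "\<forall>b\<in>C. real_polynomial_function b"
    "\<And>z z'. (\<forall>b\<in>C. sgn (b z) = sgn (b z')) \<Longrightarrow>
       \<exists>\<phi>. strict_mono \<phi> \<and> surj \<phi> \<and> (\<forall>q\<in>c ` B. \<forall>t. sgn (poly (q z) t) = sgn (poly (q z') (\<phi> t)))"
    unfolding sign_determined_def by blast
  have imp: "\<exists>t. P (z' + t *\<^sub>R d)" if agree: "\<forall>b\<in>C. sgn (b z) = sgn (b z')" and "P (z + t *\<^sub>R d)" for z z' t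
  proof -
    obtain \<phi> where "\<forall>q\<in>c ` B. \<forall>t. sgn (poly (q z) t) = sgn (poly (q z') (\<phi> t))"
      using C(3)[OF agree] by blast
    then have "\<forall>b\<in>B. sgn (b (z + t *\<^sub>R d)) = sgn (b (z' + \<phi> t *\<^sub>R d))"
      using nc(2) by (metis imageI)
    with B(3) that(2) show ?thesis by blast
  qed
  show ?thesis
    unfolding definable_def
  proof (intro exI[of _ C] conjI allI impI C(1,2))
    fix x y assume agree: "\<forall>b\<in>C. sgn (b x) = sgn (b y)"
    then have "\<forall>b\<in>C. sgn (b y) = sgn (b x)" by simp
    with agree imp show "(\<exists>t. P (x + t *\<^sub>R d)) \<longleftrightarrow> (\<exists>t. P (y + t *\<^sub>R d))" by blast
  qed
qed

lemma definable_ex_span: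
  fixes P :: "'z::real_normed_vector \<Rightarrow> bool"
  assumes "finite D" "definable P"
  shows "definable (\<lambda>z. \<exists>w\<in>span D. P (z + w))"
  using assms(1)
proof (induction D rule: finite_induct)
  case empty
  then show ?case using assms(2) by simp
next
  case (insert d D)
  have "(\<exists>w\<in>span (insert d D). P (z + w)) \<longleftrightarrow> (\<exists>t. \<exists>w\<in>span D. P (z + t *\<^sub>R d + w))" for z
  proof
    assume "\<exists>w\<in>span (insert d D). P (z + w)"
    then obtain w where w: "w \<in> span (insert d D)" "P (z + w)" by blast
    then obtain t where "w - t *\<^sub>R d \<in> span D" using span_breakdown_eq by blast
    then show "\<exists>t. \<exists>w\<in>span D. P (z + t *\<^sub>R d + w)"
      by (intro exI[of _ t] bexI[of _ "w - t *\<^sub>R d"]) (use w in \<open>simp_all add: algebra_simps\<close>)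
  next
    assume "\<exists>t. \<exists>w\<in>span D. P (z + t *\<^sub>R d + w)"
    then obtain t w where w: "w \<in> span D" "P (z + t *\<^sub>R d + w)" by blast
    then have "t *\<^sub>R d + w \<in> span (insert d D)"
      by (meson insertI1 span_add span_base span_mono span_mul subset_iff subset_insertI)
    with w show "\<exists>w\<in>span (insert d D). P (z + w)"
      by (intro bexI[of _ "t *\<^sub>R d + w"]) (simp_all add: add.assoc)
  qed
  with definable_ex_direction[OF insert.IH, of d] show ?case by simp
qed

text \<open>The quantifier over a vector is eliminated one basis direction of the second factor after the
  other. What remains does not depend on the second component, for which 0 is substituted.\<close>

theorem definable_ex:
  fixes P :: "'x::euclidean_space \<Rightarrow> 'y::euclidean_space \<Rightarrow> bool"
  assumes "definable (\<lambda>z. P (fst z) (snd z))"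
  shows "definable (\<lambda>x. \<exists>y. P x y)"
proof -
  define D :: "('x \<times> 'y) set" where "D = Pair 0 ` Basis"
  have "linear (Pair 0 :: 'y \<Rightarrow> 'x \<times> 'y)" by (rule linearI) auto
  then have "span D = Pair 0 ` span Basis" unfolding D_def by (rule span_linear_image)
  then have D: "span D = range (Pair 0)" by simp
  have "definable (\<lambda>z. \<exists>w\<in>span D. P (fst (z + w)) (snd (z + w)))"
    by (rule definable_ex_span[OF _ assms]) (simp add: D_def)
  then have "definable (\<lambda>z. \<exists>y. P (fst z) (snd z + y))" by (simp add: D)
  from definable_compose[OF this polynomial_function_Pair[OF polynomial_function_id polynomial_function_const[of 0]]]
  show ?thesis by simp
qed

lemma definable_all:
  fixes P :: "'x::euclidean_space \<Rightarrow> 'y::euclidean_space \<Rightarrow> bool"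
  assumes "definable (\<lambda>z. P (fst z) (snd z))"
  shows "definable (\<lambda>x. \<forall>y. P x y)"
  using definable_not[OF definable_ex[of "\<lambda>x y. \<not> P x y", OF definable_not[OF assms]]] by simp

definition definable_fun :: "('x::euclidean_space \<Rightarrow> real) \<Rightarrow> bool" where
  "definable_fun g \<longleftrightarrow> definable (\<lambda>z. snd z = g (fst z))"

lemma definable_fun_poly:
  assumes "real_polynomial_function g"
  shows "definable_fun g"
  unfolding definable_fun_def
proof (rule definable_poly_eq)
  show "real_polynomial_function (snd :: 'a \<times> real \<Rightarrow> real)"
    by (simp add: real_polynomial_function.intros(1) bounded_linear_snd)
  show "real_polynomial_function (\<lambda>z::'a \<times> real. g (fst z))"
    using real_polynomial_function_compose[OF polynomial_function_fst[OF polynomial_function_id] assms]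
    by (simp add: o_def)
qed

lemma definable_fun_compose:
  assumes "definable_fun g" "polynomial_function h"
  shows "definable_fun (\<lambda>x. g (h x))"
proof -
  have "polynomial_function (\<lambda>z. (h (fst z), snd z))"
    using polynomial_function_compose[OF polynomial_function_fst[OF polynomial_function_id] assms(2)]
    by (intro polynomial_function_Pair polynomial_function_snd polynomial_function_id) (simp add: o_def)
  from definable_compose[OF assms(1)[unfolded definable_fun_def] this]
  show ?thesis by (simp add: definable_fun_def)
qed

text \<open>The value \<open>g x\<close> is named by an existentially quantified real. All terms that contain definable
  functions are treated in this way.\<close>

lemma definable_subst:
  assumes "definable (\<lambda>z. P (fst z) (snd z))" "definable_fun g"
  shows "definable (\<lambda>x. P x (g x))"
proof -
  have "definable (\<lambda>x. \<exists>v. v = g x \<and> P x v)"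
    by (rule definable_ex, rule definable_conj[OF assms(2)[unfolded definable_fun_def] assms(1)])
  then show ?thesis by simp
qed

lemma definable_fun_less:
  assumes "definable_fun g" "definable_fun h"
  shows "definable (\<lambda>x. g x < h x)"
proof (rule definable_subst[OF definable_subst assms(1)])
  show "definable_fun (\<lambda>z::'a \<times> real. h (fst z))"
    by (rule definable_fun_compose[OF assms(2) polynomial_function_fst[OF polynomial_function_id]])
  show "definable (\<lambda>z::('a \<times> real) \<times> real. snd (fst z) < snd z)"
    by (intro definable_poly_less) 
      (simp_all add: real_polynomial_function_eq polynomial_function_snd polynomial_function_fst)
qed

lemma definable_fun_eq:
  assumes "definable_fun g" "definable_fun h"
  shows "definable (\<lambda>x. g x = h x)"
  using definable_conj[OF definable_not[OF definable_fun_less[OF assms]] definable_not[OF definable_fun_less[OF assms(2,1)]]]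
  by (simp add: not_less eq_iff conj_commute)

lemma definable_fun_le:
  assumes "definable_fun g" "definable_fun h"
  shows "definable (\<lambda>x. g x \<le> h x)"
  using definable_not[OF definable_fun_less[OF assms(2,1)]] by (simp add: not_less)

section \<open>Definable functions of one real variable\<close>

lemma real_polynomial_function_eq_poly:
  fixes b :: "real \<Rightarrow> real"
  assumes "real_polynomial_function b"
  obtains q where "b = poly q"
proof -
  obtain c where "\<forall>z t. poly (c z) t = b (z + t *\<^sub>R 1)"
    using real_polynomial_function_along_line[OF assms, of 1] by blast
  from this[rule_format, of 0] have "b = poly (c 0)" by (auto simp: fun_eq_iff)
  then show ?thesis by (rule that)
qed

text \<open>The tameness from which everything on functions of one variable follows: the nonzero
  polynomials among the determining ones have finitely many zeros.\<close>

lemma definable_right_germ: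
  fixes P :: "real \<Rightarrow> bool"
  assumes "definable P"
  obtains \<delta> where "\<delta> > 0" "(\<forall>t. a < t \<and> t < a + \<delta> \<longrightarrow> P t) \<or> (\<forall>t. a < t \<and> t < a + \<delta> \<longrightarrow> \<not> P t)"
proof -
  obtain B where B: "finite B" "\<forall>b\<in>B. real_polynomial_function b"
      "\<And>x y. (\<forall>b\<in>B. sgn (b x) = sgn (b y)) \<Longrightarrow> (P x \<longleftrightarrow> P y)"
    using assms unfolding definable_def by blast
  define Z where "Z = (\<Union>b\<in>{b\<in>B. b \<noteq> (\<lambda>x. 0)}. {x. b x = 0})"
  have fin: "finite Z"
    unfolding Z_def
  proof (rule finite_UN_I)
    fix b assume b: "b \<in> {b\<in>B. b \<noteq> (\<lambda>x. 0)}"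
    then obtain q where q: "b = poly q" using B(2) real_polynomial_function_eq_poly by blast
    with b have "q \<noteq> 0" by auto
    with q show "finite {x. b x = 0}" by (simp add: poly_roots_finite)
  qed (use B in simp)
  obtain x y where xy: "x < a" "a < y" "\<And>z. z \<in> Z \<Longrightarrow> z < x \<or> z = a \<or> y < z"
    using finite_isolated[OF fin] by blast
  have nz: "b t \<noteq> 0" if "b \<in> B" "b \<noteq> (\<lambda>x. 0)" "a < t" "t < y" for b t
  proof
    assume "b t = 0"
    then have "t \<in> Z" using that(1,2) by (auto simp: Z_def)
    from xy(3)[OF this] xy(1) that(3,4) show False by linarith
  qed
  have "P t \<longleftrightarrow> P u" if tu: "a < t" "t < y" "a < u" "u < y" for t u
  proof (rule B(3), rule ballI)
    fix b assume b: "b \<in> B"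
    obtain q where q: "b = poly q" using B(2) b real_polynomial_function_eq_poly by blast
    show "sgn (b t) = sgn (b u)"
    proof (cases "b = (\<lambda>x. 0)")
      case False
      show ?thesis
        unfolding q by (rule poly_sgn_const) (use nz[OF b False] tu q in auto)
    qed simp
  qed
  then show ?thesis
    by (intro that[of "y - a"]) (use xy(2) in auto)
qed

lemma definable_left_germ:
  fixes P :: "real \<Rightarrow> bool"
  assumes "definable P"
  obtains \<delta> where "\<delta> > 0" "(\<forall>t. a - \<delta> < t \<and> t < a \<longrightarrow> P t) \<or> (\<forall>t. a - \<delta> < t \<and> t < a \<longrightarrow> \<not> P t)"
proof -
  have "definable (\<lambda>t. P (- t))"
    by (rule definable_compose[OF assms]) (rule polynomial_function_minus[OF polynomial_function_id])
  then obtain \<delta> where \<delta>: "\<delta> > 0"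
    "(\<forall>t. - a < t \<and> t < - a + \<delta> \<longrightarrow> P (- t)) \<or> (\<forall>t. - a < t \<and> t < - a + \<delta> \<longrightarrow> \<not> P (- t))"
    using definable_right_germ by blast
  have eq: "- a < - t \<and> - t < - a + \<delta> \<longleftrightarrow> a - \<delta> < t \<and> t < a" for t by auto
  from \<delta>(2) have "(\<forall>t. a - \<delta> < t \<and> t < a \<longrightarrow> P t) \<or> (\<forall>t. a - \<delta> < t \<and> t < a \<longrightarrow> \<not> P t)"
    by (metis (no_types, lifting) eq add.inverse_inverse)
  with \<delta>(1) show ?thesis by (rule that)
qed

text \<open>The local conditions on both sides do the work of continuity: the infimum of the counterexamples
  to the right of \<open>s\<close> is no counterexample by the condition on its left, and then by the condition on
  its right no limit of counterexamples.\<close>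

lemma transitive_local_to_global:
  fixes g :: "real \<Rightarrow> real"
  assumes trans: "\<And>u v w. R u v \<Longrightarrow> R v w \<Longrightarrow> R u w"
    and right: "\<And>s. a < s \<Longrightarrow> s < b \<Longrightarrow> \<exists>\<epsilon>>0. \<forall>t. s < t \<and> t < s + \<epsilon> \<longrightarrow> R (g s) (g t)"
    and left: "\<And>s. a < s \<Longrightarrow> s < b \<Longrightarrow> \<exists>\<epsilon>>0. \<forall>t. s - \<epsilon> < t \<and> t < s \<longrightarrow> R (g t) (g s)"
    and st: "a < s" "s < t" "t < b"
  shows "R (g s) (g t)"
proof (rule ccontr)
  assume nR: "\<not> R (g s) (g t)"
  define V where "V = {v. s < v \<and> v \<le> t \<and> \<not> R (g s) (g v)}"
  define c where "c = Inf V"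
  have V: "t \<in> V" using nR st by (simp add: V_def)
  have bdd: "bdd_below V" by (rule bdd_belowI[of _ s]) (simp add: V_def)
  have "c \<le> t" unfolding c_def by (rule cInf_lower[OF V bdd])
  obtain \<epsilon> where \<epsilon>: "\<epsilon> > 0" "\<And>v. s < v \<Longrightarrow> v < s + \<epsilon> \<Longrightarrow> R (g s) (g v)"
    using right[of s] st by auto
  have "s + \<epsilon> \<le> c"
    unfolding c_def by (rule cInf_greatest) (use V \<epsilon>(2) in \<open>auto simp: V_def not_less[symmetric]\<close>)
  have good: "R (g s) (g v)" if "s < v" "v < c" for v
  proof (rule ccontr)
    assume "\<not> R (g s) (g v)"
    with that \<open>c \<le> t\<close> have "v \<in> V" by (simp add: V_def)
    from cInf_lower[OF this bdd] that show False by (simp add: c_def)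
  qed
  have cb: "a < c" "c < b" "s < c" using \<open>s + \<epsilon> \<le> c\<close> \<epsilon>(1) st \<open>c \<le> t\<close> by auto
  obtain \<eta> where \<eta>: "\<eta> > 0" "\<And>v. c - \<eta> < v \<Longrightarrow> v < c \<Longrightarrow> R (g v) (g c)"
    using left[OF cb(1,2)] by auto
  define v where "v = (max s (c - \<eta>) + c) / 2"
  have "s < v" "v < c" "c - \<eta> < v" using cb \<eta>(1) by (auto simp: v_def max_def field_simps)
  with good \<eta>(2) trans have gc: "R (g s) (g c)" by blast
  obtain \<zeta> where \<zeta>: "\<zeta> > 0" "\<And>v. c < v \<Longrightarrow> v < c + \<zeta> \<Longrightarrow> R (g c) (g v)"
    using right[OF cb(1,2)] by auto
  have "c + \<zeta> \<le> c"
  proof -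
    have "c + \<zeta> \<le> v" if v: "v \<in> V" for v
    proof (rule ccontr)
      assume "\<not> c + \<zeta> \<le> v"
      moreover have "c \<le> v" unfolding c_def by (rule cInf_lower[OF v bdd])
      moreover have "v \<noteq> c" using v gc by (auto simp: V_def)
      ultimately have "R (g c) (g v)" using \<zeta>(2) by auto
      with gc trans v show False by (auto simp: V_def)
    qed
    then have "c + \<zeta> \<le> Inf V" using V by (intro cInf_greatest) auto
    then show ?thesis by (simp add: c_def)
  qed
  with \<zeta>(1) show False by simp
qed

text \<open>A strict local minimum is determined by a rational interval on which it is the only minimum, so
  there are only countably many.\<close>

lemma not_everywhere_strict_local_min:
  fixes g :: "real \<Rightarrow> real"
  assumes "a < b"
    and right: "\<And>s. a < s \<Longrightarrow> s < b \<Longrightarrow> \<exists>\<epsilon>>0. \<forall>t. s < t \<and> t < s + \<epsilon> \<longrightarrow> g s < g t"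
    and left: "\<And>s. a < s \<Longrightarrow> s < b \<Longrightarrow> \<exists>\<epsilon>>0. \<forall>t. s - \<epsilon> < t \<and> t < s \<longrightarrow> g s < g t"
  shows False
proof -
  have "\<exists>p q. p \<in> \<rat> \<and> q \<in> \<rat> \<and> p < s \<and> s < q \<and> (\<forall>t. p < t \<and> t < q \<and> t \<noteq> s \<longrightarrow> g s < g t)"
    if s: "s \<in> {a<..<b}" for s
  proof -
    obtain \<epsilon> where \<epsilon>: "\<epsilon> > 0" "\<And>t. s < t \<Longrightarrow> t < s + \<epsilon> \<Longrightarrow> g s < g t"
      using right[of s] s by auto
    obtain \<eta> where \<eta>: "\<eta> > 0" "\<And>t. s - \<eta> < t \<Longrightarrow> t < s \<Longrightarrow> g s < g t"
      using left[of s] s by auto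
    obtain q where q: "q \<in> \<rat>" "s < q" "q < s + \<epsilon>" using Rats_dense_in_real[of s "s + \<epsilon>"] \<epsilon>(1) by auto
    obtain p where p: "p \<in> \<rat>" "s - \<eta> < p" "p < s" using Rats_dense_in_real[of "s - \<eta>" s] \<eta>(1) by auto
    have "g s < g t" if "p < t" "t < q" "t \<noteq> s" for t
      using \<epsilon>(2)[of t] \<eta>(2)[of t] that p q by (cases t s rule: linorder_cases) auto
    with p q show ?thesis by blast
  qed
  then obtain p q where pq: "\<And>s. s \<in> {a<..<b} \<Longrightarrow> p s \<in> \<rat> \<and> q s \<in> \<rat> \<and> p s < s \<and> s < q s \<and>
      (\<forall>t. p s < t \<and> t < q s \<and> t \<noteq> s \<longrightarrow> g s < g t)"
    by metis
  have "inj_on (\<lambda>s. (p s, q s)) {a<..<b}"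
  proof (rule inj_onI, rule ccontr)
    fix s t assume st: "s \<in> {a<..<b}" "t \<in> {a<..<b}" "(p s, q s) = (p t, q t)" "s \<noteq> t"
    then have "g s < g t" "g t < g s"
      using pq[OF st(1)] pq[OF st(2)] by (metis prod.inject)+
    then show False by simp
  qed
  moreover have "countable ((\<lambda>s. (p s, q s)) ` {a<..<b})"
    by (rule countable_subset[of _ "\<rat> \<times> \<rat>"]) (use pq countable_rat in auto)
  ultimately have "countable {a<..<b}" by (rule countable_image_inj_on[rotated])
  then show False using uncountable_open_interval[of a b] \<open>a < b\<close> by simp
qed

lemmas definable_logic = definable_ex definable_all definable_conj definable_disj definable_imp definable_not
lemmas polynomial_projections = polynomial_function_fst polynomial_function_snd polynomial_function_id
  polynomial_function_const polynomial_function_Pair polynomial_function_add polynomial_function_diff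

lemma real_polynomial_functionI: "polynomial_function f \<Longrightarrow> real_polynomial_function f"
  by (simp add: real_polynomial_function_eq)

lemma definable_fun_polynomial: "polynomial_function f \<Longrightarrow> definable_fun f"
  by (simp add: definable_fun_poly real_polynomial_function_eq)

lemma definable_germ_at_0:
  assumes "finite \<P>" "\<forall>P\<in>\<P>. definable P"
  shows "\<exists>\<delta>>0::real. \<forall>P\<in>\<P>. (\<forall>t. 0 < t \<and> t < \<delta> \<longrightarrow> P t) \<or> (\<forall>t. 0 < t \<and> t < \<delta> \<longrightarrow> \<not> P t)"
  using assms
proof (induction \<P> rule: finite_induct)
  case empty
  show ?case by (intro exI[of _ 1]) simp
next
  case (insert P \<P>)
  then obtain \<delta> where \<delta>: "\<delta> > 0" "\<And>P. P \<in> \<P> \<Longrightarrow>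
    (\<forall>t. 0 < t \<and> t < \<delta> \<longrightarrow> P t) \<or> (\<forall>t. 0 < t \<and> t < \<delta> \<longrightarrow> \<not> P t)" by auto
  have "definable P" using insert.prems by simp
  from definable_right_germ[OF this, of 0] obtain \<epsilon> where
    \<epsilon>: "\<epsilon> > 0" "(\<forall>t. 0 < t \<and> t < \<epsilon> \<longrightarrow> P t) \<or> (\<forall>t. 0 < t \<and> t < \<epsilon> \<longrightarrow> \<not> P t)" by auto
  show ?case
  proof (intro exI[of _ "min \<delta> \<epsilon>"] conjI ballI)
    fix Q assume "Q \<in> insert P \<P>"
    then show "(\<forall>t. 0 < t \<and> t < min \<delta> \<epsilon> \<longrightarrow> Q t) \<or> (\<forall>t. 0 < t \<and> t < min \<delta> \<epsilon> \<longrightarrow> \<not> Q t)"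
    proof
      assume "Q = P" with \<epsilon>(2) show ?thesis by auto
    next
      assume "Q \<in> \<P>" from \<delta>(2)[OF this] show ?thesis by auto
    qed
  qed (use \<delta> \<epsilon> in simp)
qed

lemma definable_order_relation:
  fixes h k :: "'z::euclidean_space \<Rightarrow> real"
  assumes "R \<in> {(<), (>), (=)}" "definable_fun g" "polynomial_function h" "polynomial_function k"
  shows "definable (\<lambda>x. R (g (h x)) (g (k x)))"
proof -
  have hk: "definable_fun (\<lambda>x. g (h x))" "definable_fun (\<lambda>x. g (k x))"
    using assms by (simp_all add: definable_fun_compose)
  from assms(1) consider "R = (<)" | "R = (>)" | "R = (=)" by blast
  then show ?thesis
    by cases (simp_all add: definable_fun_less[OF hk] definable_fun_less[OF hk(2,1)] definable_fun_eq[OF hk])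
qed

text \<open>At each point the values to the right are all larger, all smaller or all equal, and likewise to
  the left; near \<open>0+\<close> the same alternative holds at all points. If the alternatives on both sides
  agree, \<open>transitive_local_to_global\<close> finishes the proof. If they disagree, either all points are strict
  local extrema, or the function is locally constant on one side and strictly comparable on the other;
  both are impossible.\<close>

theorem definable_fun_monotone_germ:
  fixes g :: "real \<Rightarrow> real"
  assumes g: "definable_fun g"
  obtains \<delta> where "\<delta> > 0"
    "(\<forall>s t. 0 < s \<and> s < t \<and> t < \<delta> \<longrightarrow> g s < g t) \<or> (\<forall>s t. 0 < s \<and> s < t \<and> t < \<delta> \<longrightarrow> g s > g t) \<or>
     (\<forall>s t. 0 < s \<and> s < t \<and> t < \<delta> \<longrightarrow> g s = g t)"
proof -
  define Right where "Right = (\<lambda>R s. \<exists>\<epsilon>. 0 < \<epsilon> \<and> (\<forall>t. s < t \<and> t < s + \<epsilon> \<longrightarrow> R (g s) (g t)))"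
  define Left where "Left = (\<lambda>R s. \<exists>\<epsilon>. 0 < \<epsilon> \<and> (\<forall>t. s - \<epsilon> < t \<and> t < s \<longrightarrow> R (g t) (g s)))"
  let ?Rels = "{(<), (>), (=)} :: (real \<Rightarrow> real \<Rightarrow> bool) set"
  have "definable (Right R)" "definable (Left R)" if "R \<in> ?Rels" for R
    unfolding Right_def Left_def
    by (rule definable_logic definable_order_relation[OF that g] definable_fun_less definable_fun_polynomial polynomial_projections)+
  then have "\<exists>\<delta>>0. \<forall>P\<in>Right ` ?Rels \<union> Left ` ?Rels. (\<forall>t. 0 < t \<and> t < \<delta> \<longrightarrow> P t) \<or> (\<forall>t. 0 < t \<and> t < \<delta> \<longrightarrow> \<not> P t)"
    by (intro definable_germ_at_0) auto
  then obtain \<delta> where \<delta>: "\<delta> > 0"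
    and germ: "\<And>P. P \<in> Right ` ?Rels \<union> Left ` ?Rels \<Longrightarrow>
       (\<forall>t. 0 < t \<and> t < \<delta> \<longrightarrow> P t) \<or> (\<forall>t. 0 < t \<and> t < \<delta> \<longrightarrow> \<not> P t)" by blast
  have exR: "\<exists>R\<in>?Rels. Right R s" for s
  proof -
    have d: "definable (\<lambda>t. R (g s) (g t))" if "R \<in> ?Rels" for R
      by (rule definable_order_relation[OF that g] polynomial_projections)+
    have d1: "definable (\<lambda>t. g s < g t)" and d2: "definable (\<lambda>t. g s = g t)"
      using d[of "(<)"] d[of "(=)"] by simp_all
    obtain \<epsilon>1 where e1: "\<epsilon>1 > 0"
      "(\<forall>t. s < t \<and> t < s + \<epsilon>1 \<longrightarrow> g s < g t) \<or> (\<forall>t. s < t \<and> t < s + \<epsilon>1 \<longrightarrow> \<not> g s < g t)"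
      by (rule definable_right_germ[OF d1, of s])
    obtain \<epsilon>2 where e2: "\<epsilon>2 > 0"
      "(\<forall>t. s < t \<and> t < s + \<epsilon>2 \<longrightarrow> g s = g t) \<or> (\<forall>t. s < t \<and> t < s + \<epsilon>2 \<longrightarrow> g s \<noteq> g t)"
      by (rule definable_right_germ[OF d2, of s])
    note \<epsilon> = e1(1) e2(1) e1(2) e2(2)
    show ?thesis
    proof (cases "\<forall>t. s < t \<and> t < s + \<epsilon>1 \<longrightarrow> g s < g t")
      case True
      then have "Right (<) s" using \<epsilon>(1) by (auto simp: Right_def)
      then show ?thesis by blast
    next
      case nlt: False
      show ?thesis
      proof (cases "\<forall>t. s < t \<and> t < s + \<epsilon>2 \<longrightarrow> g s = g t")
        case True
        then have "Right (=) s" using \<epsilon>(2) by (auto simp: Right_def)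
        then show ?thesis by blast
      next
        case False
        have "g s > g t" if "s < t" "t < s + min \<epsilon>1 \<epsilon>2" for t
        proof -
          have "t < s + \<epsilon>1" "t < s + \<epsilon>2" using that by auto
          with nlt False \<epsilon>(3,4) that show ?thesis by (metis linorder_neqE_linordered_idom)
        qed
        then have "Right (>) s"
          unfolding Right_def using \<epsilon>(1,2) by (intro exI[of _ "min \<epsilon>1 \<epsilon>2"]) simp
        then show ?thesis by blast
      qed
    qed
  qed
  have exL: "\<exists>R\<in>?Rels. Left R s" for s
  proof -
    have d: "definable (\<lambda>t. R (g t) (g s))" if "R \<in> ?Rels" for R
      by (rule definable_order_relation[OF that g] polynomial_projections)+
    have d1: "definable (\<lambda>t. g t < g s)" and d2: "definable (\<lambda>t. g t = g s)"
      using d[of "(<)"] d[of "(=)"] by simp_all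
    obtain \<epsilon>1 where e1: "\<epsilon>1 > 0"
      "(\<forall>t. s - \<epsilon>1 < t \<and> t < s \<longrightarrow> g t < g s) \<or> (\<forall>t. s - \<epsilon>1 < t \<and> t < s \<longrightarrow> \<not> g t < g s)"
      by (rule definable_left_germ[OF d1, of s])
    obtain \<epsilon>2 where e2: "\<epsilon>2 > 0"
      "(\<forall>t. s - \<epsilon>2 < t \<and> t < s \<longrightarrow> g t = g s) \<or> (\<forall>t. s - \<epsilon>2 < t \<and> t < s \<longrightarrow> g t \<noteq> g s)"
      by (rule definable_left_germ[OF d2, of s])
    note \<epsilon> = e1(1) e2(1) e1(2) e2(2)
    show ?thesis
    proof (cases "\<forall>t. s - \<epsilon>1 < t \<and> t < s \<longrightarrow> g t < g s")
      case True
      then have "Left (<) s" using \<epsilon>(1) by (auto simp: Left_def)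
      then show ?thesis by blast
    next
      case nlt: False
      show ?thesis
      proof (cases "\<forall>t. s - \<epsilon>2 < t \<and> t < s \<longrightarrow> g t = g s")
        case True
        then have "Left (=) s" using \<epsilon>(2) by (auto simp: Left_def)
        then show ?thesis by blast
      next
        case False
        have "g t > g s" if "s - min \<epsilon>1 \<epsilon>2 < t" "t < s" for t
        proof -
          have "s - \<epsilon>1 < t" "s - \<epsilon>2 < t" using that by auto
          with nlt False \<epsilon>(3,4) that show ?thesis by (metis linorder_neqE_linordered_idom)
        qed
        then have "Left (>) s"
          unfolding Left_def using \<epsilon>(1,2) by (intro exI[of _ "min \<epsilon>1 \<epsilon>2"]) simp
        then show ?thesis by blast
      qed
    qed
  qed
  obtain R where R: "R \<in> ?Rels" "\<And>s. 0 < s \<Longrightarrow> s < \<delta> \<Longrightarrow> Right R s"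
    using exR[of "\<delta> / 2"] germ \<delta>(1) by (smt (verit, best) UnI1 field_sum_of_halves imageI)
  obtain R' where R': "R' \<in> ?Rels" "\<And>s. 0 < s \<Longrightarrow> s < \<delta> \<Longrightarrow> Left R' s"
    using exL[of "\<delta> / 2"] germ \<delta>(1) by (smt (verit, best) UnI2 field_sum_of_halves imageI)
  have right: "\<exists>\<epsilon>>0. \<forall>t. s < t \<and> t < s + \<epsilon> \<longrightarrow> R (g s) (g t)" if "0 < s" "s < \<delta>" for s
    using R(2)[OF that] by (simp add: Right_def)
  have left: "\<exists>\<epsilon>>0. \<forall>t. s - \<epsilon> < t \<and> t < s \<longrightarrow> R' (g t) (g s)" if "0 < s" "s < \<delta>" for s
    using R'(2)[OF that] by (simp add: Left_def)
  have "R = R'"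
  proof (rule ccontr)
    assume ne: "R \<noteq> R'"
    have half: "0 < \<delta> / 2" "\<delta> / 2 < \<delta>" using \<delta> by auto
    consider "R = (=)" | "R' = (=)" | "R = (<)" "R' = (>)" | "R = (>)" "R' = (<)"
      using R(1) R'(1) ne by auto
    then show False
    proof cases
      case 1
      then obtain \<epsilon> where \<epsilon>: "\<epsilon> > 0" "\<And>t. \<delta>/2 < t \<Longrightarrow> t < \<delta>/2 + \<epsilon> \<Longrightarrow> g (\<delta>/2) = g t"
        using right[OF half] by auto
      define s where "s = \<delta>/2 + min \<epsilon> (\<delta>/2) / 2"
      have s: "\<delta>/2 < s" "s < \<delta>/2 + \<epsilon>" "s < \<delta>" using \<epsilon>(1) \<delta> by (auto simp: s_def min_def field_simps)
      obtain \<eta> where \<eta>: "\<eta> > 0" "\<And>t. s - \<eta> < t \<Longrightarrow> t < s \<Longrightarrow> R' (g t) (g s)"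
        using left[of s] s \<delta> by auto
      define t where "t = (max (\<delta>/2) (s - \<eta>) + s) / 2"
      have t: "\<delta>/2 < t" "t < s" "s - \<eta> < t" using s \<eta>(1) by (auto simp: t_def max_def field_simps)
      have "R' (g t) (g s)" "g t = g s" using \<eta>(2)[OF t(3,2)] \<epsilon>(2)[of t] \<epsilon>(2)[of s] s t by auto
      then show False using R'(1) ne 1 by auto
    next
      case 2
      then obtain \<epsilon> where \<epsilon>: "\<epsilon> > 0" "\<And>t. \<delta>/2 - \<epsilon> < t \<Longrightarrow> t < \<delta>/2 \<Longrightarrow> g t = g (\<delta>/2)"
        using left[OF half] by auto
      define s where "s = \<delta>/2 - min \<epsilon> (\<delta>/2) / 2"
      have s: "\<delta>/2 - \<epsilon> < s" "s < \<delta>/2" "0 < s" using \<epsilon>(1) \<delta> by (auto simp: s_def min_def field_simps)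
      obtain \<eta> where \<eta>: "\<eta> > 0" "\<And>t. s < t \<Longrightarrow> t < s + \<eta> \<Longrightarrow> R (g s) (g t)"
        using right[of s] s \<delta> by auto
      define t where "t = (min (\<delta>/2) (s + \<eta>) + s) / 2"
      have t: "t < \<delta>/2" "s < t" "t < s + \<eta>" using s \<eta>(1) by (auto simp: t_def min_def field_simps)
      have "R (g s) (g t)" "g t = g s" using \<eta>(2)[OF t(2,3)] \<epsilon>(2)[of t] \<epsilon>(2)[of s] s t by auto
      then show False using R(1) ne 2 by auto
    next
      case 3
      show False
        by (rule not_everywhere_strict_local_min[OF \<delta>, of g]) (use right left 3 in auto)
    next
      case 4
      show False
        by (rule not_everywhere_strict_local_min[OF \<delta>, of "\<lambda>t. - g t"]) (use right left 4 in auto)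
    qed
  qed
  have "R (g s) (g t)" if "0 < s" "s < t" "t < \<delta>" for s t
  proof (rule transitive_local_to_global[of R 0 \<delta> g])
    show "\<And>u v w. R u v \<Longrightarrow> R v w \<Longrightarrow> R u w" using R(1) by auto
  qed (use right left \<open>R = R'\<close> that in auto)
  with R(1) \<delta> show ?thesis by (intro that[of \<delta>]) auto
qed

lemma real_poly_flatness_bound:
  fixes q :: "real poly"
  assumes "q \<noteq> 0"
  shows "\<exists>k c \<epsilon>. 0 < c \<and> 0 < \<epsilon> \<and> (\<forall>u. \<bar>u\<bar> < \<epsilon> \<longrightarrow> c * \<bar>u\<bar> ^ k \<le> \<bar>poly q u\<bar>)"
proof -
  define k where "k = order 0 q"
  obtain r where r: "q = [:- 0, 1:] ^ k * r" "\<not> [:- 0, 1:] dvd r"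
    using order_decomp[OF assms, of 0] unfolding k_def by blast
  from r(2) have r0: "poly r 0 \<noteq> 0" by (simp add: poly_eq_0_iff_dvd)
  have "isCont (\<lambda>u. \<bar>poly r u\<bar>) 0" by (intro continuous_intros)
  then have "((\<lambda>u. \<bar>poly r u\<bar>) \<longlongrightarrow> \<bar>poly r 0\<bar>) (nhds 0)"
    by (metis isCont_def tendsto_at_iff_tendsto_nhds[of "\<lambda>u. \<bar>poly r u\<bar>"])
  moreover have "\<bar>poly r 0\<bar> / 2 < \<bar>poly r 0\<bar>" using r0 by simp
  ultimately have "eventually (\<lambda>u. \<bar>poly r 0\<bar> / 2 < \<bar>poly r u\<bar>) (nhds 0)"
    by (rule order_tendstoD(1))
  then obtain \<epsilon> where \<epsilon>: "\<epsilon> > 0" "\<And>u. \<bar>u\<bar> < \<epsilon> \<Longrightarrow> \<bar>poly r 0\<bar> / 2 < \<bar>poly r u\<bar>"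
    unfolding eventually_nhds_metric by (auto simp: dist_real_def)
  have "\<bar>poly r 0\<bar> / 2 * \<bar>u\<bar> ^ k \<le> \<bar>poly q u\<bar>" if "\<bar>u\<bar> < \<epsilon>" for u
  proof -
    have "\<bar>poly r 0\<bar> / 2 * \<bar>u\<bar> ^ k \<le> \<bar>poly r u\<bar> * \<bar>u\<bar> ^ k"
      using \<epsilon>(2)[OF that] by (intro mult_right_mono) auto
    also have "\<dots> = \<bar>poly q u\<bar>" by (simp add: r(1) abs_mult power_abs)
    finally show ?thesis .
  qed
  then show ?thesis
    by - (rule exI[of _ k], rule exI[of _ "\<bar>poly r 0\<bar> / 2"], rule exI[of _ \<epsilon>], use \<epsilon>(1) r0 in simp)
qed

text \<open>After division by the largest possible power of \<open>s\<close>, the polynomial \<open>b\<close> becomes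
  \<open>q(u) + s r(s, u)\<close> with \<open>q\<close> different from 0. Near the origin a zero with \<open>s > 0\<close> satisfies
  \<open>|q(u)| \<le> M s\<close>, and \<open>q\<close> vanishes only to finite order at 0.\<close>

lemma polynomial_zero_set_bound:
  fixes b :: "real \<times> real \<Rightarrow> real"
  assumes b: "real_polynomial_function b" and nz: "b z0 \<noteq> 0"
  shows "\<exists>k M \<epsilon>. 0 < \<epsilon> \<and> (\<forall>s u. 0 < s \<and> s < \<epsilon> \<and> \<bar>u\<bar> < \<epsilon> \<and> b (s, u) = 0 \<longrightarrow> \<bar>u\<bar> ^ k \<le> M * s)"
proof -
  obtain n e where e: "param_poly n e" "\<And>z t. poly (e z) t = b (z + t *\<^sub>R (1, 0))"
    using real_polynomial_function_along_line[OF b, of "(1, 0)"] by blast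
  define c where "c = (\<lambda>u. e (0, u))"
  have b_eq: "b (s, u) = poly (c u) s" for s u by (simp add: c_def e(2))
  have "\<exists>i u. coeff (c u) i \<noteq> 0"
  proof (rule ccontr)
    assume "\<not> ?thesis"
    then have "c u = 0" for u by (simp add: poly_eq_iff)
    then have "b (fst z0, snd z0) = 0" unfolding b_eq by simp
    with nz show False by simp
  qed
  define m where "m = (LEAST i. \<exists>u. coeff (c u) i \<noteq> 0)"
  have m: "\<exists>u. coeff (c u) m \<noteq> 0"
    unfolding m_def using \<open>\<exists>i u. _\<close> by (rule LeastI_ex)
  have low: "coeff (c u) i = 0" if "i < m" for i u
    using not_less_Least[OF that[unfolded m_def]] by blast
  have rpf: "real_polynomial_function (\<lambda>u. coeff (c u) i)" for i
    using real_polynomial_function_compose[OF polynomial_function_Pair[OF polynomial_function_const[of 0] polynomial_function_id]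
        param_polyD(3)[OF e(1), of i]]
    by (simp add: c_def o_def)
  obtain q where q: "(\<lambda>u. coeff (c u) m) = poly q" using real_polynomial_function_eq_poly[OF rpf] .
  with m have "q \<noteq> 0" by (metis poly_0)
  from real_poly_flatness_bound[OF this]
  obtain k d \<eta> where d: "0 < d" "0 < \<eta>" "\<And>u. \<bar>u\<bar> < \<eta> \<Longrightarrow> d * \<bar>u\<bar> ^ k \<le> \<bar>poly q u\<bar>" by blast
  have "\<exists>K. \<forall>u\<in>{-1..1}. \<bar>coeff (c u) i\<bar> \<le> K" for i
  proof -
    have "continuous_on {-1..1} (\<lambda>u. coeff (c u) i)"
      by (rule continuous_on_polymonial_function) (use rpf in \<open>simp add: real_polynomial_function_eq\<close>)
    then have "bounded ((\<lambda>u. coeff (c u) i) ` {-1..1})"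
      by (intro compact_imp_bounded compact_continuous_image) auto
    then show ?thesis by (auto simp: bounded_iff)
  qed
  then obtain K where K: "\<And>i u. u \<in> {-1..1} \<Longrightarrow> \<bar>coeff (c u) i\<bar> \<le> K i" by metis
  define M where "M = (\<Sum>i\<le>n. K (i + Suc m))"
  have "\<bar>u\<bar> ^ k \<le> M / d * s" if su: "0 < s" "s < min \<eta> 1" "\<bar>u\<bar> < min \<eta> 1" "b (s, u) = 0" for s u
  proof -
    define r where "r = poly_shift (Suc m) (c u)"
    have r: "degree r \<le> n"
      by (rule degree_le) (auto simp: r_def coeff_poly_shift c_def intro!: param_polyD(2)[OF e(1)])
    have "c u = monom 1 m * pCons (coeff (c u) m) r"
    proof (rule poly_eqI)
      fix i
      show "coeff (c u) i = coeff (monom 1 m * pCons (coeff (c u) m) r) i"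
      proof (cases "i < m")
        case False
        then obtain l where l: "i = m + l" by (metis le_Suc_ex not_less)
        then show ?thesis
          by (cases l) (simp_all add: coeff_monom_mult r_def coeff_poly_shift add.commute del: mult_pCons_right)
      qed (simp add: coeff_monom_mult low del: mult_pCons_right)
    qed
    then have "poly (c u) s = s ^ m * (coeff (c u) m + s * poly r s)"
      by (metis poly_mult poly_monom poly_pCons mult_1)
    with su(1,4) have "coeff (c u) m = - s * poly r s" by (simp add: b_eq add_eq_0_iff)
    then have eq: "\<bar>poly q u\<bar> = s * \<bar>poly r s\<bar>"
      using su(1) fun_cong[OF q, of u] by (simp add: abs_mult)
    have "poly r s = (\<Sum>i\<le>n. coeff r i * s ^ i)"
      unfolding poly_altdef using r by (intro sum.mono_neutral_left) (auto simp: coeff_eq_0)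
    also have "\<bar>\<dots>\<bar> \<le> (\<Sum>i\<le>n. \<bar>coeff r i * s ^ i\<bar>)" by (rule sum_abs)
    also have "\<dots> \<le> M"
      unfolding M_def
    proof (rule sum_mono)
      fix i
      have "\<bar>coeff r i\<bar> \<le> K (i + Suc m)"
        unfolding r_def coeff_poly_shift by (rule K) (use su(3) in auto)
      moreover have "s ^ i \<le> 1" using su(1,2) by (intro power_le_one) auto
      ultimately have "\<bar>coeff r i\<bar> * s ^ i \<le> K (i + Suc m) * 1"
        using su(1) by (intro mult_mono) auto
      then show "\<bar>coeff r i * s ^ i\<bar> \<le> K (i + Suc m)" using su(1) by (simp add: abs_mult)
    qed
    finally have "s * \<bar>poly r s\<bar> \<le> s * M" using su(1) by simp
    moreover have "d * \<bar>u\<bar> ^ k \<le> \<bar>poly q u\<bar>" using d(3) su(3) by simp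
    ultimately have "d * \<bar>u\<bar> ^ k \<le> s * M" using eq by simp
    then show ?thesis using d(1) by (simp add: field_simps)
  qed
  then show ?thesis
    by - (rule exI[of _ k], rule exI[of _ "M / d"], rule exI[of _ "min \<eta> 1"], use d(2) in auto)
qed

lemma polynomials_zero_set_bound:
  fixes B :: "(real \<times> real \<Rightarrow> real) set"
  assumes "finite B" "\<forall>b\<in>B. real_polynomial_function b \<and> (\<exists>z. b z \<noteq> 0)"
  shows "\<exists>k M \<epsilon>. 0 < \<epsilon> \<and> \<epsilon> \<le> 1 \<and>
     (\<forall>s u. 0 < s \<and> s < \<epsilon> \<and> \<bar>u\<bar> < \<epsilon> \<and> (\<exists>b\<in>B. b (s, u) = 0) \<longrightarrow> \<bar>u\<bar> ^ k \<le> M * s)"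
  using assms
proof (induction B rule: finite_induct)
  case empty
  show ?case by (rule exI[of _ 0], rule exI[of _ 1], rule exI[of _ 1]) auto
next
  case (insert b B)
  have "\<forall>b\<in>B. real_polynomial_function b \<and> (\<exists>z. b z \<noteq> 0)"
    using insert.prems by blast
  from insert.IH[OF this] obtain k1 M1 e1 where 1: "0 < e1" "e1 \<le> 1"
    "\<And>s u. 0 < s \<Longrightarrow> s < e1 \<Longrightarrow> \<bar>u\<bar> < e1 \<Longrightarrow> (\<exists>b\<in>B. b (s, u) = 0) \<Longrightarrow> \<bar>u\<bar> ^ k1 \<le> M1 * s"
    by blast
  obtain z0 where "real_polynomial_function b" "b z0 \<noteq> 0" using insert.prems by auto
  from polynomial_zero_set_bound[OF this] obtain k2 M2 e2 where 2: "0 < e2"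
    "\<And>s u. 0 < s \<Longrightarrow> s < e2 \<Longrightarrow> \<bar>u\<bar> < e2 \<Longrightarrow> b (s, u) = 0 \<Longrightarrow> \<bar>u\<bar> ^ k2 \<le> M2 * s"
    by blast
  have "\<bar>u\<bar> ^ max k1 k2 \<le> max M1 M2 * s"
    if su: "0 < s" "s < min e1 e2" "\<bar>u\<bar> < min e1 e2" "\<exists>b\<in>insert b B. b (s, u) = 0" for s u
  proof -
    have u1: "\<bar>u\<bar> \<le> 1" using su(3) 1(2) by simp
    have "\<bar>u\<bar> ^ k1 \<le> M1 * s \<or> \<bar>u\<bar> ^ k2 \<le> M2 * s" using 1(3)[of s u] 2(2)[of s u] su by auto
    moreover have "\<bar>u\<bar> ^ max k1 k2 \<le> \<bar>u\<bar> ^ k1" "\<bar>u\<bar> ^ max k1 k2 \<le> \<bar>u\<bar> ^ k2"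
      using u1 by (simp_all add: power_decreasing)
    moreover have "M1 * s \<le> max M1 M2 * s" "M2 * s \<le> max M1 M2 * s"
      using su(1) by (simp_all add: mult_right_mono)
    ultimately show ?thesis by linarith
  qed
  then show ?case
    by - (rule exI[of _ "max k1 k2"], rule exI[of _ "max M1 M2"], rule exI[of _ "min e1 e2"], use 1(1,2) 2(1) in auto)
qed

text \<open>At a point \<open>(s, u)\<close> of the graph one of the determining polynomials that are not identically 0
  must vanish. Otherwise all signs persist for nearby \<open>u\<close>, against the uniqueness of the value.\<close>

theorem definable_graph_power_bound:
  fixes H :: "real \<Rightarrow> real \<Rightarrow> bool"
  assumes def: "definable (\<lambda>z. H (fst z) (snd z))" and "0 < \<epsilon>"
    and uniq: "\<And>s u v. 0 < s \<Longrightarrow> s < \<epsilon> \<Longrightarrow> H s u \<Longrightarrow> H s v \<Longrightarrow> u = v"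
  shows "\<exists>k M \<delta>. 0 < \<delta> \<and> \<delta> \<le> 1 \<and>
    (\<forall>s u. 0 < s \<and> s < \<delta> \<and> \<bar>u\<bar> < \<delta> \<and> H s u \<longrightarrow> \<bar>u\<bar> ^ k \<le> M * s)"
proof -
  obtain B where B: "finite B" "\<forall>b\<in>B. real_polynomial_function b"
      "\<And>x y. (\<forall>b\<in>B. sgn (b x) = sgn (b y)) \<Longrightarrow> (H (fst x) (snd x) \<longleftrightarrow> H (fst y) (snd y))"
    using def unfolding definable_def by blast
  define B' where "B' = {b\<in>B. \<exists>z. b z \<noteq> 0}"
  have "finite B'" "\<forall>b\<in>B'. real_polynomial_function b \<and> (\<exists>z. b z \<noteq> 0)"
    using B(1,2) by (auto simp: B'_def)
  from polynomials_zero_set_bound[OF this]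
  obtain k M \<delta> where \<delta>: "0 < \<delta>" "\<delta> \<le> 1"
     "\<And>s u. 0 < s \<Longrightarrow> s < \<delta> \<Longrightarrow> \<bar>u\<bar> < \<delta> \<Longrightarrow> (\<exists>b\<in>B'. b (s, u) = 0) \<Longrightarrow> \<bar>u\<bar> ^ k \<le> M * s"
    by blast
  have "\<exists>b\<in>B'. b (s, u) = 0" if s: "0 < s" "s < \<epsilon>" and H: "H s u" for s u
  proof (rule ccontr)
    assume no: "\<not> ?thesis"
    have "eventually (\<lambda>v. \<forall>b\<in>B'. sgn (b (s, v)) = sgn (b (s, u))) (at u)"
    proof (rule eventually_ball_finite)
      show "finite B'" using B(1) by (simp add: B'_def)
      show "\<forall>b\<in>B'. eventually (\<lambda>v. sgn (b (s, v)) = sgn (b (s, u))) (at u)"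
      proof
        fix b assume b: "b \<in> B'"
        have "continuous_on UNIV b"
          by (rule continuous_on_polymonial_function)
             (use b B(2) in \<open>simp add: B'_def real_polynomial_function_eq\<close>)
        then have "continuous_on UNIV (\<lambda>v. b (s, v))"
          by (rule continuous_on_compose2) (auto intro: continuous_intros)
        then have lim: "((\<lambda>v. b (s, v)) \<longlongrightarrow> b (s, u)) (at u)"
          by (simp add: continuous_on_def)
        have "b (s, u) \<noteq> 0" using no b by blast
        then consider "0 < b (s, u)" | "b (s, u) < 0" by linarith
        then show "eventually (\<lambda>v. sgn (b (s, v)) = sgn (b (s, u))) (at u)"
        proof cases
          case 1
          from order_tendstoD(1)[OF lim 1] show ?thesis
            by (rule eventually_mono) (use 1 in simp)
        next
          case 2
          from order_tendstoD(2)[OF lim 2] show ?thesis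
            by (rule eventually_mono) (use 2 in simp)
        qed
      qed
    qed
    moreover have "eventually (\<lambda>v. v \<noteq> u) (at u)" by (simp add: eventually_at_filter)
    ultimately have "eventually (\<lambda>v. v \<noteq> u \<and> (\<forall>b\<in>B'. sgn (b (s, v)) = sgn (b (s, u)))) (at u)"
      by (simp add: eventually_conj)
    from eventually_happens'[OF trivial_limit_at this] obtain v where
      v: "v \<noteq> u" "\<And>b. b \<in> B' \<Longrightarrow> sgn (b (s, v)) = sgn (b (s, u))" by blast
    have "\<forall>b\<in>B. sgn (b (s, v)) = sgn (b (s, u))"
    proof
      fix b assume "b \<in> B"
      then show "sgn (b (s, v)) = sgn (b (s, u))"
        using v(2)[of b] by (cases "b \<in> B'") (auto simp: B'_def)
    qed
    from B(3)[OF this] H have "H s v" by simp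
    with uniq[OF s H] v(1) show False by simp
  qed
  then show ?thesis
    by - (rule exI[of _ k], rule exI[of _ M], rule exI[of _ "min \<delta> \<epsilon>"], use \<delta> \<open>0 < \<epsilon>\<close> in auto)
qed

section \<open>Curves in definable sets\<close>

lemma definable_compose2:
  assumes "definable (\<lambda>z. P (fst z) (snd z))" "polynomial_function h" "polynomial_function k"
  shows "definable (\<lambda>w. P (h w) (k w))"
  using definable_compose[OF assms(1) polynomial_function_Pair[OF assms(2,3)]] by simp

lemma definable_fun_add:
  assumes "definable_fun g" "definable_fun h"
  shows "definable_fun (\<lambda>x. g x + h x)"
proof -
  have g: "definable_fun (\<lambda>z::'a \<times> real. g (fst z))"
    by (rule definable_fun_compose[OF assms(1)]) (rule polynomial_projections)+
  have h: "definable_fun (\<lambda>w::('a \<times> real) \<times> real. h (fst (fst w)))"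
    by (rule definable_fun_compose[OF assms(2)]) (rule polynomial_projections)+
  have "definable (\<lambda>w::(('a \<times> real) \<times> real) \<times> real. snd (fst (fst w)) = snd (fst w) + snd w)"
    by (rule definable_poly_eq; rule real_polynomial_functionI) (rule polynomial_projections)+
  then have "definable (\<lambda>w::('a \<times> real) \<times> real. snd (fst w) = snd w + h (fst (fst w)))"
    by (rule definable_subst[where P = "\<lambda>w v. snd (fst w) = snd w + v", OF _ h])
  then have "definable (\<lambda>z::'a \<times> real. snd z = g (fst z) + h (fst z))"
    by (rule definable_subst[where P = "\<lambda>z v. snd z = v + h (fst z)", OF _ g])
  then show ?thesis by (simp add: definable_fun_def)
qed

text \<open>Compact fibres are narrowed by minimizing one coordinate after the other. This choice is definable
  because minimality is a quantified statement.\<close>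

lemma definable_selection_step:
  fixes \<Phi> :: "real \<Rightarrow> 'a::euclidean_space \<Rightarrow> bool"
  assumes "finite S" and def: "definable (\<lambda>z. \<Phi> (fst z) (snd z))"
    and fib: "\<And>s. 0 < s \<Longrightarrow> s < \<epsilon> \<Longrightarrow> compact {x. \<Phi> s x} \<and> {x. \<Phi> s x} \<noteq> {}"
  shows "\<exists>\<Psi>. definable (\<lambda>z. \<Psi> (fst z) (snd z)) \<and> (\<forall>s x. \<Psi> s x \<longrightarrow> \<Phi> s x) \<and>
    (\<forall>s. 0 < s \<and> s < \<epsilon> \<longrightarrow> compact {x. \<Psi> s x} \<and> {x. \<Psi> s x} \<noteq> {}) \<and>
    (\<forall>s x y. \<forall>b\<in>S. \<Psi> s x \<and> \<Psi> s y \<longrightarrow> x \<bullet> b = y \<bullet> b)"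
  using assms(1)
proof (induction S rule: finite_induct)
  case empty
  show ?case by (rule exI[of _ \<Phi>]) (use def fib in auto)
next
  case (insert b S)
  then obtain \<Psi> where \<Psi>: "definable (\<lambda>z. \<Psi> (fst z) (snd z))" "\<And>s x. \<Psi> s x \<Longrightarrow> \<Phi> s x"
    "\<And>s. 0 < s \<Longrightarrow> s < \<epsilon> \<Longrightarrow> compact {x. \<Psi> s x} \<and> {x. \<Psi> s x} \<noteq> {}"
    "\<And>s x y b. b \<in> S \<Longrightarrow> \<Psi> s x \<Longrightarrow> \<Psi> s y \<Longrightarrow> x \<bullet> b = y \<bullet> b" by blast
  define \<Psi>' where "\<Psi>' = (\<lambda>s x. \<Psi> s x \<and> (\<forall>y. \<Psi> s y \<longrightarrow> x \<bullet> b \<le> y \<bullet> b))"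
  have fib': "compact {x. \<Psi>' s x} \<and> {x. \<Psi>' s x} \<noteq> {}" if s: "0 < s" "s < \<epsilon>" for s
  proof -
    have "continuous_on {x. \<Psi> s x} (\<lambda>x. x \<bullet> b)" by (intro continuous_intros)
    then obtain m where m: "\<Psi> s m" "\<And>y. \<Psi> s y \<Longrightarrow> m \<bullet> b \<le> y \<bullet> b"
      using continuous_attains_inf[of "{x. \<Psi> s x}" "\<lambda>x. x \<bullet> b"] \<Psi>(3)[OF s] by auto
    have "{x. \<Psi>' s x} = {x. \<Psi> s x} \<inter> {x. b \<bullet> x \<le> m \<bullet> b}"
      using m by (force simp: \<Psi>'_def inner_commute)
    moreover have "closed {x. b \<bullet> x \<le> m \<bullet> b}" by (rule closed_halfspace_le)
    ultimately have "compact {x. \<Psi>' s x}" using \<Psi>(3)[OF s] by (simp add: compact_Int_closed)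
    moreover have "\<Psi>' s m" using m by (simp add: \<Psi>'_def)
    ultimately show ?thesis by blast
  qed
  have def': "definable (\<lambda>z. \<Psi>' (fst z) (snd z))"
    unfolding \<Psi>'_def
    by (rule definable_logic definable_compose2[OF \<Psi>(1)] definable_poly_le real_polynomial_function_inner
        polynomial_projections)+
  show ?case
  proof (rule exI[of _ \<Psi>'], intro conjI allI impI ballI)
    show "definable (\<lambda>z. \<Psi>' (fst z) (snd z))" by (rule def')
    show "\<Phi> s x" if "\<Psi>' s x" for s x using that \<Psi>(2) by (simp add: \<Psi>'_def)
    show "compact {x. \<Psi>' s x}" "{x. \<Psi>' s x} \<noteq> {}" if "0 < s \<and> s < \<epsilon>" for s using fib' that by auto
    fix s x y c assume c: "c \<in> insert b S" and xy: "\<Psi>' s x \<and> \<Psi>' s y"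
    show "x \<bullet> c = y \<bullet> c"
    proof (cases "c = b")
      case True with xy show ?thesis by (auto simp: \<Psi>'_def intro: antisym)
    next
      case False
      then show ?thesis using c xy \<Psi>(4)[of c s x y] by (simp add: \<Psi>'_def)
    qed
  qed
qed

theorem definable_selection:
  fixes \<Phi> :: "real \<Rightarrow> 'a::euclidean_space \<Rightarrow> bool"
  assumes def: "definable (\<lambda>z. \<Phi> (fst z) (snd z))"
    and fib: "\<And>s. 0 < s \<Longrightarrow> s < \<epsilon> \<Longrightarrow> compact {x. \<Phi> s x} \<and> {x. \<Phi> s x} \<noteq> {}"
  obtains \<xi> where "\<And>s. 0 < s \<Longrightarrow> s < \<epsilon> \<Longrightarrow> \<Phi> s (\<xi> s)" "\<And>b. definable_fun (\<lambda>s. \<xi> s \<bullet> b)"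
proof -
  obtain \<Psi> where \<Psi>: "definable (\<lambda>z. \<Psi> (fst z) (snd z))" "\<And>s x. \<Psi> s x \<Longrightarrow> \<Phi> s x"
    "\<And>s. 0 < s \<Longrightarrow> s < \<epsilon> \<Longrightarrow> {x. \<Psi> s x} \<noteq> {}"
    "\<And>s x y b. b \<in> Basis \<Longrightarrow> \<Psi> s x \<Longrightarrow> \<Psi> s y \<Longrightarrow> x \<bullet> b = y \<bullet> b"
    using definable_selection_step[of Basis \<Phi> \<epsilon>, OF finite_Basis def fib] by blast
  define \<xi> where "\<xi> = (\<lambda>s. if 0 < s \<and> s < \<epsilon> then SOME x. \<Psi> s x else 0)"
  have \<xi>: "\<Psi> s (\<xi> s)" if s: "0 < s" "s < \<epsilon>" for s
    using someI_ex[of "\<Psi> s"] \<Psi>(3)[OF s] s by (auto simp: \<xi>_def)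
  have uniq: "x = y" if "\<Psi> s x" "\<Psi> s y" for s x y
    using \<Psi>(4)[OF _ that] by (rule euclidean_eqI)
  have graph: "y = \<xi> s \<bullet> b \<longleftrightarrow> ((0 < s \<and> s < \<epsilon>) \<and> (\<exists>x. \<Psi> s x \<and> y = x \<bullet> b)) \<or> (\<not> (0 < s \<and> s < \<epsilon>) \<and> y = 0)" for s y b
  proof (cases "0 < s \<and> s < \<epsilon>")
    case True
    then have "\<Psi> s x \<longleftrightarrow> x = \<xi> s" for x using \<xi>[of s] uniq by blast
    with True show ?thesis by simp
  next
    case False
    then have "\<xi> s = 0" by (auto simp: \<xi>_def)
    with False show ?thesis by auto
  qed
  have "definable_fun (\<lambda>s. \<xi> s \<bullet> b)" for b
    unfolding definable_fun_def graph
    by (rule definable_logic definable_compose2[OF \<Psi>(1)] definable_poly_less definable_poly_eq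
        real_polynomial_function_inner real_polynomial_functionI polynomial_projections)+
  with \<xi> \<Psi>(2) show ?thesis by (intro that[of \<xi>]) auto
qed

lemma mono_from_short_steps:
  fixes U :: "real \<Rightarrow> real"
  assumes "0 < \<eta>" and step: "\<And>s t. a \<le> s \<Longrightarrow> s < t \<Longrightarrow> t \<le> b \<Longrightarrow> t - s \<le> \<eta> \<Longrightarrow> U s \<le> U t"
    and "a \<le> b"
  shows "U a \<le> U b"
proof -
  have *: "U s \<le> U b" if "b - s \<le> real n * \<eta>" "a \<le> s" "s \<le> b" for n s
    using that
  proof (induction n arbitrary: s)
    case 0 then show ?case by simp
  next
    case (Suc n)
    show ?case
    proof (cases "b - s \<le> \<eta>")
      case True
      then show ?thesis using step[of s b] Suc.prems by (cases "s = b") auto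
    next
      case False
      then have "U s \<le> U (s + \<eta>)" using step[of s "s + \<eta>"] Suc.prems \<open>0 < \<eta>\<close> by auto
      also have "U (s + \<eta>) \<le> U b" using Suc.IH[of "s + \<eta>"] Suc.prems \<open>0 < \<eta>\<close> False by (auto simp: algebra_simps)
      finally show ?thesis .
    qed
  qed
  obtain n where "b - a \<le> real n * \<eta>"
    using real_arch_simple[of "(b - a) / \<eta>"] \<open>0 < \<eta>\<close> by (auto simp: field_simps)
  from *[OF this] \<open>a \<le> b\<close> show ?thesis by simp
qed

text \<open>With \<open>\<sigma> b\<close> the direction of monotonicity of the coordinate \<open>b\<close>, the function
  \<open>V = \<Sum>b. \<sigma> b * (\<xi> \<bullet> b)\<close> is bounded and its increments are sums of absolute coordinate increments.\<close>

lemma definable_curve_variation: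
  fixes \<xi> :: "real \<Rightarrow> 'a::euclidean_space"
  assumes def: "\<And>b. definable_fun (\<lambda>s. \<xi> s \<bullet> b)"
    and bdd: "\<And>s. 0 < s \<Longrightarrow> s < \<epsilon> \<Longrightarrow> norm (\<xi> s) \<le> R" and "0 < \<epsilon>"
  shows "\<exists>\<delta> V K. 0 < \<delta> \<and> (\<forall>s. 0 < s \<and> s < \<delta> \<longrightarrow> \<bar>V s\<bar> \<le> K) \<and>
    (\<forall>s t. 0 < s \<and> s < t \<and> t < \<delta> \<longrightarrow> norm (\<xi> t - \<xi> s) \<le> V t - V s)"
proof -
  have "\<exists>\<delta> \<sigma>. 0 < \<delta> \<and> \<bar>\<sigma>\<bar> = 1 \<and> (\<forall>s t. 0 < s \<and> s < t \<and> t < \<delta> \<longrightarrow>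
      \<bar>\<xi> t \<bullet> b - \<xi> s \<bullet> b\<bar> = \<sigma> * (\<xi> t \<bullet> b) - \<sigma> * (\<xi> s \<bullet> b))" for b
  proof -
    obtain \<delta> where \<delta>: "0 < \<delta>"
      "(\<forall>s t. 0 < s \<and> s < t \<and> t < \<delta> \<longrightarrow> \<xi> s \<bullet> b < \<xi> t \<bullet> b) \<or>
       (\<forall>s t. 0 < s \<and> s < t \<and> t < \<delta> \<longrightarrow> \<xi> s \<bullet> b > \<xi> t \<bullet> b) \<or>
       (\<forall>s t. 0 < s \<and> s < t \<and> t < \<delta> \<longrightarrow> \<xi> s \<bullet> b = \<xi> t \<bullet> b)"
      by (rule definable_fun_monotone_germ[OF def])
    from \<delta>(2) show ?thesis
    proof (elim disjE)
      assume "\<forall>s t. 0 < s \<and> s < t \<and> t < \<delta> \<longrightarrow> \<xi> s \<bullet> b < \<xi> t \<bullet> b"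
      then show ?thesis by - (rule exI[of _ \<delta>], rule exI[of _ 1], use \<delta>(1) in fastforce)
    next
      assume "\<forall>s t. 0 < s \<and> s < t \<and> t < \<delta> \<longrightarrow> \<xi> s \<bullet> b > \<xi> t \<bullet> b"
      then show ?thesis by - (rule exI[of _ \<delta>], rule exI[of _ "-1"], use \<delta>(1) in fastforce)
    next
      assume "\<forall>s t. 0 < s \<and> s < t \<and> t < \<delta> \<longrightarrow> \<xi> s \<bullet> b = \<xi> t \<bullet> b"
      then show ?thesis by - (rule exI[of _ \<delta>], rule exI[of _ 1], use \<delta>(1) in fastforce)
    qed
  qed
  then obtain d \<sigma> where d: "\<And>b. 0 < d b" and \<sigma>: "\<And>b. \<bar>\<sigma> b\<bar> = 1"
    and mono: "\<And>b s t. 0 < s \<Longrightarrow> s < t \<Longrightarrow> t < d b \<Longrightarrow>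
      \<bar>\<xi> t \<bullet> b - \<xi> s \<bullet> b\<bar> = \<sigma> b * (\<xi> t \<bullet> b) - \<sigma> b * (\<xi> s \<bullet> b)"
    by metis
  define \<delta> where "\<delta> = Min (insert \<epsilon> (d ` Basis))"
  have \<delta>: "0 < \<delta>" "\<delta> \<le> \<epsilon>" "\<And>b. b \<in> Basis \<Longrightarrow> \<delta> \<le> d b"
    using d \<open>0 < \<epsilon>\<close> by (auto simp: \<delta>_def simp del: Min_insert intro: Min_le)
  define V where "V = (\<lambda>s. \<Sum>b\<in>Basis. \<sigma> b * (\<xi> s \<bullet> b))"
  show ?thesis
  proof (rule exI[of _ \<delta>], rule exI[of _ V], rule exI[of _ "\<Sum>b\<in>(Basis::'a set). R"], intro conjI allI impI)
    fix s assume "0 < s \<and> s < \<delta>"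
    then have s: "0 < s" "s < \<delta>" by auto
    have "\<bar>V s\<bar> \<le> (\<Sum>b\<in>Basis. \<bar>\<sigma> b * (\<xi> s \<bullet> b)\<bar>)" unfolding V_def by (rule sum_abs)
    also have "\<dots> \<le> (\<Sum>b\<in>(Basis::'a set). R)"
    proof (rule sum_mono)
      fix b :: 'a assume b: "b \<in> Basis"
      have "\<bar>\<xi> s \<bullet> b\<bar> \<le> norm (\<xi> s)" by (rule Basis_le_norm[OF b])
      also have "\<dots> \<le> R" using bdd s \<delta>(2) by auto
      finally show "\<bar>\<sigma> b * (\<xi> s \<bullet> b)\<bar> \<le> R" by (simp add: abs_mult \<sigma>)
    qed
    finally show "\<bar>V s\<bar> \<le> (\<Sum>b\<in>(Basis::'a set). R)" .
  next
    fix s t assume "0 < s \<and> s < t \<and> t < \<delta>"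
    then have st: "0 < s" "s < t" "t < \<delta>" by auto
    have "norm (\<xi> t - \<xi> s) \<le> (\<Sum>b\<in>Basis. \<bar>(\<xi> t - \<xi> s) \<bullet> b\<bar>)" by (rule norm_le_l1)
    also have "\<dots> = (\<Sum>b\<in>Basis. \<sigma> b * (\<xi> t \<bullet> b) - \<sigma> b * (\<xi> s \<bullet> b))"
    proof (rule sum.cong[OF refl])
      fix b :: 'a assume "b \<in> Basis"
      then have "t < d b" using st \<delta>(3) by fastforce
      with mono[OF st(1,2)] show "\<bar>(\<xi> t - \<xi> s) \<bullet> b\<bar> = \<sigma> b * (\<xi> t \<bullet> b) - \<sigma> b * (\<xi> s \<bullet> b)"
        by (simp add: inner_diff_left)
    qed
    also have "\<dots> = V t - V s" by (simp add: V_def sum_subtractf)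
    finally show "norm (\<xi> t - \<xi> s) \<le> V t - V s" .
  qed (rule \<delta>)
qed

text \<open>If \<open>t - s\<close> is small compared with \<open>s\<^sup>2\<close>, the quadratic term can be absorbed, and the variation
  between \<open>s\<close> and \<open>t\<close> is at least \<open>(t - s) / (2 C s)\<close>, hence at least the increment of
  \<open>ln / (2 C)\<close>. So the increase of a bounded function from \<open>a\<close> to a fixed \<open>b\<close>
  would be at least \<open>(ln b - ln a) / (2 C)\<close>, which is unbounded as \<open>a\<close> tends to 0.\<close>

lemma no_slow_definable_curve:
  fixes \<xi> :: "real \<Rightarrow> 'a::euclidean_space"
  assumes def: "\<And>b. definable_fun (\<lambda>s. \<xi> s \<bullet> b)" and "0 < \<epsilon>" "0 < C" "0 < L"
    and bdd: "\<And>s. 0 < s \<Longrightarrow> s < \<epsilon> \<Longrightarrow> norm (\<xi> s) \<le> R"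
    and slow: "\<And>s t. 0 < s \<Longrightarrow> s < t \<Longrightarrow> t < \<epsilon> \<Longrightarrow>
      t - s \<le> C * s * norm (\<xi> t - \<xi> s) + L * (norm (\<xi> t - \<xi> s))\<^sup>2"
  shows False
proof -
  obtain \<delta> V K where V: "0 < \<delta>" "\<And>s. 0 < s \<Longrightarrow> s < \<delta> \<Longrightarrow> \<bar>V s\<bar> \<le> K"
    "\<And>s t. 0 < s \<Longrightarrow> s < t \<Longrightarrow> t < \<delta> \<Longrightarrow> norm (\<xi> t - \<xi> s) \<le> V t - V s"
    using definable_curve_variation[of \<xi> \<epsilon> R, OF def bdd \<open>0 < \<epsilon>\<close>] by blast
  define b where "b = min \<delta> \<epsilon> / 2"
  have b: "0 < b" "b < \<delta>" "b < \<epsilon>" using V(1) \<open>0 < \<epsilon>\<close> by (auto simp: b_def min_def)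
  have grow: "(ln b - ln a) / (2 * C) \<le> 2 * K" if a: "0 < a" "a \<le> b" for a
  proof -
    \<comment> \<open>For steps shorter than \<open>\<eta>\<close>, a variation \<open>W\<close> above the threshold \<open>C s / L\<close> is more than
      enough, and below the threshold the quadratic term is at most the linear one.\<close>
    define \<eta> where "\<eta> = 2 * C\<^sup>2 * a\<^sup>2 / L"
    have "\<eta> > 0" using a \<open>0 < C\<close> \<open>0 < L\<close> by (simp add: \<eta>_def)
    have "V a - ln a / (2 * C) \<le> V b - ln b / (2 * C)"
    proof (rule mono_from_short_steps[OF \<open>\<eta> > 0\<close> _ a(2)])
      fix s t assume st: "a \<le> s" "s < t" "t \<le> b" "t - s \<le> \<eta>"
      have s0: "0 < s" using a st by simp
      define W where "W = V t - V s"
      have nW: "norm (\<xi> t - \<xi> s) \<le> W" unfolding W_def using V(3) s0 st b by auto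
      then have W0: "0 \<le> W" using norm_ge_zero order_trans by blast
      have "t - s \<le> C * s * norm (\<xi> t - \<xi> s) + L * (norm (\<xi> t - \<xi> s))\<^sup>2"
        using slow s0 st b by auto
      also have "\<dots> \<le> C * s * W + L * W\<^sup>2"
        using nW s0 \<open>0 < C\<close> \<open>0 < L\<close> by (intro add_mono mult_left_mono power_mono) auto
      finally have le: "t - s \<le> C * s * W + L * W\<^sup>2" .
      have "(t - s) / (2 * C * s) \<le> W"
      proof (cases "L * W \<le> C * s")
        case True
        then have "L * W * W \<le> C * s * W" using W0 by (rule mult_right_mono)
        with le have "t - s \<le> 2 * C * s * W" by (simp add: power2_eq_square algebra_simps)
        then show ?thesis using s0 \<open>0 < C\<close> by (simp add: field_simps)
      next
        case False
        have "(t - s) / (2 * C * s) \<le> \<eta> / (2 * C * a)"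
          using st s0 a \<open>0 < C\<close> \<open>\<eta> > 0\<close> by (intro frac_le) auto
        also have "\<dots> = C * a / L" using a \<open>0 < C\<close> by (simp add: \<eta>_def power2_eq_square field_simps)
        also have "\<dots> \<le> C * s / L" using st \<open>0 < C\<close> \<open>0 < L\<close> by (simp add: divide_right_mono)
        also have "\<dots> \<le> W" using False \<open>0 < L\<close> by (simp add: field_simps)
        finally show ?thesis .
      qed
      moreover have "ln t - ln s \<le> (t - s) / s"
      proof -
        have "ln (t / s) \<le> t / s - 1" using s0 st by (intro ln_le_minus_one) auto
        then show ?thesis using s0 st by (simp add: ln_div diff_divide_distrib)
      qed
      then have "(ln t - ln s) / (2 * C) \<le> (t - s) / s / (2 * C)"
        using \<open>0 < C\<close> by (intro divide_right_mono) auto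
      ultimately have "(ln t - ln s) / (2 * C) \<le> W" by (simp add: mult.commute)
      then show "V s - ln s / (2 * C) \<le> V t - ln t / (2 * C)"
        by (simp add: W_def diff_divide_distrib)
    qed
    then have "(ln b - ln a) / (2 * C) \<le> V b - V a" by (simp add: diff_divide_distrib)
    also have "\<dots> \<le> 2 * K" using V(2)[of a] V(2)[of b] a b by auto
    finally show ?thesis .
  qed
  have K0: "0 \<le> K" using V(2)[of b] b by auto
  \<comment> \<open>So small that the logarithm grows by more than the total variation \<open>2 K\<close> allows.\<close>
  define a where "a = b * exp (- (2 * K + 1) * (2 * C))"
  have "0 < a" using b by (simp add: a_def)
  moreover have "a \<le> b"
  proof -
    have "- (2 * K + 1) * (2 * C) \<le> 0"
      by (rule mult_nonpos_nonneg) (use K0 \<open>0 < C\<close> in auto)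
    then have "exp (- (2 * K + 1) * (2 * C)) \<le> 1" by (subst exp_le_one_iff)
    then have "b * exp (- (2 * K + 1) * (2 * C)) \<le> b * 1"
      using b(1) by (intro mult_left_mono) auto
    then show ?thesis by (simp add: a_def)
  qed
  moreover have lna: "ln a = ln b - (2 * K + 1) * (2 * C)"
  proof -
    have "ln a = ln b + ln (exp (- (2 * K + 1) * (2 * C)))"
      unfolding a_def by (rule ln_mult_pos[OF b(1) exp_gt_zero])
    then show ?thesis by (simp only: ln_exp)
  qed
  ultimately have "(ln b - (ln b - (2 * K + 1) * (2 * C))) / (2 * C) \<le> 2 * K"
    using grow[of a] by (simp only: lna)
  then have "(2 * K + 1) * (2 * C) / (2 * C) \<le> 2 * K" by simp
  moreover have "(2 * K + 1) * (2 * C) / (2 * C) = 2 * K + 1"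
    by (rule nonzero_mult_div_cancel_right) (use \<open>0 < C\<close> in simp)
  ultimately show False by linarith
qed

section \<open>The Lojasiewicz gradient inequality\<close>

text \<open>Two expansions with quadratic error differ by a linear function of quadratic size. This is what
  allows a definition of the gradient by a formula without limits.\<close>

lemma quadratic_expansion_unique:
  fixes v w :: "'a::euclidean_space"
  assumes "0 < L" and v: "\<And>y. \<bar>f y - f x - v \<bullet> (y - x)\<bar> \<le> L * ((y - x) \<bullet> (y - x))"
    and w: "\<And>y. \<bar>f y - f x - w \<bullet> (y - x)\<bar> \<le> L * ((y - x) \<bullet> (y - x))"
  shows "v = w"
proof -
  define d where "d = v - w"
  \<comment> \<open>Any positive multiple of \<open>d\<close> with factor below \<open>1 / (2 L)\<close> makes the linear term dominate.\<close>
  define h where "h = (1 / (4 * L)) *\<^sub>R d"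
  have "\<bar>f (x + h) - f x - v \<bullet> h\<bar> \<le> L * (h \<bullet> h)" "\<bar>f (x + h) - f x - w \<bullet> h\<bar> \<le> L * (h \<bullet> h)"
    using v[of "x + h"] w[of "x + h"] by auto
  then have "d \<bullet> h \<le> 2 * (L * (h \<bullet> h))" by (simp add: d_def inner_diff_left)
  then have "(d \<bullet> d) / (4 * L) \<le> (d \<bullet> d) / (8 * L)"
    using \<open>0 < L\<close> by (simp add: h_def field_simps)
  then have "d \<bullet> d \<le> 0" using \<open>0 < L\<close> by (simp add: field_simps)
  then have "d = 0" by (metis inner_ge_zero inner_eq_zero_iff order_antisym)
  then show ?thesis by (simp add: d_def)
qed

text \<open>The two-sided quadratic bound stands in for the second derivative: it makes the gradient definable
  and controls \<open>f\<close> along a curve.\<close>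

locale smooth_definable =
  fixes f :: "'a::euclidean_space \<Rightarrow> real" and G :: "'a \<Rightarrow> 'a" and L :: real
  assumes L: "0 < L" and f_def: "definable_fun f"
    and f_cont: "continuous_on UNIV f" and G_cont: "continuous_on UNIV G"
    and quad: "\<And>x y. \<bar>f y - f x - G x \<bullet> (y - x)\<bar> \<le> L * ((y - x) \<bullet> (y - x))"
begin

text \<open>The gradient is the only vector for which the quadratic expansion holds at all points \<open>y\<close>.\<close>

lemma definable_gradient: "definable (\<lambda>z. G (fst z) = snd z)"
proof -
  have eq: "G x = v \<longleftrightarrow> (\<forall>y. f y \<le> f x + (v \<bullet> (y - x) + L * ((y - x) \<bullet> (y - x))) \<and>
      f x + (v \<bullet> (y - x) - L * ((y - x) \<bullet> (y - x))) \<le> f y)" for x v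
  proof -
    have "G x = v \<longleftrightarrow> (\<forall>y. \<bar>f y - f x - v \<bullet> (y - x)\<bar> \<le> L * ((y - x) \<bullet> (y - x)))"
      using quad[of _ x] quadratic_expansion_unique[OF L, of f x "G x" v] by blast
    also have "\<dots> \<longleftrightarrow> (\<forall>y. f y \<le> f x + (v \<bullet> (y - x) + L * ((y - x) \<bullet> (y - x))) \<and>
      f x + (v \<bullet> (y - x) - L * ((y - x) \<bullet> (y - x))) \<le> f y)"
      by (intro all_cong1) (simp only: abs_le_iff, argo)
    finally show ?thesis .
  qed
  show ?thesis
    unfolding eq
    by (rule definable_all definable_conj definable_fun_le definable_fun_add definable_fun_compose[OF f_def]
        definable_fun_poly real_polynomial_function.intros(3) real_polynomial_function_diff
        real_polynomial_function.intros(4) real_polynomial_function.intros(2)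
        real_polynomial_function_inner polynomial_projections)+
qed

text \<open>The number \<open>R\<close> bounds the square of the norm, because the square is a polynomial.\<close>

definition level :: "real \<Rightarrow> real \<Rightarrow> real \<Rightarrow> 'a \<Rightarrow> bool" where
  "level R c s x \<longleftrightarrow> x \<bullet> x \<le> R \<and> f x = c + s"

lemma definable_level: "definable (\<lambda>z. level R c (fst z) (snd z))"
  unfolding level_def
  by (rule definable_conj definable_poly_le definable_fun_eq definable_fun_compose[OF f_def] definable_fun_poly
      real_polynomial_function.intros(2) real_polynomial_function.intros(3) real_polynomial_function_inner
      real_polynomial_functionI polynomial_projections)+

lemma definable_gradient_pred:
  assumes "definable (\<lambda>z. P (fst z) (snd z))"
  shows "definable (\<lambda>z::'z::euclidean_space \<times> 'a. P (fst z) (G (snd z)))"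
proof -
  have "definable (\<lambda>z::'z \<times> 'a. \<exists>v. G (snd z) = v \<and> P (fst z) v)"
    by (rule definable_ex definable_conj definable_compose2[OF definable_gradient] definable_compose2[OF assms]
        polynomial_projections)+
  then show ?thesis by simp
qed

lemma compact_level: "compact {x. level R c s x}"
proof -
  have "closed {x. x \<bullet> x \<le> R}" by (intro closed_Collect_le continuous_intros)
  moreover have "closed {x. f x = c + s}"
    by (intro closed_Collect_eq continuous_intros f_cont)
  moreover have "{x. level R c s x} = {x. x \<bullet> x \<le> R} \<inter> {x. f x = c + s}" by (auto simp: level_def)
  ultimately have "closed {x. level R c s x}" by (metis closed_Int)
  moreover have "bounded {x. level R c s x}"
    by (rule boundedI[of _ "sqrt R"]) (auto simp: level_def norm_eq_sqrt_inner)
  ultimately show ?thesis by (simp add: compact_eq_bounded_closed)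
qed

text \<open>Curve selection: the points with \<open>|G x| \<le> C s\<close> on the levels \<open>c + s\<close> form compact definable
  fibres. Either they are empty for all small \<open>s\<close>, as claimed, or a definable curve runs through all
  of them; the expansion of \<open>f\<close> along this curve contradicts \<open>no_slow_definable_curve\<close>.\<close>

lemma gradient_superlinear:
  assumes "0 < C"
  shows "\<exists>\<epsilon>>0. \<forall>s x. 0 < s \<and> s < \<epsilon> \<and> level R c s x \<longrightarrow> C * s < norm (G x)"
proof -
  define \<Phi> where "\<Phi> = (\<lambda>s x. level R c s x \<and> G x \<bullet> G x \<le> (C * s) * (C * s))"
  have "definable (\<lambda>z::real \<times> 'a. snd z \<bullet> snd z \<le> (C * fst z) * (C * fst z))"
    by (rule definable_poly_le real_polynomial_function.intros(4) real_polynomial_function.intros(2)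
        real_polynomial_function_inner real_polynomial_functionI polynomial_projections)+
  then have "definable (\<lambda>z::real \<times> 'a. G (snd z) \<bullet> G (snd z) \<le> (C * fst z) * (C * fst z))"
    by (rule definable_gradient_pred[where P = "\<lambda>s v. v \<bullet> v \<le> (C * s) * (C * s)"])
  then have def: "definable (\<lambda>z. \<Phi> (fst z) (snd z))"
    unfolding \<Phi>_def by (rule definable_conj[OF definable_level])
  have comp: "compact {x. \<Phi> s x}" for s
  proof -
    have "closed {x. G x \<bullet> G x \<le> (C * s) * (C * s)}"
      by (intro closed_Collect_le continuous_intros G_cont)
    from compact_Int_closed[OF compact_level this, of R c s] show ?thesis
      by (simp add: \<Phi>_def Collect_conj_eq)
  qed
  obtain \<epsilon> where \<epsilon>: "0 < \<epsilon>"
    "(\<forall>s. 0 < s \<and> s < 0 + \<epsilon> \<longrightarrow> (\<exists>x. \<Phi> s x)) \<or> (\<forall>s. 0 < s \<and> s < 0 + \<epsilon> \<longrightarrow> \<not> (\<exists>x. \<Phi> s x))"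
    by (rule definable_right_germ[OF definable_ex[OF def], of 0])
  have "\<not> (\<forall>s. 0 < s \<and> s < 0 + \<epsilon> \<longrightarrow> (\<exists>x. \<Phi> s x))"
  proof
    assume "\<forall>s. 0 < s \<and> s < 0 + \<epsilon> \<longrightarrow> (\<exists>x. \<Phi> s x)"
    then have "compact {x. \<Phi> s x} \<and> {x. \<Phi> s x} \<noteq> {}" if "0 < s" "s < \<epsilon>" for s
      using comp that by auto
    then obtain \<xi> where \<xi>: "\<And>s. 0 < s \<Longrightarrow> s < \<epsilon> \<Longrightarrow> \<Phi> s (\<xi> s)" "\<And>b. definable_fun (\<lambda>s. \<xi> s \<bullet> b)"
      using definable_selection[OF def, of \<epsilon>] by blast
    show False
    proof (rule no_slow_definable_curve[OF \<xi>(2) \<epsilon>(1) \<open>0 < C\<close> L])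
      fix s :: real assume "0 < s" "s < \<epsilon>"
      then show "norm (\<xi> s) \<le> sqrt R"
        using \<xi>(1) by (simp add: \<Phi>_def level_def norm_eq_sqrt_inner)
    next
      fix s t assume st: "0 < s" "s < t" "t < \<epsilon>"
      have s: "\<Phi> s (\<xi> s)" and t: "\<Phi> t (\<xi> t)" using \<xi>(1) st by auto
      have "(norm (G (\<xi> s)))\<^sup>2 \<le> (C * s)\<^sup>2"
        using s unfolding \<Phi>_def by (simp only: power2_norm_eq_inner power2_eq_square[of "C * s"])
      then have nG: "norm (G (\<xi> s)) \<le> C * s"
        by (rule power2_le_imp_le) (use st \<open>0 < C\<close> in auto)
      have "t - s = f (\<xi> t) - f (\<xi> s)" using s t by (simp add: \<Phi>_def level_def)
      also have "\<dots> \<le> G (\<xi> s) \<bullet> (\<xi> t - \<xi> s) + L * ((\<xi> t - \<xi> s) \<bullet> (\<xi> t - \<xi> s))"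
        using quad[of "\<xi> t" "\<xi> s"] by (simp add: abs_le_iff)
      also have "G (\<xi> s) \<bullet> (\<xi> t - \<xi> s) \<le> norm (G (\<xi> s)) * norm (\<xi> t - \<xi> s)" by (rule norm_cauchy_schwarz)
      also have "\<dots> \<le> C * s * norm (\<xi> t - \<xi> s)" using nG by (rule mult_right_mono) simp
      finally show "t - s \<le> C * s * norm (\<xi> t - \<xi> s) + L * (norm (\<xi> t - \<xi> s))\<^sup>2"
        by (simp add: power2_norm_eq_inner)
    qed
  qed
  with \<epsilon>(2) have no: "\<not> \<Phi> s x" if "0 < s" "s < \<epsilon>" for s x using that by auto
  have "C * s < norm (G x)" if s: "0 < s" "s < \<epsilon>" and x: "level R c s x" for s x
  proof (rule ccontr)
    assume "\<not> ?thesis"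
    then have "(norm (G x))\<^sup>2 \<le> (C * s)\<^sup>2" by (intro power_mono) auto
    then have "\<Phi> s x"
      using x unfolding \<Phi>_def by (simp only: power2_norm_eq_inner power2_eq_square[of "C * s"])
    with no[OF s] show False by blast
  qed
  with \<epsilon>(1) show ?thesis by blast
qed

text \<open>On the graph \<open>H\<close>, \<open>u\<close> is the quotient of \<open>s\<close> and the minimum of \<open>|G|\<close> on the level. It tends to
  0 by \<open>gradient_superlinear\<close> and is definable, so that \<open>u\<^sup>k \<le> M s\<close>. Solving for the gradient gives
  the claim; \<open>k\<close> is increased by 2 so that the exponent \<open>1 - 1/k\<close> is at least \<open>1/2\<close>.\<close>

lemma gradient_power_bound:
  "\<exists>k M \<epsilon>. 2 \<le> k \<and> 0 < M \<and> 0 < \<epsilon> \<and>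
     (\<forall>s x. 0 < s \<and> s < \<epsilon> \<and> level R c s x \<longrightarrow> s ^ (k - 1) \<le> M * norm (G x) ^ k)"
proof -
  define H where "H = (\<lambda>s u. 0 \<le> u \<and> (\<exists>x. level R c s x \<and> (u * u) * (G x \<bullet> G x) = s * s) \<and>
     (\<forall>x. level R c s x \<longrightarrow> s * s \<le> (u * u) * (G x \<bullet> G x)))"
  have pos: "definable (\<lambda>z::real \<times> real. 0 \<le> snd z)"
    by (rule definable_poly_le real_polynomial_function.intros(2) real_polynomial_functionI polynomial_projections)+
  have "definable (\<lambda>w::(real \<times> real) \<times> 'a. (snd (fst w) * snd (fst w)) * (snd w \<bullet> snd w) = fst (fst w) * fst (fst w))"
    by (rule definable_poly_eq real_polynomial_function.intros(4) real_polynomial_function_inner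
        real_polynomial_functionI polynomial_projections)+
  then have att: "definable (\<lambda>w::(real \<times> real) \<times> 'a.
      (snd (fst w) * snd (fst w)) * (G (snd w) \<bullet> G (snd w)) = fst (fst w) * fst (fst w))"
    by (rule definable_gradient_pred[where P = "\<lambda>z v. (snd z * snd z) * (v \<bullet> v) = fst z * fst z"])
  have "definable (\<lambda>w::(real \<times> real) \<times> 'a. fst (fst w) * fst (fst w) \<le> (snd (fst w) * snd (fst w)) * (snd w \<bullet> snd w))"
    by (rule definable_poly_le real_polynomial_function.intros(4) real_polynomial_function_inner
        real_polynomial_functionI polynomial_projections)+
  then have min: "definable (\<lambda>w::(real \<times> real) \<times> 'a.
      fst (fst w) * fst (fst w) \<le> (snd (fst w) * snd (fst w)) * (G (snd w) \<bullet> G (snd w)))"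
    by (rule definable_gradient_pred[where P = "\<lambda>z v. fst z * fst z \<le> (snd z * snd z) * (v \<bullet> v)"])
  have lev: "definable (\<lambda>w::(real \<times> real) \<times> 'a. level R c (fst (fst w)) (snd w))"
    by (rule definable_compose2[OF definable_level] polynomial_projections)+
  have def: "definable (\<lambda>z. H (fst z) (snd z))"
    unfolding H_def
    by (rule definable_conj[OF pos definable_conj[OF definable_ex[OF definable_conj[OF lev att]]
        definable_all[OF definable_imp[OF lev min]]]])
  obtain \<epsilon>1 where \<epsilon>1: "0 < \<epsilon>1" "\<And>s x. 0 < s \<Longrightarrow> s < \<epsilon>1 \<Longrightarrow> level R c s x \<Longrightarrow> 1 * s < norm (G x)"
    using gradient_superlinear[of 1 R c] by auto
  have uniq: "u = v" if s: "0 < s" "s < \<epsilon>1" and H: "H s u" "H s v" for s u v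
  proof -
    have le: "u \<le> v" if Hu: "H s u" and Hv: "H s v" for u v
    proof -
      obtain x where x: "level R c s x" "(u * u) * (G x \<bullet> G x) = s * s" using Hu by (auto simp: H_def)
      have "0 < norm (G x)" using \<epsilon>1(2)[OF s x(1)] s by linarith
      then have G0: "0 < G x \<bullet> G x" by simp
      have "(u * u) * (G x \<bullet> G x) \<le> (v * v) * (G x \<bullet> G x)" using Hv x by (simp add: H_def)
      then have "u\<^sup>2 \<le> v\<^sup>2" using G0 by (simp add: power2_eq_square)
      then show ?thesis by (rule power2_le_imp_le) (use Hv in \<open>auto simp: H_def\<close>)
    qed
    show ?thesis using le H by (intro antisym) auto
  qed
  have "\<exists>k M \<delta>. 0 < \<delta> \<and> \<delta> \<le> 1 \<and>
      (\<forall>s u. 0 < s \<and> s < \<delta> \<and> \<bar>u\<bar> < \<delta> \<and> H s u \<longrightarrow> \<bar>u\<bar> ^ k \<le> M * s)"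
    by (rule definable_graph_power_bound[OF def \<epsilon>1(1)]) (rule uniq)
  then obtain k M \<delta> where \<delta>: "0 < \<delta>" "\<delta> \<le> 1"
    "\<And>s u. 0 < s \<Longrightarrow> s < \<delta> \<Longrightarrow> \<bar>u\<bar> < \<delta> \<Longrightarrow> H s u \<Longrightarrow> \<bar>u\<bar> ^ k \<le> M * s"
    by blast
  obtain \<epsilon>2 where \<epsilon>2: "0 < \<epsilon>2"
    "\<And>s x. 0 < s \<Longrightarrow> s < \<epsilon>2 \<Longrightarrow> level R c s x \<Longrightarrow> 1 / \<delta> * s < norm (G x)"
    using gradient_superlinear[of "1 / \<delta>" R c] \<delta>(1) by auto
  have "s ^ (k + 2 - 1) \<le> max M 1 * norm (G x) ^ (k + 2)"
    if s: "0 < s" "s < min \<delta> \<epsilon>2" and x: "level R c s x" for s x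
  proof -
    have "continuous_on {x. level R c s x} (\<lambda>x. norm (G x))"
      by (intro continuous_intros continuous_on_subset[OF G_cont]) auto
    then obtain m where m: "level R c s m" "\<And>y. level R c s y \<Longrightarrow> norm (G m) \<le> norm (G y)"
      using continuous_attains_inf[OF compact_level, of R c s "\<lambda>x. norm (G x)"] x by auto
    have big: "1 / \<delta> * s < norm (G m)" using \<epsilon>2(2) m(1) s by simp
    moreover have "0 < 1 / \<delta> * s" using s \<delta>(1) by simp
    ultimately have Gm: "0 < norm (G m)" by linarith
    define u where "u = s / norm (G m)"
    have u: "0 < u" "u < \<delta>" using s Gm big \<delta>(1) by (auto simp: u_def field_simps)
    have un: "u * norm (G m) = s" using Gm by (simp add: u_def)
    have sq: "(u * u) * (G y \<bullet> G y) = (u * norm (G y)) * (u * norm (G y))" for y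
      by (simp only: dot_square_norm power2_eq_square ac_simps)
    have "H s u"
      unfolding H_def sq
    proof (intro conjI exI allI impI)
      show "0 \<le> u" using u by simp
      show "level R c s m" by (rule m)
      show "u * norm (G m) * (u * norm (G m)) = s * s" by (simp add: un)
      fix y assume "level R c s y"
      then have "s \<le> u * norm (G y)" using m(2) u(1) un by (metis mult_left_mono less_imp_le)
      then show "s * s \<le> u * norm (G y) * (u * norm (G y))" using s by (intro mult_mono) auto
    qed
    with \<delta>(3)[of s u] s u have "u ^ k \<le> M * s" by simp
    also have "\<dots> \<le> max M 1 * s" using s by (simp add: mult_right_mono)
    finally have uk: "u ^ k \<le> max M 1 * s" .
    have "u ^ (k + 2) \<le> u ^ k" using u \<delta>(2) by (intro power_decreasing) auto
    with uk have uk2: "u ^ (k + 2) \<le> max M 1 * s" by simp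
    have "s * s ^ (k + 2 - 1) = s ^ (k + 2)" by simp
    also have "\<dots> = u ^ (k + 2) * norm (G m) ^ (k + 2)" by (simp only: un[symmetric] power_mult_distrib)
    also have "\<dots> \<le> (max M 1 * s) * norm (G m) ^ (k + 2)" using uk2 by (intro mult_right_mono) auto
    also have "\<dots> \<le> (max M 1 * s) * norm (G x) ^ (k + 2)"
      using m(2)[OF x] s by (intro mult_left_mono power_mono) auto
    finally have "s * s ^ (k + 2 - 1) \<le> s * (max M 1 * norm (G x) ^ (k + 2))" by (simp add: ac_simps)
    then show ?thesis using s by simp
  qed
  then show ?thesis
    by - (rule exI[of _ "k + 2"], rule exI[of _ "max M 1"], rule exI[of _ "min \<delta> \<epsilon>2"], use \<delta>(1) \<epsilon>2(1) in auto)
qed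

text \<open>The exponent is \<open>1 - 1/k\<close>, by taking \<open>k\<close>-th roots in \<open>gradient_power_bound\<close>.\<close>

theorem lojasiewicz_inequality:
  "\<exists>\<theta> C \<epsilon>. 1 / 2 \<le> \<theta> \<and> \<theta> < 1 \<and> 0 < C \<and> 0 < \<epsilon> \<and>
     (\<forall>x. norm x \<le> R \<and> c < f x \<and> f x < c + \<epsilon> \<longrightarrow> (f x - c) powr \<theta> \<le> C * norm (G x))"
proof -
  obtain k M \<epsilon> where k: "2 \<le> k" and M: "0 < M" and \<epsilon>: "0 < \<epsilon>"
    and bound: "\<And>s x. 0 < s \<Longrightarrow> s < \<epsilon> \<Longrightarrow> level (R\<^sup>2) c s x \<Longrightarrow> s ^ (k - 1) \<le> M * norm (G x) ^ k"
    using gradient_power_bound[of "R\<^sup>2" c] by blast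
  define \<theta> where "\<theta> = real (k - 1) / real k"
  have \<theta>: "1 / 2 \<le> \<theta>" "\<theta> < 1" using k by (auto simp: \<theta>_def field_simps of_nat_diff)
  have "(f x - c) powr \<theta> \<le> max M 1 * norm (G x)" if x: "norm x \<le> R" "c < f x" "f x < c + \<epsilon>" for x
  proof -
    define s where "s = f x - c"
    have s: "0 < s" "s < \<epsilon>" using x by (auto simp: s_def)
    have "x \<bullet> x \<le> R\<^sup>2" using x(1) by (metis norm_ge_zero power2_norm_eq_inner power_mono)
    then have lev: "level (R\<^sup>2) c s x" by (simp add: level_def s_def)
    have "(s powr \<theta>) ^ k = s powr (\<theta> * real k)" using s by (simp add: powr_power mult.commute)
    also have "\<theta> * real k = real (k - 1)" using k by (simp add: \<theta>_def)
    also have "s powr real (k - 1) = s ^ (k - 1)" using s by (simp add: powr_realpow)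
    also have "\<dots> \<le> M * norm (G x) ^ k" by (rule bound[OF s lev])
    also have "\<dots> \<le> max M 1 ^ k * norm (G x) ^ k"
    proof (rule mult_right_mono)
      have "max M 1 ^ 1 \<le> max M 1 ^ k" using k by (intro power_increasing) auto
      then show "M \<le> max M 1 ^ k" by simp
    qed simp
    also have "\<dots> = (max M 1 * norm (G x)) ^ k" by (simp add: power_mult_distrib)
    finally have "(s powr \<theta>) ^ k \<le> (max M 1 * norm (G x)) ^ k" .
    then have "s powr \<theta> \<le> max M 1 * norm (G x)"
      using k by (subst (asm) power_mono_iff) auto
    then show ?thesis by (simp add: s_def)
  qed
  then show ?thesis
    by - (rule exI[of _ \<theta>], rule exI[of _ "max M 1"], rule exI[of _ \<epsilon>], use \<theta> \<epsilon> in auto)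
qed

end

section \<open>The heavy-ball proximal iteration\<close>

lemma powr_concave_bound:
  fixes r s p :: real
  assumes "0 < s" "s \<le> r" "0 < p" "p \<le> 1"
  shows "p * r powr (p - 1) * (r - s) \<le> r powr p - s powr p"
proof (cases "s = r")
  case False
  with assms have "s < r" by simp
  have "\<exists>z. s < z \<and> z < r \<and> r powr p - s powr p = (r - s) * (p * z powr (p - 1))"
    by (rule MVT2[OF \<open>s < r\<close>]) (use assms in \<open>auto intro!: derivative_eq_intros\<close>)
  then obtain z where z: "s < z" "z < r" "r powr p - s powr p = (r - s) * (p * z powr (p - 1))" by blast
  have "r powr (p - 1) \<le> z powr (p - 1)"
    by (rule powr_mono2') (use assms z in auto)
  then have "(r - s) * (p * r powr (p - 1)) \<le> (r - s) * (p * z powr (p - 1))"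
    using assms z by (intro mult_left_mono) auto
  with z(3) show ?thesis by (simp add: ac_simps)
qed simp

text \<open>With \<open>p = 1 - \<theta>\<close>, concavity of \<open>r \<mapsto> r\<^sup>p\<close> gives
  \<open>D\<^sub>n\<^sub>+\<^sub>2\<^sup>2 \<le> K (\<phi> n - \<phi> (n + 1)) (D\<^sub>n + D\<^sub>n\<^sub>+\<^sub>1)\<close> for \<open>\<phi> n = r\<^sub>n\<^sub>+\<^sub>1\<^sup>p\<close>. By the inequality of the
  arithmetic and geometric mean, each step is at most a quarter of the sum of the two steps before it
  plus a term that telescopes.\<close>

lemma finite_length_if_lojasiewicz_step:
  fixes r D :: "nat \<Rightarrow> real"
  assumes D0: "\<And>n. 0 \<le> D n" and r0: "\<And>n. 0 \<le> r n" and a: "0 < a" and C: "0 < C"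
    and \<theta>: "0 \<le> \<theta>" "\<theta> < 1"
    and descent: "\<And>n. r (Suc n) + a * (D (Suc n))\<^sup>2 \<le> r n"
    and step: "\<And>n. N \<le> n \<Longrightarrow> 0 < r (Suc n) \<Longrightarrow> r (Suc n) powr \<theta> \<le> C * (D n + D (Suc n))"
  shows "summable D"
proof (cases "\<exists>m. r m = 0")
  case True
  then obtain m where m: "r m = 0" by blast
  have dec: "r (Suc n) \<le> r n" for n
  proof -
    have "0 \<le> a * (D (Suc n))\<^sup>2" using a by simp
    with descent[of n] show ?thesis by linarith
  qed
  have z: "r n = 0" if "m \<le> n" for n
    using lift_Suc_antimono_le[of r m n] dec that m r0[of n] by fastforce
  have "D (Suc n) = 0" if "m \<le> n" for n
  proof -
    have "a * (D (Suc n))\<^sup>2 \<le> 0" using descent[of n] z[of n] z[of "Suc n"] that by simp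
    then show ?thesis using a by (simp add: mult_le_0_iff)
  qed
  then have "D n = 0" if "n \<notin> {..m}" for n using that by (cases n) auto
  then show ?thesis by (intro summable_finite[of "{..m}"]) auto
next
  case False
  then have rpos: "0 < r n" for n using r0 by (metis less_eq_real_def)
  define K where "K = C / ((1 - \<theta>) * a)"
  define \<phi> where "\<phi> = (\<lambda>n. r (Suc n) powr (1 - \<theta>))"
  have K: "0 < K" using C \<theta> a by (simp add: K_def)
  have key: "D (n + 2) \<le> (D n + D (Suc n)) / 4 + K * (\<phi> n - \<phi> (Suc n))" if n: "N \<le> n" for n
  proof -
    define q where "q = D n + D (Suc n)"
    define p where "p = \<phi> n - \<phi> (Suc n)"
    have q: "0 < q"
    proof -
      have "0 < r (Suc n) powr \<theta>" using rpos[of "Suc n"] by simp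
      also have "\<dots> \<le> C * q" unfolding q_def by (rule step[OF n rpos])
      finally show ?thesis using C by (simp add: zero_less_mult_iff)
    qed
    have dr: "a * (D (n + 2))\<^sup>2 \<le> r (Suc n) - r (Suc (Suc n))" using descent[of "Suc n"] by simp
    moreover have "0 \<le> a * (D (n + 2))\<^sup>2" using a by simp
    ultimately have le: "r (Suc (Suc n)) \<le> r (Suc n)" by linarith
    have "1 / (C * q) \<le> 1 / r (Suc n) powr \<theta>"
      using step[OF n rpos] rpos[of "Suc n"] C q by (intro divide_left_mono) (auto simp: q_def)
    also have "\<dots> = r (Suc n) powr ((1 - \<theta>) - 1)" by (simp add: powr_minus_divide)
    finally have "(1 - \<theta>) * (1 / (C * q)) * (a * (D (n + 2))\<^sup>2)
        \<le> (1 - \<theta>) * r (Suc n) powr ((1 - \<theta>) - 1) * (r (Suc n) - r (Suc (Suc n)))"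
      using \<theta> a dr C q by (intro mult_mono mult_left_mono) auto
    also have "\<dots> \<le> p"
      unfolding p_def \<phi>_def using \<theta> le rpos by (intro powr_concave_bound) auto
    finally have "(D (n + 2))\<^sup>2 \<le> K * p * q"
      using \<theta> a C q by (simp add: K_def field_simps)
    also have "K * p * q \<le> (K * p + q / 4)\<^sup>2"
    proof -
      have "0 \<le> (K * p - q / 4)\<^sup>2" by simp
      then show ?thesis by (simp add: power2_eq_square algebra_simps)
    qed
    finally have sq: "(D (n + 2))\<^sup>2 \<le> (K * p + q / 4)\<^sup>2" .
    have "0 \<le> p"
      unfolding p_def \<phi>_def using le rpos[of "Suc (Suc n)"] \<theta> by (simp add: powr_mono2)
    then have "D (n + 2) \<le> K * p + q / 4"
      by (intro power2_le_imp_le[OF sq]) (use K q in auto)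
    then show ?thesis by (simp add: p_def q_def)
  qed
  \<comment> \<open>A potential that drops by half a step: the weights \<open>1/4\<close> and \<open>1/2\<close> absorb the two earlier
    steps on the right-hand side of \<open>key\<close>.\<close>
  define P where "P = (\<lambda>n. K * \<phi> n + D n / 4 + D (Suc n) / 2)"
  have P: "D (n + 2) / 2 \<le> P n - P (Suc n)" if "N \<le> n" for n
    using key[OF that] by (simp add: P_def algebra_simps add_divide_distrib)
  have P0: "0 \<le> P n" for n using K D0 by (simp add: P_def \<phi>_def)
  have tele: "(\<Sum>i<m. D (i + (N + 2))) \<le> 2 * (P N - P (N + m))" for m
  proof (induction m)
    case (Suc m)
    then show ?case using P[of "N + m"] by (simp add: add.commute add.left_commute)
  qed simp
  have "summable (\<lambda>i. D (i + (N + 2)))"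
  proof (rule summableI_nonneg_bounded)
    have "2 * (P N - P (N + m)) \<le> 2 * P N" for m using P0[of "N + m"] by simp
    then show "(\<Sum>i<m. D (i + (N + 2))) \<le> 2 * P N" for m using tele order_trans by blast
  qed (rule D0)
  then show ?thesis by (subst (asm) summable_iff_shift)
qed

lemma convergent_if_finite_length:
  fixes x :: "nat \<Rightarrow> 'a::banach"
  assumes "summable (\<lambda>n. norm (x (Suc n) - x n))"
  shows "convergent x"
proof -
  have "summable (\<lambda>n. x (Suc n) - x n)" using assms by (rule summable_norm_cancel)
  then have "(\<lambda>n. \<Sum>i<n. x (Suc i) - x i) \<longlonglongrightarrow> (\<Sum>i. x (Suc i) - x i)" by (rule summable_LIMSEQ)
  then have "(\<lambda>n. x n - x 0) \<longlonglongrightarrow> (\<Sum>i. x (Suc i) - x i)" by (simp add: sum_lessThan_telescope)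
  from tendsto_add[OF this tendsto_const[of "x 0"]] show ?thesis by (auto simp: convergent_def)
qed

text \<open>The indices are shifted by one, so that step \<open>n\<close> leads from \<open>x n\<close> to \<open>x (n + 1)\<close>.\<close>

locale heavy_ball =
  fixes f :: "'a::euclidean_space \<Rightarrow> real" and G :: "'a \<Rightarrow> 'a" and L \<beta> \<gamma> :: real and x :: "nat \<Rightarrow> 'a"
  assumes L: "0 < L" and \<gamma>: "0 < \<gamma>" and \<beta>: "0 < \<beta>" "\<beta> < 1 / 2"
    and quad: "\<And>x y. \<bar>f y - f x - G x \<bullet> (y - x)\<bar> \<le> L * ((y - x) \<bullet> (y - x))"
    and bdd: "bdd_below (range f)"
    and prox: "\<And>n. x (Suc (Suc n)) \<in> Prox (\<lambda>u. \<gamma> * f u) (x (Suc n) + \<beta> *\<^sub>R (x (Suc n) - x n))"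
begin

definition d :: "nat \<Rightarrow> 'a" where "d n = x (Suc n) - x n"

definition energy :: "nat \<Rightarrow> real" where
  "energy n = \<gamma> * f (x (Suc n)) + \<beta> / 2 * (norm (d n))\<^sup>2"

lemma prox_le:
  "\<gamma> * f (x (Suc (Suc n))) + (norm (d (Suc n) - \<beta> *\<^sub>R d n))\<^sup>2 / 2 \<le>
   \<gamma> * f u + (norm (u - (x (Suc n) + \<beta> *\<^sub>R d n)))\<^sup>2 / 2"
  using prox[of n] by (simp add: Prox_def is_arg_min_linorder d_def algebra_simps)

text \<open>The optimality condition of the proximal problem. It comes from comparing the minimizer with a
  small step in the direction of steepest descent.\<close>

lemma gradient_step: "\<gamma> *\<^sub>R G (x (Suc (Suc n))) = \<beta> *\<^sub>R d n - d (Suc n)"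
proof -
  define z where "z = x (Suc (Suc n))"
  define v where "v = d (Suc n) - \<beta> *\<^sub>R d n"
  define w where "w = \<gamma> *\<^sub>R G z + v"
  define K where "K = \<gamma> * L + 1 / 2"
  have K: "0 < K" using \<gamma> L by (simp add: K_def add_pos_pos)
  have var: "0 \<le> w \<bullet> h + K * (h \<bullet> h)" for h
  proof -
    have e: "z + h - (x (Suc n) + \<beta> *\<^sub>R d n) = v + h" by (simp add: z_def v_def d_def algebra_simps)
    have "\<gamma> * f z + (norm v)\<^sup>2 / 2 \<le> \<gamma> * f (z + h) + (norm (v + h))\<^sup>2 / 2"
      using prox_le[of n "z + h"] unfolding e by (simp add: z_def v_def)
    then have "\<gamma> * f z + (v \<bullet> v) / 2 \<le> \<gamma> * f (z + h) + ((v + h) \<bullet> (v + h)) / 2"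
      by (simp add: power2_norm_eq_inner)
    moreover have "\<gamma> * f (z + h) \<le> \<gamma> * (f z + G z \<bullet> h + L * (h \<bullet> h))"
      using quad[of "z + h" z] \<gamma> by (intro mult_left_mono) (auto simp: abs_le_iff)
    ultimately have "0 \<le> \<gamma> * (G z \<bullet> h + L * (h \<bullet> h)) + v \<bullet> h + (h \<bullet> h) / 2"
      by (simp add: algebra_simps inner_commute add_divide_distrib)
    then show ?thesis by (simp add: w_def K_def algebra_simps inner_add_left)
  qed
  \<comment> \<open>This choice of \<open>h\<close> minimizes the right-hand side of \<open>var\<close>.\<close>
  have "0 \<le> w \<bullet> (- (1 / (2 * K)) *\<^sub>R w) + K * ((- (1 / (2 * K)) *\<^sub>R w) \<bullet> (- (1 / (2 * K)) *\<^sub>R w))"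
    by (rule var)
  then have "0 \<le> - (w \<bullet> w) / (4 * K)" using K by (simp add: field_simps)
  then have "w \<bullet> w \<le> 0" using K by (simp add: field_simps)
  then have "w = 0" by (metis inner_ge_zero inner_eq_zero_iff order_antisym)
  then show ?thesis by (simp add: w_def v_def z_def algebra_simps eq_neg_iff_add_eq_0)
qed

text \<open>The proximal point is compared with the candidate \<open>x (n + 1)\<close>; the mixed term is split evenly
  between the two steps, which leaves the factor \<open>(1 - 2 * \<beta>) / 2\<close>, positive for \<open>\<beta> < 1 / 2\<close>.\<close>

lemma energy_descent: "energy (Suc n) + (1 - 2 * \<beta>) / 2 * (norm (d (Suc n)))\<^sup>2 \<le> energy n"
proof -
  have e: "x (Suc n) - (x (Suc n) + \<beta> *\<^sub>R d n) = - (\<beta> *\<^sub>R d n)" by simp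
  have "\<gamma> * f (x (Suc (Suc n))) + (norm (d (Suc n) - \<beta> *\<^sub>R d n))\<^sup>2 / 2 \<le> \<gamma> * f (x (Suc n)) + (norm (\<beta> *\<^sub>R d n))\<^sup>2 / 2"
    using prox_le[of n "x (Suc n)"] unfolding e norm_minus_cancel .
  then have "\<gamma> * f (x (Suc (Suc n))) + (d (Suc n) \<bullet> d (Suc n)) / 2 - \<beta> * (d (Suc n) \<bullet> d n) \<le> \<gamma> * f (x (Suc n))"
    unfolding power2_norm_eq_inner
    by (simp add: algebra_simps inner_commute add_divide_distrib diff_divide_distrib)
  moreover have "2 * (d (Suc n) \<bullet> d n) \<le> d (Suc n) \<bullet> d (Suc n) + d n \<bullet> d n"
    using inner_ge_zero[of "d (Suc n) - d n"] by (simp add: algebra_simps inner_commute)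
  then have "\<beta> * (2 * (d (Suc n) \<bullet> d n)) \<le> \<beta> * (d (Suc n) \<bullet> d (Suc n) + d n \<bullet> d n)"
    using \<beta> by (intro mult_left_mono) auto
  ultimately show ?thesis by (simp add: energy_def power2_norm_eq_inner algebra_simps add_divide_distrib diff_divide_distrib)
qed

lemma energy_decseq: "decseq energy"
proof (rule decseq_SucI)
  fix n
  have "0 \<le> (1 - 2 * \<beta>) / 2 * (norm (d (Suc n)))\<^sup>2" using \<beta> by simp
  with energy_descent[of n] show "energy (Suc n) \<le> energy n" by linarith
qed

lemma energy_limit: "\<exists>e. energy \<longlonglongrightarrow> e \<and> (\<forall>n. e \<le> energy n)"
proof -
  obtain m where m: "\<And>u. m \<le> f u" using bdd by (auto simp: bdd_below_def)
  have "\<gamma> * m \<le> energy n" for n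
    using m[of "x (Suc n)"] \<gamma> \<beta> by (simp add: energy_def add_increasing2)
  then have "\<forall>n. \<gamma> * m \<le> energy n" by blast
  from decseq_convergent[OF energy_decseq this] show ?thesis by metis
qed

lemma d_tendsto_0: "d \<longlonglongrightarrow> 0"
proof -
  obtain e where e: "energy \<longlonglongrightarrow> e" using energy_limit by blast
  have a: "0 < (1 - 2 * \<beta>) / 2" using \<beta> by simp
  have "(\<lambda>n. (energy n - energy (Suc n)) / ((1 - 2 * \<beta>) / 2)) \<longlonglongrightarrow> (e - e) / ((1 - 2 * \<beta>) / 2)"
    using a by (intro tendsto_intros e LIMSEQ_Suc) auto
  then have lim: "(\<lambda>n. (energy n - energy (Suc n)) / ((1 - 2 * \<beta>) / 2)) \<longlonglongrightarrow> 0" by simp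
  have "(norm (d (Suc n)))\<^sup>2 \<le> (energy n - energy (Suc n)) / ((1 - 2 * \<beta>) / 2)" for n
    using energy_descent[of n] a by (subst pos_le_divide_eq[OF a]) (simp add: mult.commute)
  then have "(\<lambda>n. (norm (d (Suc n)))\<^sup>2) \<longlonglongrightarrow> 0"
    by (intro tendsto_sandwich[OF _ _ tendsto_const lim]) auto
  from tendsto_real_sqrt[OF this] have "(\<lambda>n. norm (d (Suc n))) \<longlonglongrightarrow> 0" by simp
  then have "(\<lambda>n. d (Suc n)) \<longlonglongrightarrow> 0" by (rule tendsto_norm_zero_cancel)
  then show ?thesis by (rule LIMSEQ_imp_Suc)
qed

theorem gradient_tendsto_0: "(\<lambda>n. G (x n)) \<longlonglongrightarrow> 0"
proof -
  have "(\<lambda>n. (1 / \<gamma>) *\<^sub>R (\<beta> *\<^sub>R d n - d (Suc n))) \<longlonglongrightarrow> (1 / \<gamma>) *\<^sub>R (\<beta> *\<^sub>R 0 - 0)"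
    by (intro tendsto_intros d_tendsto_0 LIMSEQ_Suc[OF d_tendsto_0])
  moreover have "(1 / \<gamma>) *\<^sub>R (\<beta> *\<^sub>R d n - d (Suc n)) = G (x (n + 2))" for n
    using \<gamma> by (simp add: gradient_step[symmetric])
  ultimately have "(\<lambda>n. G (x (n + 2))) \<longlonglongrightarrow> 0" by simp
  then show ?thesis by (rule LIMSEQ_offset)
qed

text \<open>The energy gap \<open>r\<close> consists of \<open>t\<close>, the gap of the values multiplied by \<open>\<gamma>\<close>, and of a
  quadratic term. If \<open>t\<close> dominates, the Lojasiewicz inequality bounds \<open>r\<^sup>\<theta>\<close> by the gradient, which is a
  combination of two steps. If the quadratic term dominates, then \<open>r\<^sup>\<theta>\<close> is at most the step itself,
  as \<open>2 \<theta> \<ge> 1\<close> and the steps are eventually below 1.\<close>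

theorem finite_length:
  assumes bounded: "\<And>n. norm (x (Suc n)) \<le> R"
    and loja: "\<And>c. \<exists>\<theta> C \<epsilon>. 1 / 2 \<le> \<theta> \<and> \<theta> < 1 \<and> 0 < C \<and> 0 < \<epsilon> \<and>
       (\<forall>u. norm u \<le> R \<and> c < f u \<and> f u < c + \<epsilon> \<longrightarrow> (f u - c) powr \<theta> \<le> C * norm (G u))"
  shows "convergent x"
proof -
  obtain e where e: "energy \<longlonglongrightarrow> e" "\<And>n. e \<le> energy n" using energy_limit by blast
  define c where "c = e / \<gamma>"
  have \<gamma>c: "\<gamma> * c = e" using \<gamma> by (simp add: c_def)
  obtain \<theta> C \<epsilon> where \<theta>: "1 / 2 \<le> \<theta>" "\<theta> < 1" and C: "0 < C" and \<epsilon>: "0 < \<epsilon>"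
    and KL: "\<And>u. norm u \<le> R \<Longrightarrow> c < f u \<Longrightarrow> f u < c + \<epsilon> \<Longrightarrow> (f u - c) powr \<theta> \<le> C * norm (G u)"
    using loja[of c] by blast
  have nd: "(\<lambda>n. norm (d n)) \<longlonglongrightarrow> 0" by (rule tendsto_norm_zero[OF d_tendsto_0])
  have "(\<lambda>n. (energy n - \<beta> / 2 * (norm (d n))\<^sup>2) / \<gamma>) \<longlonglongrightarrow> (e - \<beta> / 2 * 0\<^sup>2) / \<gamma>"
    by (rule tendsto_divide[OF tendsto_diff[OF e(1) tendsto_mult[OF tendsto_const tendsto_power[OF nd]]] tendsto_const])
       (use \<gamma> in simp)
  moreover have "(energy n - \<beta> / 2 * (norm (d n))\<^sup>2) / \<gamma> = f (x (Suc n))" for n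
    using \<gamma> by (simp add: energy_def)
  ultimately have "(\<lambda>n. f (x (Suc n))) \<longlonglongrightarrow> c" by (simp add: c_def)
  then have "eventually (\<lambda>n. f (x (Suc n)) < c + \<epsilon>) sequentially"
    by (rule order_tendstoD(2)) (use \<epsilon> in simp)
  moreover have "eventually (\<lambda>n. norm (d n) < 1) sequentially"
    by (rule order_tendstoD(2)[OF nd]) simp
  ultimately have "eventually (\<lambda>n. f (x (Suc n)) < c + \<epsilon> \<and> norm (d n) < 1) sequentially" by (rule eventually_conj)
  then obtain N where N: "\<And>n. N \<le> n \<Longrightarrow> f (x (Suc n)) < c + \<epsilon>" "\<And>n. N \<le> n \<Longrightarrow> norm (d n) < 1"
    unfolding eventually_sequentially by blast
  define r where "r = (\<lambda>n. energy n - e)"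
  define C' where "C' = 1 + (2 * \<gamma>) powr \<theta> * (C / \<gamma>)"
  have C': "0 < C'" using C \<gamma> by (simp add: C'_def add_pos_nonneg)
  have "summable (\<lambda>n. norm (d n))"
  proof (rule finite_length_if_lojasiewicz_step[where r = r and a = "(1 - 2 * \<beta>) / 2" and C = C' and \<theta> = \<theta> and N = N])
    show "r (Suc n) + (1 - 2 * \<beta>) / 2 * (norm (d (Suc n)))\<^sup>2 \<le> r n" for n
      using energy_descent[of n] by (simp add: r_def)
    show "r (Suc n) powr \<theta> \<le> C' * (norm (d n) + norm (d (Suc n)))" if n: "N \<le> n" and pos: "0 < r (Suc n)" for n
    proof -
      define D where "D = norm (d (Suc n))"
      define t where "t = \<gamma> * (f (x (Suc (Suc n))) - c)"
      have r_eq: "r (Suc n) = t + \<beta> / 2 * D\<^sup>2"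
        using \<gamma>c by (simp add: r_def energy_def t_def D_def algebra_simps)
      have D: "0 \<le> D" "D < 1" using N(2)[of "Suc n"] n by (simp_all add: D_def)
      show ?thesis
      proof (cases "t \<le> \<beta> / 2 * D\<^sup>2")
        case True
        have "\<beta> * D\<^sup>2 \<le> 1 * D\<^sup>2" using \<beta> by (intro mult_right_mono) auto
        then have "r (Suc n) \<le> D\<^sup>2" using True r_eq by simp
        with pos have "D \<noteq> 0" by auto
        with D have D0: "0 < D" by simp
        have "r (Suc n) powr \<theta> \<le> (D\<^sup>2) powr \<theta>"
          using \<open>r (Suc n) \<le> D\<^sup>2\<close> pos \<theta> by (intro powr_mono2) auto
        also have "(D\<^sup>2) powr \<theta> = D powr (2 * \<theta>)"
          using D0 powr_powr[of D 2 \<theta>] by (simp add: powr_numeral)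
        also have "\<dots> \<le> D powr 1" using D D0 \<theta> by (intro powr_mono') auto
        also have "\<dots> = 1 * D" using D0 by simp
        also have "\<dots> \<le> C' * (norm (d n) + norm (d (Suc n)))"
          using C \<gamma> by (intro mult_mono) (auto simp: C'_def D_def)
        finally show ?thesis .
      next
        case False
        moreover have "0 \<le> \<beta> / 2 * D\<^sup>2" using \<beta> by simp
        ultimately have tpos: "0 < t" by linarith
        then have fc: "c < f (x (Suc (Suc n)))" using \<gamma> by (simp add: t_def zero_less_mult_iff)
        have fc': "f (x (Suc (Suc n))) < c + \<epsilon>" using N(1)[of "Suc n"] n by simp
        have "norm (\<gamma> *\<^sub>R G (x (Suc (Suc n)))) \<le> norm (\<beta> *\<^sub>R d n) + norm (d (Suc n))"
          unfolding gradient_step by (rule norm_triangle_ineq4)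
        also have "norm (\<beta> *\<^sub>R d n) \<le> 1 * norm (d n)" using \<beta> by (simp add: mult_right_le_one_le mult_left_le_one_le)
        finally have G: "norm (G (x (Suc (Suc n)))) \<le> (norm (d n) + norm (d (Suc n))) / \<gamma>"
          using \<gamma> by (simp add: field_simps)
        have "r (Suc n) powr \<theta> \<le> (2 * t) powr \<theta>"
          using False r_eq pos \<theta> by (intro powr_mono2) auto
        also have "2 * t = (2 * \<gamma>) * (f (x (Suc (Suc n))) - c)" by (simp add: t_def)
        also have "\<dots> powr \<theta> = (2 * \<gamma>) powr \<theta> * (f (x (Suc (Suc n))) - c) powr \<theta>"
          by (rule powr_mult)
        also have "\<dots> \<le> (2 * \<gamma>) powr \<theta> * (C * ((norm (d n) + norm (d (Suc n))) / \<gamma>))"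
          using KL[OF bounded fc fc'] mult_left_mono[OF G, of C] C by (intro mult_left_mono) auto
        also have "\<dots> \<le> C' * (norm (d n) + norm (d (Suc n)))"
          by (simp add: C'_def algebra_simps)
        finally show ?thesis .
      qed
    qed
  qed (use \<theta> \<beta> C' e(2) in \<open>auto simp: r_def\<close>)
  then show ?thesis by (intro convergent_if_finite_length) (simp add: d_def)
qed

end

section \<open>From the Hessian bound and semi-algebraicity to convergence\<close>

text \<open>The Hessian bound makes the gradient Lipschitz, and the mean value inequality on the segment from
  \<open>x\<close> to \<open>y\<close> gives the expansion.\<close>

lemma twice_differentiable_quadratic_bound:
  fixes f :: "real ^ 'n \<Rightarrow> real"
  assumes f: "twice_continuously_differentiable f" and L: "\<And>u. spectral_norm (hessian f u) \<le> L"
  shows "continuous_on UNIV (grad f)" "continuous_on UNIV f"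
    "\<bar>f y - f x - grad f x \<bullet> (y - x)\<bar> \<le> L * ((y - x) \<bullet> (y - x))"
proof -
  have fd: "\<And>u. f differentiable (at u)" and gd: "\<And>u. grad f differentiable (at u)"
    using f by (auto simp: twice_continuously_differentiable_def)
  have L0: "0 \<le> L"
    using L[of 0] onorm_pos_le[of "\<lambda>v. hessian f 0 *v v"] by (simp add: spectral_norm_def matrix_vector_mul_bounded_linear)
  have der: "(f has_derivative (\<lambda>h. h \<bullet> grad f u)) (at u)" for u
    using GDERIV_grad[OF fd] by (simp add: gderiv_def)
  show "continuous_on UNIV f"
    using fd differentiable_imp_continuous_within by (auto simp: continuous_on_eq_continuous_within)
  show "continuous_on UNIV (grad f)"
    using gd differentiable_imp_continuous_within by (auto simp: continuous_on_eq_continuous_within)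
  have hess: "(grad f has_derivative (\<lambda>v. hessian f u *v v)) (at u)" for u
    using jacobian_works[of "grad f" "at u"] gd by (simp add: hessian_def)
  have lip: "norm (grad f u - grad f v) \<le> L * norm (u - v)" for u v
  proof (rule differentiable_bound[of UNIV])
    show "onorm (\<lambda>v. hessian f w *v v) \<le> L" for w using L[of w] by (simp add: spectral_norm_def)
  qed (use hess in auto)
  have "norm (f y - f x - (y - x) \<bullet> grad f x) \<le> norm (y - x) * (L * norm (y - x))"
  proof (rule differentiable_bound_linearization[where S = "closed_segment x y" and f' = "\<lambda>u h. h \<bullet> grad f u"])
    show "x + t *\<^sub>R (y - x) \<in> closed_segment x y" if "t \<in> {0..1}" for t
      using that by (auto simp: closed_segment_def algebra_simps intro!: exI[of _ t])
    show "(f has_derivative (\<lambda>h. h \<bullet> grad f u)) (at u within closed_segment x y)" for u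
      using der has_derivative_at_withinI by blast
    show "x \<in> closed_segment x y" by simp
    fix u assume u: "u \<in> closed_segment x y"
    have "onorm (\<lambda>h. h \<bullet> grad f u - h \<bullet> grad f x) \<le> norm (grad f u - grad f x)"
    proof (rule onorm_le)
      fix h
      have "norm (h \<bullet> grad f u - h \<bullet> grad f x) = \<bar>h \<bullet> (grad f u - grad f x)\<bar>" by (simp add: inner_diff_right)
      also have "\<dots> \<le> norm h * norm (grad f u - grad f x)" by (rule Cauchy_Schwarz_ineq2)
      finally show "norm (h \<bullet> grad f u - h \<bullet> grad f x) \<le> norm (grad f u - grad f x) * norm h" by (simp add: mult.commute)
    qed
    also have "\<dots> \<le> L * norm (u - x)" by (rule lip)
    also have "\<dots> \<le> L * norm (y - x)"
      using segment_bound(1)[OF u] L0 by (intro mult_left_mono) auto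
    finally show "onorm ((\<lambda>h. h \<bullet> grad f u) - (\<lambda>h. h \<bullet> grad f x)) \<le> L * norm (y - x)"
      by (simp add: fun_diff_def)
  qed
  then show "\<bar>f y - f x - grad f x \<bullet> (y - x)\<bar> \<le> L * ((y - x) \<bullet> (y - x))"
    by (simp add: inner_commute dot_square_norm power2_eq_square ac_simps)
qed

text \<open>Membership in the given union of basic sets depends only on the signs of the defining
  polynomials.\<close>

lemma semialgebraic_definable_fun:
  fixes f :: "'a::euclidean_space \<Rightarrow> real"
  assumes "semialgebraic f"
  shows "definable_fun f"
proof -
  obtain p q :: nat and g h where gh:
    "\<forall>i<p. \<forall>j<q. real_polynomial_function (g i j) \<and> real_polynomial_function (h i j)"
    "{(x, y). y = f x} = (\<Union>i<p. \<Inter>j<q. {x. g i j x = 0 \<and> h i j x < 0})"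
    using assms unfolding semialgebraic_def semialgebraic_set_def by blast
  have eq: "snd z = f (fst z) \<longleftrightarrow> (\<exists>i<p. \<forall>j<q. g i j z = 0 \<and> h i j z < 0)" for z
  proof -
    have "snd z = f (fst z) \<longleftrightarrow> z \<in> {(x, y). y = f x}" by (auto simp: case_prod_beta)
    then show ?thesis unfolding gh(2) by auto
  qed
  define B where "B = (\<lambda>(i, j). g i j) ` ({..<p} \<times> {..<q}) \<union> (\<lambda>(i, j). h i j) ` ({..<p} \<times> {..<q})"
  show ?thesis
    unfolding definable_fun_def definable_def eq
  proof (intro exI[of _ B] conjI allI impI)
    show "finite B" by (simp add: B_def)
    show "\<forall>b\<in>B. real_polynomial_function b" using gh(1) by (auto simp: B_def)
    fix z w assume sg: "\<forall>b\<in>B. sgn (b z) = sgn (b w)"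
    have "(g i j z = 0 \<longleftrightarrow> g i j w = 0) \<and> (h i j z < 0 \<longleftrightarrow> h i j w < 0)" if "i < p" "j < q" for i j
    proof -
      have "g i j \<in> B" "h i j \<in> B" using that by (force simp: B_def)+
      then have "sgn (g i j z) = sgn (g i j w)" "sgn (h i j z) = sgn (h i j w)" using sg by blast+
      then show ?thesis by (metis sgn_zero_iff sgn_less)
    qed
    then show "(\<exists>i<p. \<forall>j<q. g i j z = 0 \<and> h i j z < 0) \<longleftrightarrow> (\<exists>i<p. \<forall>j<q. g i j w = 0 \<and> h i j w < 0)"
      by blast
  qed
qed

theorem lemma3:
  fixes f :: "real ^ 'n \<Rightarrow> real" and x :: "nat \<Rightarrow> real ^ 'n" and L \<beta> \<gamma> :: real
  assumes "twice_continuously_differentiable f"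
    and "L > 0"
    and "\<And>u. spectral_norm (hessian f u) \<le> L"
    and "bdd_below (range f)"
    and "0 < \<beta>" and "\<beta> < 1 / 2"
    and "\<gamma> > 0"
    and "\<And>k. k \<ge> 1 \<Longrightarrow>
           x (k + 1) \<in> Prox (\<lambda>u. \<gamma> * f u) (x k + \<beta> *\<^sub>R (x k - x (k - 1)))"
  shows "(\<lambda>k. norm (grad f (x k))) \<longlonglongrightarrow> 0 \<and>
         (semialgebraic f \<and> coercive f \<longrightarrow>
            (\<exists>xs. critical_point f xs \<and> x \<longlonglongrightarrow> xs))"
proof -
  note smooth = twice_differentiable_quadratic_bound[OF assms(1,3)]
  interpret heavy_ball f "grad f" L \<beta> \<gamma> x
  proof
    show "x (Suc (Suc n)) \<in> Prox (\<lambda>u. \<gamma> * f u) (x (Suc n) + \<beta> *\<^sub>R (x (Suc n) - x n))" for n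
      using assms(8)[of "Suc n"] by simp
  qed (use assms smooth(3) in auto)
  have "\<exists>xs. critical_point f xs \<and> x \<longlonglongrightarrow> xs" if sa: "semialgebraic f" and co: "coercive f"
  proof -
    interpret smooth_definable f "grad f" L
      by unfold_locales (use assms smooth semialgebraic_definable_fun[OF sa] in auto)
    have "eventually (\<lambda>u. energy 0 / \<gamma> < f u) at_infinity"
      using co unfolding coercive_def filterlim_at_top_dense by blast
    then obtain R where R: "\<And>u. R \<le> norm u \<Longrightarrow> energy 0 / \<gamma> < f u"
      unfolding eventually_at_infinity by blast
    have "norm (x (Suc n)) \<le> R" for n
    proof (rule ccontr)
      assume "\<not> ?thesis"
      then have "energy 0 / \<gamma> < f (x (Suc n))" by (intro R) simp
      then have "energy 0 < \<gamma> * f (x (Suc n))" using assms(7) by (simp add: field_simps)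
      moreover have "0 \<le> \<beta> / 2 * (norm (d n))\<^sup>2" using assms(5) by simp
      moreover have "energy n \<le> energy 0" using decseqD[OF energy_decseq, of 0 n] by simp
      ultimately show False by (simp add: energy_def)
    qed
    from finite_length[OF this lojasiewicz_inequality]
    obtain xs where xs: "x \<longlonglongrightarrow> xs" by (auto simp: convergent_def)
    have "(\<lambda>k. grad f (x k)) \<longlonglongrightarrow> grad f xs"
      by (rule continuous_on_tendsto_compose[OF smooth(1) xs]) auto
    with gradient_tendsto_0 have "grad f xs = 0" by (rule LIMSEQ_unique[symmetric])
    moreover have "f differentiable (at xs)"
      using assms(1) by (simp add: twice_continuously_differentiable_def)
    ultimately show ?thesis using xs by (auto simp: critical_point_def)
  qed
  with tendsto_norm_zero[OF gradient_tendsto_0] show ?thesis by blast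
qed

end
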